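(* Let $A$ be a unital star algebra over $\mathbb{C}$, let $L$ be a weak left line module over $A$, and let $G:\overline{L}\to L^\circ$ be a non-degenerate Hermitian structure on $L$. Define conjugate-linear star maps $L\to L^\circ$ and $L^\circ\to L$ by $x^*=G(\overline{x})$ for $x\in L$, and, for $y\in L^\circ$, $y^*\in L$ is the element with $\overline{y^*}=G^{-1}(y)$. Extend these, together with the star of $A$, to $T_{\mathbb{Z}}(L)$ by order reversal, $$x_1\otimes x_2\otimes\cdots\otimes x_m\longmapsto x_m^*\otimes\cdots\otimes x_2^*\otimes x_1^* .$$ Then $T_{\mathbb{Z}}(L)$ becomes a star algebra.
   Context: For an $A$-bimodule $E$, $E^\circ={}_A\mathrm{Hom}(E,A)$ (left module maps), a bimodule with $(\alpha.a)(e)=\alpha(e)a$ and $(a.\alpha)(e)=\alpha(e.a)$. If $E$ is finitely generated projective as a left module, with dual basis $e^i\in E$, $e_i\in E^\circ$ ($f=\sum_i e_i(f).e^i$ for all $f\in E$), there are bimodule maps $\mathrm{ev}:E\otimes_A E^\circ\to A$, $\mathrm{ev}(e\otimes\alpha)=\alpha(e)$, and $\mathrm{coev}:A\to E^\circ\otimes_A E$, $\mathrm{coev}(1)=\sum_i e_i\otimes e^i$. A weak left line module is an $A$-bimodule $L$, finitely generated projective as a left $A$-module, such that $\mathrm{coev}:A\to L^\circ\otimes_A L$ is an isomorphism. The conjugate bimodule $\overline{E}$ is the conjugate vector space with elements $\overline{e}$, $e\in E$, and actions $a.\overline{e}=\overline{e.a^*}$, $\overline{e}.a=\overline{a^*.e}$.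 A non-degenerate Hermitian structure on $E$ is an invertible $A$-bimodule map $G:\overline{E}\to E^\circ$ such that the inner product $\langle e,\overline{f}\rangle=\mathrm{ev}(e\otimes G(\overline f))$ satisfies $\langle e,\overline f\rangle=\langle f,\overline e\rangle^*$ for all $e,f\in E$ (no positivity is assumed). $T_{\mathbb{Z}}(L)=\bigoplus_{n\in\mathbb{Z}}L^n$ with $L^0=A$, $L^n=L^{\otimes_A n}$ and $L^{-n}=(L^\circ)^{\otimes_A n}$ for $n\ge1$. Define recursively $\mathrm{ev}^1=\mathrm{ev}$, $\mathrm{ev}^{n+1}=\mathrm{ev}(\mathrm{id}\otimes\mathrm{ev}^n\otimes\mathrm{id}):L^{n+1}\otimes_A L^{-n-1}\to A$ and $\tilde{\mathrm{ev}}^1=\mathrm{coev}^{-1}$, $\tilde{\mathrm{ev}}^{n+1}=\mathrm{coev}^{-1}(\mathrm{id}\otimes\tilde{\mathrm{ev}}^n\otimes\mathrm{id}):L^{-n-1}\otimes_A L^{n+1}\to A$. The (associative) product $L^n\otimes_A L^m\to L^{n+m}$ is $\otimes_A$ if $n,m$ have the same sign (and the $A$-action if one is $0$). For $n,m>0$ it is, on $L^{-n}\otimes_A L^m$, $\tilde{\mathrm{ev}}^n\otimes\mathrm{id}$ if $m\ge n$ and $\mathrm{id}\otimes\tilde{\mathrm{ev}}^m$ if $m\le n$; on $L^n\otimes_A L^{-m}$, $\mathrm{ev}^n\otimes\mathrm{id}$ if $m\ge n$ and $\mathrm{id}\otimes\mathrm{ev}^m$ if $m\le n$. A star algebra is an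 algebra with a conjugate-linear involution satisfying $(st)^*=t^*s^*$. *)

theory Defs
  imports
    Complex_Main
    "HOL-Algebra.Module"
    "HOL-Algebra.Coset"
    "HOL-Algebra.Generated_Groups"
    "HOL-Algebra.Product_Groups"
    "HOL-Algebra.Free_Abelian_Groups"
    "HOL-Algebra.Algebraic_Closure_Type"
begin

section \<open>Complex algebras and star algebras\<close>

abbreviation complex_ring :: "complex ring" where
  "complex_ring \<equiv> ring_of_type_algebra"

text \<open>The locale \<^locale>\<open>algebra\<close> only covers commutative algebras.\<close>

definition complex_algebra :: "(complex, 'a, 'm) module_scheme \<Rightarrow> bool" where
  "complex_algebra A \<longleftrightarrow> ring A \<and> module complex_ring A \<and>
     (\<forall>c. \<forall>x\<in>carrier A. \<forall>y\<in>carrier A.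
        (c \<odot>\<^bsub>A\<^esub> x) \<otimes>\<^bsub>A\<^esub> y = c \<odot>\<^bsub>A\<^esub> (x \<otimes>\<^bsub>A\<^esub> y) \<and>
        x \<otimes>\<^bsub>A\<^esub> (c \<odot>\<^bsub>A\<^esub> y) = c \<odot>\<^bsub>A\<^esub> (x \<otimes>\<^bsub>A\<^esub> y))"

record 'a star_alg = "(complex, 'a) module" +
  star :: "'a \<Rightarrow> 'a"

definition star_algebra :: "('a, 'm) star_alg_scheme \<Rightarrow> bool" where
  "star_algebra A \<longleftrightarrow> complex_algebra A \<and>
     (\<forall>x\<in>carrier A. star A x \<in> carrier A) \<and>
     (\<forall>x\<in>carrier A. \<forall>y\<in>carrier A. star A (x \<oplus>\<^bsub>A\<^esub> y) = star A x \<oplus>\<^bsub>A\<^esub> star A y) \<and>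
     (\<forall>c. \<forall>x\<in>carrier A. star A (c \<odot>\<^bsub>A\<^esub> x) = cnj c \<odot>\<^bsub>A\<^esub> star A x) \<and>
     (\<forall>x\<in>carrier A. star A (star A x) = x) \<and>
     (\<forall>x\<in>carrier A. \<forall>y\<in>carrier A. star A (x \<otimes>\<^bsub>A\<^esub> y) = star A y \<otimes>\<^bsub>A\<^esub> star A x)"

section \<open>Bimodules\<close>

text \<open>As for \<^locale>\<open>module\<close>, the fields \<^const>\<open>mult\<close> and \<^const>\<open>one\<close> inherited from rings are not
  used.\<close>

record ('a, 'e) bimod = "(complex, 'e) module" +
  lact :: "'a \<Rightarrow> 'e \<Rightarrow> 'e"
  ract :: "'e \<Rightarrow> 'a \<Rightarrow> 'e"

definition bimodule :: "(complex, 'a, 'm) module_scheme \<Rightarrow> ('a, 'e) bimod \<Rightarrow> bool" where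
  "bimodule A E \<longleftrightarrow> module complex_ring E \<and>
     (\<forall>a\<in>carrier A. \<forall>x\<in>carrier E. lact E a x \<in> carrier E \<and> ract E x a \<in> carrier E) \<and>
     (\<forall>a\<in>carrier A. \<forall>x\<in>carrier E. \<forall>y\<in>carrier E.
        lact E a (x \<oplus>\<^bsub>E\<^esub> y) = lact E a x \<oplus>\<^bsub>E\<^esub> lact E a y \<and>
        ract E (x \<oplus>\<^bsub>E\<^esub> y) a = ract E x a \<oplus>\<^bsub>E\<^esub> ract E y a) \<and>
     (\<forall>a\<in>carrier A. \<forall>b\<in>carrier A. \<forall>x\<in>carrier E.
        lact E (a \<oplus>\<^bsub>A\<^esub> b) x = lact E a x \<oplus>\<^bsub>E\<^esub> lact E b x \<and>
        ract E x (a \<oplus>\<^bsub>A\<^esub> b) = ract E x a \<oplus>\<^bsub>E\<^esub> ract E x b \<and>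
        lact E (a \<otimes>\<^bsub>A\<^esub> b) x = lact E a (lact E b x) \<and>
        ract E x (a \<otimes>\<^bsub>A\<^esub> b) = ract E (ract E x a) b \<and>
        ract E (lact E a x) b = lact E a (ract E x b)) \<and>
     (\<forall>x\<in>carrier E. lact E \<one>\<^bsub>A\<^esub> x = x \<and> ract E x \<one>\<^bsub>A\<^esub> = x) \<and>
     (\<forall>c. \<forall>a\<in>carrier A. \<forall>x\<in>carrier E.
        lact E (c \<odot>\<^bsub>A\<^esub> a) x = c \<odot>\<^bsub>E\<^esub> lact E a x \<and> lact E a (c \<odot>\<^bsub>E\<^esub> x) = c \<odot>\<^bsub>E\<^esub> lact E a x \<and>
        ract E x (c \<odot>\<^bsub>A\<^esub> a) = c \<odot>\<^bsub>E\<^esub> ract E x a \<and> ract E (c \<odot>\<^bsub>E\<^esub> x) a = c \<odot>\<^bsub>E\<^esub> ract E x a)"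

text \<open>Since the algebras are unital, additive maps that are linear for one of the two actions are
  automatically complex linear.\<close>

definition left_hom ::
  "(complex, 'a, 'm) module_scheme \<Rightarrow> ('a, 'e) bimod \<Rightarrow> ('a, 'f) bimod \<Rightarrow> ('e \<Rightarrow> 'f) set" where
  "left_hom A E F = {h \<in> carrier E \<rightarrow> carrier F.
     (\<forall>x\<in>carrier E. \<forall>y\<in>carrier E. h (x \<oplus>\<^bsub>E\<^esub> y) = h x \<oplus>\<^bsub>F\<^esub> h y) \<and>
     (\<forall>a\<in>carrier A. \<forall>x\<in>carrier E. h (lact E a x) = lact F a (h x))}"

definition bimod_hom ::
  "(complex, 'a, 'm) module_scheme \<Rightarrow> ('a, 'e) bimod \<Rightarrow> ('a, 'f) bimod \<Rightarrow> ('e \<Rightarrow> 'f) set" where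
  "bimod_hom A E F = {h \<in> left_hom A E F.
     \<forall>a\<in>carrier A. \<forall>x\<in>carrier E. h (ract E x a) = ract F (h x) a}"

definition bimod_iso ::
  "(complex, 'a, 'm) module_scheme \<Rightarrow> ('a, 'e) bimod \<Rightarrow> ('a, 'f) bimod \<Rightarrow> ('e \<Rightarrow> 'f) set" where
  "bimod_iso A E F = {h \<in> bimod_hom A E F. bij_betw h (carrier E) (carrier F)}"

definition self_bimod :: "(complex, 'a, 'm) module_scheme \<Rightarrow> ('a, 'a) bimod" where
  "self_bimod A = \<lparr>carrier = carrier A, monoid.mult = undefined, one = undefined,
     zero = \<zero>\<^bsub>A\<^esub>, add = (\<oplus>\<^bsub>A\<^esub>), module.smult = (\<odot>\<^bsub>A\<^esub>), lact = (\<otimes>\<^bsub>A\<^esub>), ract = (\<otimes>\<^bsub>A\<^esub>)\<rparr>"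

definition free_bimod :: "(complex, 'a, 'm) module_scheme \<Rightarrow> nat \<Rightarrow> ('a, nat \<Rightarrow> 'a) bimod" where
  "free_bimod A n = \<lparr>carrier = {..<n} \<rightarrow>\<^sub>E carrier A, monoid.mult = undefined, one = undefined,
     zero = (\<lambda>i\<in>{..<n}. \<zero>\<^bsub>A\<^esub>), add = (\<lambda>x y. \<lambda>i\<in>{..<n}. x i \<oplus>\<^bsub>A\<^esub> y i),
     module.smult = (\<lambda>c x. \<lambda>i\<in>{..<n}. c \<odot>\<^bsub>A\<^esub> x i),
     lact = (\<lambda>a x. \<lambda>i\<in>{..<n}. a \<otimes>\<^bsub>A\<^esub> x i), ract = (\<lambda>x a. \<lambda>i\<in>{..<n}. x i \<otimes>\<^bsub>A\<^esub> a)\<rparr>"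

text \<open>Finitely generated projective as a left module: a direct summand (retract) of some \<open>A\<^sup>n\<close>.\<close>

definition left_fgp :: "(complex, 'a, 'm) module_scheme \<Rightarrow> ('a, 'e) bimod \<Rightarrow> bool" where
  "left_fgp A E \<longleftrightarrow> (\<exists>n. \<exists>i \<in> left_hom A E (free_bimod A n). \<exists>p \<in> left_hom A (free_bimod A n) E.
     \<forall>x\<in>carrier E. p (i x) = x)"

text \<open>Elements of the dual are cut off outside the carrier, so that equality of functions is
  equality of left module maps.\<close>

definition dual :: "(complex, 'a, 'm) module_scheme \<Rightarrow> ('a, 'e) bimod \<Rightarrow> ('a, 'e \<Rightarrow> 'a) bimod" where
  "dual A E = \<lparr>carrier = left_hom A E (self_bimod A) \<inter> extensional (carrier E),
     monoid.mult = undefined, one = undefined,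
     zero = (\<lambda>x\<in>carrier E. \<zero>\<^bsub>A\<^esub>), add = (\<lambda>\<alpha> \<beta>. \<lambda>x\<in>carrier E. \<alpha> x \<oplus>\<^bsub>A\<^esub> \<beta> x),
     module.smult = (\<lambda>c \<alpha>. \<lambda>x\<in>carrier E. c \<odot>\<^bsub>A\<^esub> \<alpha> x),
     lact = (\<lambda>a \<alpha>. \<lambda>x\<in>carrier E. \<alpha> (ract E x a)),
     ract = (\<lambda>\<alpha> a. \<lambda>x\<in>carrier E. \<alpha> x \<otimes>\<^bsub>A\<^esub> a)\<rparr>"

text \<open>The conjugate bimodule has the same underlying set: the element \<open>x\<close> of \<open>conj_bimod A E\<close> stands
  for the conjugate of \<open>x\<close>.\<close>

definition conj_bimod :: "('a, 'm) star_alg_scheme \<Rightarrow> ('a, 'e) bimod \<Rightarrow> ('a, 'e) bimod" where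
  "conj_bimod A E = \<lparr>carrier = carrier E, monoid.mult = undefined, one = undefined,
     zero = \<zero>\<^bsub>E\<^esub>, add = (\<oplus>\<^bsub>E\<^esub>), module.smult = (\<lambda>c x. cnj c \<odot>\<^bsub>E\<^esub> x),
     lact = (\<lambda>a x. ract E x (star A a)), ract = (\<lambda>x a. lact E (star A a) x)\<rparr>"

section \<open>Bimodules presented by generators and relations\<close>

text \<open>The quotient of the free abelian group on \<open>W\<close> by the subgroup generated by \<open>R\<close>, written
  additively, and the class of a generator in it.\<close>

definition presented :: "'w set \<Rightarrow> ('w \<Rightarrow>\<^sub>0 int) set \<Rightarrow> ('w \<Rightarrow>\<^sub>0 int) set ring" where
  "presented W R =
     (let Q = free_Abelian_group W Mod generate (free_Abelian_group W) R in
      \<lparr>carrier = carrier Q, monoid.mult = undefined, one = undefined,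
       zero = \<one>\<^bsub>Q\<^esub>, add = (\<otimes>\<^bsub>Q\<^esub>)\<rparr>)"

definition gen_class :: "'w set \<Rightarrow> ('w \<Rightarrow>\<^sub>0 int) set \<Rightarrow> 'w \<Rightarrow> ('w \<Rightarrow>\<^sub>0 int) set" where
  "gen_class W R w = generate (free_Abelian_group W) R #>\<^bsub>free_Abelian_group W\<^esub> frag_of w"

text \<open>\<open>induced T f\<close> is the additive map to \<open>T\<close> that takes the value \<open>f w\<close> on the class of each
  generator \<open>w\<close>: the additive extension of \<open>f\<close> to the free abelian group takes a single value on
  each coset if it kills the relations.\<close>

definition free_extend :: "('t, 'm) ring_scheme \<Rightarrow> ('w \<Rightarrow> 't) \<Rightarrow> ('w \<Rightarrow>\<^sub>0 int) \<Rightarrow> 't" where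
  "free_extend T f x =
     (\<Oplus>\<^bsub>T\<^esub>w\<in>Poly_Mapping.keys x. [Poly_Mapping.lookup x w] \<cdot>\<^bsub>T\<^esub> f w)"

definition induced :: "('t, 'm) ring_scheme \<Rightarrow> ('w \<Rightarrow> 't) \<Rightarrow> ('w \<Rightarrow>\<^sub>0 int) set \<Rightarrow> 't" where
  "induced T f U = the_elem (free_extend T f ` U)"

definition presented_bimod ::
  "'w set \<Rightarrow> ('w \<Rightarrow>\<^sub>0 int) set \<Rightarrow> (complex \<Rightarrow> 'w \<Rightarrow> 'w) \<Rightarrow> ('a \<Rightarrow> 'w \<Rightarrow> 'w) \<Rightarrow> ('w \<Rightarrow> 'a \<Rightarrow> 'w)
     \<Rightarrow> ('a, ('w \<Rightarrow>\<^sub>0 int) set) bimod" where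
  "presented_bimod W R s l r =
     \<lparr>carrier = carrier (presented W R), monoid.mult = undefined, one = undefined,
      zero = \<zero>\<^bsub>presented W R\<^esub>, add = (\<oplus>\<^bsub>presented W R\<^esub>),
      module.smult = (\<lambda>c. induced (presented W R) (\<lambda>w. gen_class W R (s c w))),
      lact = (\<lambda>a. induced (presented W R) (\<lambda>w. gen_class W R (l a w))),
      ract = (\<lambda>U a. induced (presented W R) (\<lambda>w. gen_class W R (r w a)) U)\<rparr>"

section \<open>Tensor products over the algebra\<close>

text \<open>No relation for complex scalars is needed: they can be moved across the tensor sign because
  the algebra is unital.\<close>

definition tensor_rels ::
  "(complex, 'a, 'm) module_scheme \<Rightarrow> ('a, 'e) bimod \<Rightarrow> ('a, 'f) bimod \<Rightarrow> ('e \<times> 'f \<Rightarrow>\<^sub>0 int) set" where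
  "tensor_rels A E F =
     {frag_of (x \<oplus>\<^bsub>E\<^esub> x', y) - frag_of (x, y) - frag_of (x', y) | x x' y.
        x \<in> carrier E \<and> x' \<in> carrier E \<and> y \<in> carrier F} \<union>
     {frag_of (x, y \<oplus>\<^bsub>F\<^esub> y') - frag_of (x, y) - frag_of (x, y') | x y y'.
        x \<in> carrier E \<and> y \<in> carrier F \<and> y' \<in> carrier F} \<union>
     {frag_of (ract E x a, y) - frag_of (x, lact F a y) | x a y.
        x \<in> carrier E \<and> a \<in> carrier A \<and> y \<in> carrier F}"

definition tensor ::
  "(complex, 'a, 'm) module_scheme \<Rightarrow> ('a, 'e) bimod \<Rightarrow> ('a, 'f) bimod
     \<Rightarrow> ('a, ('e \<times> 'f \<Rightarrow>\<^sub>0 int) set) bimod" where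
  "tensor A E F = presented_bimod (carrier E \<times> carrier F) (tensor_rels A E F)
     (\<lambda>c (x, y). (c \<odot>\<^bsub>E\<^esub> x, y)) (\<lambda>a (x, y). (lact E a x, y)) (\<lambda>(x, y) a. (x, ract F y a))"

definition tens ::
  "(complex, 'a, 'm) module_scheme \<Rightarrow> ('a, 'e) bimod \<Rightarrow> ('a, 'f) bimod \<Rightarrow> 'e \<Rightarrow> 'f
     \<Rightarrow> ('e \<times> 'f \<Rightarrow>\<^sub>0 int) set" where
  "tens A E F x y = gen_class (carrier E \<times> carrier F) (tensor_rels A E F) (x, y)"

text \<open>The tensor powers (for \<open>n \<ge> 1\<close>) are not built by iterating the binary tensor product, since
  the type would change with \<open>n\<close>.  Instead all \<open>n\<close> factors are tensored at once: the word
  \<open>[x\<^sub>1, \<dots>, x\<^sub>n]\<close> is the generator for \<open>x\<^sub>1 \<otimes> \<dots> \<otimes> x\<^sub>n\<close>, and the relations are additivity in each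
  factor and balancedness between neighbouring factors.\<close>

definition words :: "('a, 'e) bimod \<Rightarrow> nat \<Rightarrow> 'e list set" where
  "words E n = {xs. length xs = n \<and> set xs \<subseteq> carrier E}"

definition tpow_rels ::
  "(complex, 'a, 'm) module_scheme \<Rightarrow> ('a, 'e) bimod \<Rightarrow> nat \<Rightarrow> ('e list \<Rightarrow>\<^sub>0 int) set" where
  "tpow_rels A E n =
     {frag_of (us @ [x \<oplus>\<^bsub>E\<^esub> x'] @ vs) - frag_of (us @ [x] @ vs) - frag_of (us @ [x'] @ vs) | us x x' vs.
        us @ [x] @ vs \<in> words E n \<and> x' \<in> carrier E} \<union>
     {frag_of (us @ [ract E x a, y] @ vs) - frag_of (us @ [x, lact E a y] @ vs) | us x a y vs.
        us @ [x, y] @ vs \<in> words E n \<and> a \<in> carrier A}"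

definition tpow ::
  "(complex, 'a, 'm) module_scheme \<Rightarrow> ('a, 'e) bimod \<Rightarrow> nat \<Rightarrow> ('a, ('e list \<Rightarrow>\<^sub>0 int) set) bimod" where
  "tpow A E n = presented_bimod (words E n) (tpow_rels A E n)
     (\<lambda>c xs. (c \<odot>\<^bsub>E\<^esub> hd xs) # tl xs) (\<lambda>a xs. lact E a (hd xs) # tl xs)
     (\<lambda>xs a. butlast xs @ [ract E (last xs) a])"

definition word_tens ::
  "(complex, 'a, 'm) module_scheme \<Rightarrow> ('a, 'e) bimod \<Rightarrow> 'e list \<Rightarrow> ('e list \<Rightarrow>\<^sub>0 int) set" where
  "word_tens A E xs = gen_class (words E (length xs)) (tpow_rels A E (length xs)) xs"

section \<open>Evaluation, coevaluation, weak line modules, Hermitian structures\<close>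

definition ev ::
  "(complex, 'a, 'm) module_scheme \<Rightarrow> ('a, 'e) bimod \<Rightarrow> ('e \<times> ('e \<Rightarrow> 'a) \<Rightarrow>\<^sub>0 int) set \<Rightarrow> 'a" where
  "ev A E = induced A (\<lambda>(x, \<alpha>). \<alpha> x)"

definition dual_basis ::
  "(complex, 'a, 'm) module_scheme \<Rightarrow> ('a, 'e) bimod \<Rightarrow> nat \<Rightarrow> (nat \<Rightarrow> 'e) \<Rightarrow> (nat \<Rightarrow> 'e \<Rightarrow> 'a) \<Rightarrow> bool" where
  "dual_basis A E n b \<beta> \<longleftrightarrow>
     b \<in> {..<n} \<rightarrow> carrier E \<and> \<beta> \<in> {..<n} \<rightarrow> carrier (dual A E) \<and>
     (\<forall>x\<in>carrier E. x = (\<Oplus>\<^bsub>E\<^esub>i\<in>{..<n}. lact E (\<beta> i x) (b i)))"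

text \<open>The element \<open>coev(1)\<close> does not depend on the dual basis.\<close>

definition coev_one ::
  "(complex, 'a, 'm) module_scheme \<Rightarrow> ('a, 'e) bimod \<Rightarrow> (('e \<Rightarrow> 'a) \<times> 'e \<Rightarrow>\<^sub>0 int) set" where
  "coev_one A E = (SOME t. \<exists>n b \<beta>. dual_basis A E n b \<beta> \<and>
     t = (\<Oplus>\<^bsub>tensor A (dual A E) E\<^esub>i\<in>{..<n}. tens A (dual A E) E (\<beta> i) (b i)))"

definition coev ::
  "(complex, 'a, 'm) module_scheme \<Rightarrow> ('a, 'e) bimod \<Rightarrow> 'a \<Rightarrow> (('e \<Rightarrow> 'a) \<times> 'e \<Rightarrow>\<^sub>0 int) set" where
  "coev A E a = lact (tensor A (dual A E) E) a (coev_one A E)"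

definition coev_inv ::
  "(complex, 'a, 'm) module_scheme \<Rightarrow> ('a, 'e) bimod \<Rightarrow> (('e \<Rightarrow> 'a) \<times> 'e \<Rightarrow>\<^sub>0 int) set \<Rightarrow> 'a" where
  "coev_inv A E = inv_into (carrier A) (coev A E)"

definition weak_left_line_module :: "(complex, 'a, 'm) module_scheme \<Rightarrow> ('a, 'l) bimod \<Rightarrow> bool" where
  "weak_left_line_module A L \<longleftrightarrow> bimodule A L \<and> left_fgp A L \<and>
     coev A L \<in> bimod_iso A (self_bimod A) (tensor A (dual A L) L)"

definition inner_product ::
  "(complex, 'a, 'm) module_scheme \<Rightarrow> ('a, 'e) bimod \<Rightarrow> ('e \<Rightarrow> 'e \<Rightarrow> 'a) \<Rightarrow> 'e \<Rightarrow> 'e \<Rightarrow> 'a" where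
  "inner_product A E G x y = ev A E (tens A E (dual A E) x (G y))"

definition nondegenerate_hermitian ::
  "('a, 'm) star_alg_scheme \<Rightarrow> ('a, 'e) bimod \<Rightarrow> ('e \<Rightarrow> 'e \<Rightarrow> 'a) \<Rightarrow> bool" where
  "nondegenerate_hermitian A E G \<longleftrightarrow>
     G \<in> bimod_iso A (conj_bimod A E) (dual A E) \<and>
     (\<forall>x\<in>carrier E. \<forall>y\<in>carrier E. inner_product A E G x y = star A (inner_product A E G y x))"

section \<open>The algebra \<open>T\<^sub>\<int>(L)\<close>\<close>

text \<open>One type for the elements of all components \<open>L\<^sup>n\<close>: \<open>Scal\<close> for \<open>n = 0\<close>, \<open>Pos\<close> for \<open>n > 0\<close>,
  \<open>Neg\<close> for \<open>n < 0\<close>.\<close>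

datatype ('a, 'l) comp =
    Scal 'a
  | Pos "('l list \<Rightarrow>\<^sub>0 int) set"
  | Neg "(('l \<Rightarrow> 'a) list \<Rightarrow>\<^sub>0 int) set"

text \<open>Transport of structure along an injective \<open>c\<close>.\<close>

definition relabel_bimod :: "('e \<Rightarrow> 'u) \<Rightarrow> ('a, 'e) bimod \<Rightarrow> ('a, 'u) bimod" where
  "relabel_bimod c E = \<lparr>carrier = c ` carrier E, monoid.mult = undefined, one = undefined,
     zero = c \<zero>\<^bsub>E\<^esub>, add = (\<lambda>u v. c (inv_into UNIV c u \<oplus>\<^bsub>E\<^esub> inv_into UNIV c v)), module.smult = (\<lambda>k u. c (k \<odot>\<^bsub>E\<^esub> inv_into UNIV c u)),
     lact = (\<lambda>a u. c (lact E a (inv_into UNIV c u))), ract = (\<lambda>u a. c (ract E (inv_into UNIV c u) a))\<rparr>"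

definition Lpow ::
  "(complex, 'a, 'm) module_scheme \<Rightarrow> ('a, 'l) bimod \<Rightarrow> int \<Rightarrow> ('a, ('a, 'l) comp) bimod" where
  "Lpow A L n =
     (if n = 0 then relabel_bimod Scal (self_bimod A)
      else if n > 0 then relabel_bimod Pos (tpow A L (nat n))
      else relabel_bimod Neg (tpow A (dual A L) (nat (- n))))"

definition pos_word ::
  "(complex, 'a, 'm) module_scheme \<Rightarrow> ('a, 'l) bimod \<Rightarrow> 'l list \<Rightarrow> ('a, 'l) comp" where
  "pos_word A L xs = Pos (word_tens A L xs)"

definition neg_word ::
  "(complex, 'a, 'm) module_scheme \<Rightarrow> ('a, 'l) bimod \<Rightarrow> ('l \<Rightarrow> 'a) list \<Rightarrow> ('a, 'l) comp" where
  "neg_word A L ys = Neg (word_tens A (dual A L) ys)"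

text \<open>For a balanced pairing \<open>\<phi>\<close> of \<open>E\<close> and \<open>F\<close> with values in the algebra, the \<open>n\<close>-fold nested
  pairing \<open>\<phi>\<^sup>n\<^sup>+\<^sup>1 = \<phi> (id \<otimes> \<phi>\<^sup>n \<otimes> id)\<close>, evaluated on
  \<open>(x\<^sub>1 \<otimes> \<dots> \<otimes> x\<^sub>n) \<otimes> (y\<^sub>1 \<otimes> \<dots> \<otimes> y\<^sub>n)\<close>.  The recursion starts at \<open>n = 1\<close>.\<close>

fun nested :: "('a, 'e) bimod \<Rightarrow> ('e \<Rightarrow> 'f \<Rightarrow> 'a) \<Rightarrow> nat \<Rightarrow> 'e list \<Rightarrow> 'f list \<Rightarrow> 'a" where
  "nested E \<phi> 0 xs ys = undefined"
| "nested E \<phi> (Suc 0) xs ys = \<phi> (hd xs) (hd ys)"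
| "nested E \<phi> (Suc (Suc n)) xs ys =
     \<phi> (ract E (hd xs) (nested E \<phi> (Suc n) (tl xs) (butlast ys))) (last ys)"

definition ev_pow ::
  "(complex, 'a, 'm) module_scheme \<Rightarrow> ('a, 'l) bimod \<Rightarrow> nat \<Rightarrow> 'l list \<Rightarrow> ('l \<Rightarrow> 'a) list \<Rightarrow> 'a" where
  "ev_pow A L = nested L (\<lambda>x \<alpha>. ev A L (tens A L (dual A L) x \<alpha>))"

definition ev_tilde_pow ::
  "(complex, 'a, 'm) module_scheme \<Rightarrow> ('a, 'l) bimod \<Rightarrow> nat \<Rightarrow> ('l \<Rightarrow> 'a) list \<Rightarrow> 'l list \<Rightarrow> 'a" where
  "ev_tilde_pow A L = nested (dual A L) (\<lambda>\<alpha> x. coev_inv A L (tens A (dual A L) L \<alpha> x))"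

definition pos_neg_mult ::
  "(complex, 'a, 'm) module_scheme \<Rightarrow> ('a, 'l) bimod \<Rightarrow> 'l list \<Rightarrow> ('l \<Rightarrow> 'a) list \<Rightarrow> ('a, 'l) comp" where
  "pos_neg_mult A L xs ys = (let n = length xs; m = length ys in
     if n = m then Scal (ev_pow A L n xs ys)
     else if n < m then
       lact (Lpow A L (int n - int m)) (ev_pow A L n xs (take n ys)) (neg_word A L (drop n ys))
     else
       ract (Lpow A L (int n - int m)) (pos_word A L (take (n - m) xs))
         (ev_pow A L m (drop (n - m) xs) ys))"

definition neg_pos_mult ::
  "(complex, 'a, 'm) module_scheme \<Rightarrow> ('a, 'l) bimod \<Rightarrow> ('l \<Rightarrow> 'a) list \<Rightarrow> 'l list \<Rightarrow> ('a, 'l) comp" where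
  "neg_pos_mult A L ys xs = (let n = length ys; m = length xs in
     if n = m then Scal (ev_tilde_pow A L n ys xs)
     else if n < m then
       lact (Lpow A L (int m - int n)) (ev_tilde_pow A L n ys (take n xs)) (pos_word A L (drop n xs))
     else
       ract (Lpow A L (int m - int n)) (neg_word A L (take (n - m) ys))
         (ev_tilde_pow A L m (drop (n - m) ys) xs))"

text \<open>The products \<open>L\<^sup>n \<times> L\<^sup>m \<rightarrow> L\<^sup>n\<^sup>+\<^sup>m\<close>, given on simple tensors and extended additively in each
  argument.\<close>

fun comp_mult ::
  "(complex, 'a, 'm) module_scheme \<Rightarrow> ('a, 'l) bimod \<Rightarrow> int \<Rightarrow> int
     \<Rightarrow> ('a, 'l) comp \<Rightarrow> ('a, 'l) comp \<Rightarrow> ('a, 'l) comp" where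
  "comp_mult A L n m (Scal a) v = lact (Lpow A L m) a v"
| "comp_mult A L n m u (Scal b) = ract (Lpow A L n) u b"
| "comp_mult A L n m (Pos U) (Pos V) = induced (Lpow A L (n + m))
     (\<lambda>xs. induced (Lpow A L (n + m)) (\<lambda>ys. pos_word A L (xs @ ys)) V) U"
| "comp_mult A L n m (Neg U) (Neg V) = induced (Lpow A L (n + m))
     (\<lambda>xs. induced (Lpow A L (n + m)) (\<lambda>ys. neg_word A L (xs @ ys)) V) U"
| "comp_mult A L n m (Pos U) (Neg V) = induced (Lpow A L (n + m))
     (\<lambda>xs. induced (Lpow A L (n + m)) (\<lambda>ys. pos_neg_mult A L xs ys) V) U"
| "comp_mult A L n m (Neg U) (Pos V) = induced (Lpow A L (n + m))
     (\<lambda>xs. induced (Lpow A L (n + m)) (\<lambda>ys. neg_pos_mult A L xs ys) V) U"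

text \<open>The star maps \<open>L\<^sup>n \<rightarrow> L\<^sup>-\<^sup>n\<close>.\<close>

fun comp_star ::
  "('a, 'm) star_alg_scheme \<Rightarrow> ('a, 'l) bimod \<Rightarrow> ('l \<Rightarrow> 'l \<Rightarrow> 'a) \<Rightarrow> int
     \<Rightarrow> ('a, 'l) comp \<Rightarrow> ('a, 'l) comp" where
  "comp_star A L G n (Scal a) = Scal (star A a)"
| "comp_star A L G n (Pos U) = induced (Lpow A L (- n)) (\<lambda>xs. neg_word A L (rev (map G xs))) U"
| "comp_star A L G n (Neg V) =
     induced (Lpow A L (- n)) (\<lambda>ys. pos_word A L (rev (map (inv_into (carrier L) G) ys))) V"

definition homogeneous ::
  "(complex, 'a, 'm) module_scheme \<Rightarrow> ('a, 'l) bimod \<Rightarrow> int \<Rightarrow> ('a, 'l) comp \<Rightarrow> int \<Rightarrow> ('a, 'l) comp" where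
  "homogeneous A L n u = (\<lambda>k. if k = n then u else \<zero>\<^bsub>Lpow A L k\<^esub>)"

definition TZ ::
  "('a, 'm) star_alg_scheme \<Rightarrow> ('a, 'l) bimod \<Rightarrow> ('l \<Rightarrow> 'l \<Rightarrow> 'a) \<Rightarrow> (int \<Rightarrow> ('a, 'l) comp) star_alg" where
  "TZ A L G =
     \<lparr>carrier = carrier (sum_group UNIV (\<lambda>n. add_monoid (Lpow A L n))),
      monoid.mult = (\<lambda>s t k. \<Oplus>\<^bsub>Lpow A L k\<^esub>n\<in>{n. s n \<noteq> \<zero>\<^bsub>Lpow A L n\<^esub> \<and> t (k - n) \<noteq> \<zero>\<^bsub>Lpow A L (k - n)\<^esub>}.
        comp_mult A L n (k - n) (s n) (t (k - n))),
      one = homogeneous A L 0 (Scal \<one>\<^bsub>A\<^esub>),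
      zero = (\<lambda>n. \<zero>\<^bsub>Lpow A L n\<^esub>),
      add = (\<lambda>s t n. s n \<oplus>\<^bsub>Lpow A L n\<^esub> t n),
      module.smult = (\<lambda>c s n. c \<odot>\<^bsub>Lpow A L n\<^esub> s n),
      star = (\<lambda>s n. comp_star A L G (- n) (s (- n)))\<rparr>"

end

theory Submission
  imports Defs
begin

text \<open>
  Write \<open>N\<close> for the dual of \<open>L\<close>, \<open>\<epsilon>\<close> for evaluation and \<open>\<phi>\<close> for the inverse of coevaluation.  A dual
  basis gives \<open>\<epsilon>(x, \<alpha>).y = x.\<phi>(\<alpha>, y)\<close>, and hence \<open>\<phi>(\<alpha>, x).\<beta> = \<alpha>.\<epsilon>(x, \<beta>)\<close>; from here on \<open>L\<close> and \<open>N\<close> play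
  symmetric roles.  Let a letter (an element of \<open>L\<close> or \<open>N\<close>) act on all components by multiplication
  from the left, cancelling against the first letter of a word of opposite sign.  The two identities
  say that letters \<open>x, y\<close> of opposite sign satisfy \<open>x (y u) = \<epsilon>(x, y).u\<close> or \<open>\<phi>(x, y).u\<close>, so \<open>(x v) w = x (v w)\<close>
  for every letter \<open>x\<close>, and associativity follows since a word multiplies as the composite of its letters.

  The Hermitian condition says \<open>\<epsilon>(x, \<alpha>)\<^sup>* = \<epsilon>(\<alpha>\<^sup>*, x\<^sup>*)\<close>.  Applying the star to the first identity
  shows that \<open>\<phi>(\<alpha>, x)\<^sup>*\<close> and \<open>\<phi>(x\<^sup>*, \<alpha>\<^sup>*)\<close> act alike on \<open>N\<close>, and \<open>A\<close> acts faithfully on \<open>N\<close> because coevaluation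
  is injective.  Thus \<open>(x v)\<^sup>* = v\<^sup>* x\<^sup>*\<close> for a letter \<open>x\<close>, and for words by induction.
\<close>

subsection \<open>Additive maps and presented groups\<close>

text \<open>The given products split by sign and length and use a nested pairing, so checking
  associativity on them directly would multiply cases. The locale \<open>pairing\<close> abstracts
  from \<open>L\<close> and its dual to two bimodules with two balanced pairings and two mixed laws,
  a list of hypotheses invariant under exchange. The double dual is not literally \<open>L\<close>,
  so the symmetry can be exploited only after this abstraction; for the same reason the constructors
  \<open>Scal\<close>, \<open>Pos\<close>, \<open>Neg\<close> become parameters. The product
  \<open>mul\<close> is built afresh from letters there, and \<open>comp_mult\<close> is identified
  with it afterwards. A second obstacle: a map out of a tensor power is \<open>the_elem\<close> of
  the image of a coset, about which nothing is known until the underlying function on words respects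
  the relations. Hence the notion \<open>balanced\<close>, and the comparison of additive maps on
  generators only. Third, \<open>coev_inv\<close> has no formula. Properties of \<phi> are obtained
  by applying the injective \<open>coev\<close>, or by testing how a value of \<phi> acts on the
  dual.\<close>

definition add_hom :: "('a, 'm) ring_scheme \<Rightarrow> ('b, 'n) ring_scheme \<Rightarrow> ('a \<Rightarrow> 'b) set" where
  "add_hom M N = {h \<in> carrier M \<rightarrow> carrier N.
     \<forall>x\<in>carrier M. \<forall>y\<in>carrier M. h (x \<oplus>\<^bsub>M\<^esub> y) = h x \<oplus>\<^bsub>N\<^esub> h y}"

lemma add_homI:
  assumes "\<And>x. x \<in> carrier M \<Longrightarrow> h x \<in> carrier N"
    and "\<And>x y. \<lbrakk>x \<in> carrier M; y \<in> carrier M\<rbrakk> \<Longrightarrow> h (x \<oplus>\<^bsub>M\<^esub> y) = h x \<oplus>\<^bsub>N\<^esub> h y"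
  shows "h \<in> add_hom M N"
  using assms by (auto simp: add_hom_def)

lemma add_hom_closed: "\<lbrakk>h \<in> add_hom M N; x \<in> carrier M\<rbrakk> \<Longrightarrow> h x \<in> carrier N"
  by (auto simp: add_hom_def)

lemma add_hom_add:
  "\<lbrakk>h \<in> add_hom M N; x \<in> carrier M; y \<in> carrier M\<rbrakk> \<Longrightarrow> h (x \<oplus>\<^bsub>M\<^esub> y) = h x \<oplus>\<^bsub>N\<^esub> h y"
  by (auto simp: add_hom_def)

lemma add_hom_compose: "\<lbrakk>h \<in> add_hom M N; k \<in> add_hom N K\<rbrakk> \<Longrightarrow> (\<lambda>x. k (h x)) \<in> add_hom M K"
  by (simp add: add_hom_def Pi_iff)

lemma add_hom_ident: "(\<lambda>x. x) \<in> add_hom M M"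
  by (auto simp: add_hom_def)

lemma add_hom_plus:
  assumes "abelian_group N" "h \<in> add_hom M N" "k \<in> add_hom M N"
  shows "(\<lambda>x. h x \<oplus>\<^bsub>N\<^esub> k x) \<in> add_hom M N"
proof -
  interpret N: abelian_group N by fact
  show ?thesis using assms(2,3) by (auto simp: add_hom_def N.a_ac Pi_iff)
qed

context
  fixes M :: "('a, 'm) ring_scheme" and N :: "('b, 'n) ring_scheme" and h
  assumes M: "abelian_group M" and N: "abelian_group N" and h: "h \<in> add_hom M N"
begin

interpretation M: abelian_group M by (rule M)
interpretation N: abelian_group N by (rule N)

lemma add_hom_zero: "h \<zero>\<^bsub>M\<^esub> = \<zero>\<^bsub>N\<^esub>"
proof -
  have "h \<zero>\<^bsub>M\<^esub> \<oplus>\<^bsub>N\<^esub> h \<zero>\<^bsub>M\<^esub> = h \<zero>\<^bsub>M\<^esub>"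
    using add_hom_add[OF h, of "\<zero>\<^bsub>M\<^esub>" "\<zero>\<^bsub>M\<^esub>"] by simp
  then show ?thesis using add_hom_closed[OF h, of "\<zero>\<^bsub>M\<^esub>"] by simp
qed

lemma add_hom_minus:
  assumes "x \<in> carrier M" shows "h (\<ominus>\<^bsub>M\<^esub> x) = \<ominus>\<^bsub>N\<^esub> h x"
proof -
  have "h (\<ominus>\<^bsub>M\<^esub> x) \<oplus>\<^bsub>N\<^esub> h x = \<zero>\<^bsub>N\<^esub>"
    using add_hom_add[OF h, of "\<ominus>\<^bsub>M\<^esub> x" x] assms add_hom_zero by (simp add: M.l_neg)
  then show ?thesis
    using N.minus_equality[of "h (\<ominus>\<^bsub>M\<^esub> x)" "h x"] add_hom_closed[OF h] assms by auto
qed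

lemma add_hom_diff:
  assumes "x \<in> carrier M" "y \<in> carrier M" shows "h (x \<ominus>\<^bsub>M\<^esub> y) = h x \<ominus>\<^bsub>N\<^esub> h y"
  using assms by (simp add: a_minus_def add_hom_add[OF h] add_hom_minus)

lemma add_hom_finsum:
  assumes "f \<in> I \<rightarrow> carrier M"
  shows "h (finsum M f I) = finsum N (\<lambda>i. h (f i)) I"
proof (cases "finite I")
  case True
  then show ?thesis using assms
  proof (induction I rule: finite_induct)
    case empty
    show ?case by (simp add: add_hom_zero)
  next
    case (insert i I)
    then have "(\<lambda>i. h (f i)) \<in> insert i I \<rightarrow> carrier N"
      using add_hom_closed[OF h] by auto
    then show ?case using insert add_hom_add[OF h] by (simp add: Pi_iff M.finsum_closed)
  qed
next
  case False
  then show ?thesis by (simp add: add_hom_zero)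
qed

end

lemma (in abelian_group) minus_zero_eq: "\<lbrakk>x \<in> carrier G; y \<in> carrier G; x \<ominus> y = \<zero>\<rbrakk> \<Longrightarrow> x = y"
  using minus_equality[of x "\<ominus> y"] by (simp add: a_minus_def)

lemma (in abelian_group) int_add_pow_closed: "x \<in> carrier G \<Longrightarrow> add_pow G (k :: int) x \<in> carrier G"
  using group.int_pow_closed[OF a_group, of x k] by (simp add: add_pow_def)

lemma (in abelian_group) int_add_pow_add:
  "x \<in> carrier G \<Longrightarrow> add_pow G (k + l :: int) x = add_pow G k x \<oplus> add_pow G l x"
  using group.int_pow_mult[OF a_group, of x k l] by (simp add: add_pow_def)

section \<open>Additive extension from generators to a free abelian group\<close>

lemma free_extend_hom:
  assumes T: "abelian_group T" and f: "f \<in> W \<rightarrow> carrier T"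
  shows "Poly_Mapping.keys x \<subseteq> W \<Longrightarrow> free_extend T f x \<in> carrier T"
    and "\<lbrakk>Poly_Mapping.keys x \<subseteq> W; Poly_Mapping.keys y \<subseteq> W\<rbrakk> \<Longrightarrow>
      free_extend T f (x + y) = free_extend T f x \<oplus>\<^bsub>T\<^esub> free_extend T f y"
    and "w \<in> W \<Longrightarrow> free_extend T f (frag_of w) = f w"
proof -
  interpret T: abelian_group T by fact
  show "free_extend T f x \<in> carrier T" if "Poly_Mapping.keys x \<subseteq> W"
    unfolding free_extend_def using that f by (intro T.finsum_closed) (auto simp: T.int_add_pow_closed)
  \<comment> \<open>Cancellation can make the keys of \<open>x + y\<close> smaller than the union of
    the keys, so all sums are taken over a common finite superset; the extra terms have coefficient
    0.\<close>
  have ext: "free_extend T f x = (\<Oplus>\<^bsub>T\<^esub>w\<in>K. [Poly_Mapping.lookup x w] \<cdot>\<^bsub>T\<^esub> f w)"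
    if "finite K" "Poly_Mapping.keys x \<subseteq> K" "K \<subseteq> W" for x K
    unfolding free_extend_def
  proof (rule T.add.finprod_mono_neutral_cong_left)
    fix w assume "w \<in> K - Poly_Mapping.keys x"
    then have "Poly_Mapping.lookup x w = 0" by (simp add: in_keys_iff)
    then show "[Poly_Mapping.lookup x w] \<cdot>\<^bsub>T\<^esub> f w = \<zero>\<^bsub>T\<^esub>"
      by (simp add: add_pow_def)
  qed (use that f in \<open>auto simp: T.int_add_pow_closed\<close>)
  show "free_extend T f (x + y) = free_extend T f x \<oplus>\<^bsub>T\<^esub> free_extend T f y"
    if x: "Poly_Mapping.keys x \<subseteq> W" and y: "Poly_Mapping.keys y \<subseteq> W"
  proof -
    define K where "K = Poly_Mapping.keys x \<union> Poly_Mapping.keys y"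
    have K: "finite K" "K \<subseteq> W" "Poly_Mapping.keys x \<subseteq> K" "Poly_Mapping.keys y \<subseteq> K"
      "Poly_Mapping.keys (x + y) \<subseteq> K"
      using x y keys_add[of x y] by (auto simp: K_def)
    have fK: "f w \<in> carrier T" if "w \<in> K" for w using f K that by auto
    have "(\<Oplus>\<^bsub>T\<^esub>w\<in>K. [Poly_Mapping.lookup (x + y) w] \<cdot>\<^bsub>T\<^esub> f w) =
      (\<Oplus>\<^bsub>T\<^esub>w\<in>K. [Poly_Mapping.lookup x w] \<cdot>\<^bsub>T\<^esub> f w \<oplus>\<^bsub>T\<^esub> [Poly_Mapping.lookup y w] \<cdot>\<^bsub>T\<^esub> f w)"
      by (rule T.finsum_cong') (auto simp: fK lookup_add T.int_add_pow_closed T.int_add_pow_add)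
    then show ?thesis unfolding ext[OF K(1,3,2)] ext[OF K(1,4,2)] ext[OF K(1,5,2)]
      using T.finsum_addf[of "\<lambda>w. [Poly_Mapping.lookup x w] \<cdot>\<^bsub>T\<^esub> f w" K "\<lambda>w. [Poly_Mapping.lookup y w] \<cdot>\<^bsub>T\<^esub> f w"]
      by (simp add: Pi_iff fK T.int_add_pow_closed)
  qed
  show "free_extend T f (frag_of w) = f w" if "w \<in> W"
  proof -
    have "f w \<in> carrier T" using that f by auto
    moreover from this have "add_pow T (1::int) (f w) = f w"
      using group.int_pow_1[OF T.a_group, of "f w"] by (simp add: add_pow_def)
    ultimately show ?thesis
      using that by (subst ext[of "{w}"]) simp_all
  qed
qed

lemma free_extend_minus:
  assumes T: "abelian_group T" and f: "f \<in> W \<rightarrow> carrier T"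
    and "Poly_Mapping.keys x \<subseteq> W" "Poly_Mapping.keys y \<subseteq> W"
  shows "free_extend T f (x - y) = free_extend T f x \<ominus>\<^bsub>T\<^esub> free_extend T f y"
proof -
  interpret T: abelian_group T by fact
  have k: "Poly_Mapping.keys (x - y) \<subseteq> W" using assms keys_diff[of x y] by auto
  note c = free_extend_hom(1)[OF T f]
  have "free_extend T f x = free_extend T f (x - y) \<oplus>\<^bsub>T\<^esub> free_extend T f y"
    using free_extend_hom(2)[OF T f k assms(4)] by simp
  then show ?thesis using c[OF k] c[OF assms(3)] c[OF assms(4)]
    by (simp add: a_minus_def T.a_assoc T.r_neg)
qed

section \<open>Quotients of free abelian groups by relations\<close>

locale presentation =
  fixes W :: "'w set" and R :: "('w \<Rightarrow>\<^sub>0 int) set"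
  assumes rels: "r \<in> R \<Longrightarrow> Poly_Mapping.keys r \<subseteq> W"
begin

abbreviation "F \<equiv> free_Abelian_group W"
abbreviation "H \<equiv> generate F R"
abbreviation "Q \<equiv> presented W R"

interpretation F: comm_group F
  by (rule abelian_free_Abelian_group)

lemma subgroup_H: "subgroup H F"
  by (rule F.generate_is_subgroup) (use rels in auto)

lemma normal_H: "H \<lhd> F"
  by (simp add: F.normal_iff_subgroup subgroup_H)

interpretation H: normal H F by (rule normal_H)

lemma carrier_presented: "carrier Q = {H #>\<^bsub>F\<^esub> x | x. Poly_Mapping.keys x \<subseteq> W}"
  by (auto simp: presented_def Let_def FactGroup_def RCOSETS_def)

lemma add_presented:
  "\<lbrakk>Poly_Mapping.keys x \<subseteq> W; Poly_Mapping.keys y \<subseteq> W\<rbrakk> \<Longrightarrow>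
   (H #>\<^bsub>F\<^esub> x) \<oplus>\<^bsub>Q\<^esub> (H #>\<^bsub>F\<^esub> y) = H #>\<^bsub>F\<^esub> (x + y)"
  using H.rcos_sum[of x y] by (simp add: presented_def Let_def FactGroup_def)

lemma zero_presented: "\<zero>\<^bsub>Q\<^esub> = H"
  by (simp add: presented_def Let_def FactGroup_def)

lemma abelian_group_presented: "abelian_group Q"
proof (rule comm_group_abelian_groupI)
  have "add_monoid Q = F Mod H"
    by (simp add: presented_def Let_def FactGroup_def)
  then show "comm_group (add_monoid Q)"
    using F.abelian_FactGroup[OF subgroup_H] by simp
qed

interpretation Q: abelian_group Q by (rule abelian_group_presented)

lemma coset_zero: "x \<in> H \<Longrightarrow> H #>\<^bsub>F\<^esub> x = \<zero>\<^bsub>Q\<^esub>"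
  unfolding zero_presented
  by (rule F.coset_join2[OF _ subgroup_H]) (use subgroup.subset[OF subgroup_H] in blast)+

lemma coset_diff:
  assumes "Poly_Mapping.keys x \<subseteq> W" "Poly_Mapping.keys y \<subseteq> W"
  shows "H #>\<^bsub>F\<^esub> (x - y) = (H #>\<^bsub>F\<^esub> x) \<ominus>\<^bsub>Q\<^esub> (H #>\<^bsub>F\<^esub> y)"
proof -
  have k: "Poly_Mapping.keys (x - y) \<subseteq> W" using assms keys_diff[of x y] by auto
  have c: "H #>\<^bsub>F\<^esub> z \<in> carrier Q" if "Poly_Mapping.keys z \<subseteq> W" for z
    using that by (auto simp: carrier_presented)
  have "H #>\<^bsub>F\<^esub> x = (H #>\<^bsub>F\<^esub> (x - y)) \<oplus>\<^bsub>Q\<^esub> (H #>\<^bsub>F\<^esub> y)"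
    using add_presented[OF k assms(2)] by simp
  then show ?thesis
    using c[OF k] c[OF assms(1)] c[OF assms(2)] by (simp add: a_minus_def Q.a_assoc Q.r_neg)
qed

lemma gen_class_closed: "w \<in> W \<Longrightarrow> gen_class W R w \<in> carrier Q"
  unfolding carrier_presented gen_class_def by (rule CollectI, rule exI[of _ "frag_of w"]) simp

lemma gen_class_eq:
  assumes "frag_of w - frag_of w' \<in> R" "w \<in> W" "w' \<in> W"
  shows "gen_class W R w = gen_class W R w'"
  using coset_zero[OF generate.incl[OF assms(1)]] assms(2,3)
    gen_class_closed[of w] gen_class_closed[of w'] unfolding gen_class_def
  by (simp add: coset_diff Q.minus_zero_eq)

lemma gen_class_add:
  assumes "frag_of w - frag_of u - frag_of v \<in> R" "w \<in> W" "u \<in> W" "v \<in> W"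
  shows "gen_class W R w = gen_class W R u \<oplus>\<^bsub>Q\<^esub> gen_class W R v"
proof -
  have k: "Poly_Mapping.keys (frag_of w - frag_of u) \<subseteq> W"
    using assms keys_diff[of "frag_of w" "frag_of u"] by auto
  have "(gen_class W R w \<ominus>\<^bsub>Q\<^esub> gen_class W R u) \<ominus>\<^bsub>Q\<^esub> gen_class W R v = \<zero>\<^bsub>Q\<^esub>"
    using coset_zero[OF generate.incl[OF assms(1)]] assms(2-4) k
    unfolding gen_class_def by (simp add: coset_diff)
  then have "gen_class W R w \<ominus>\<^bsub>Q\<^esub> gen_class W R u = gen_class W R v"
    using gen_class_closed assms(2-4) by (simp add: Q.minus_zero_eq)
  moreover have "gen_class W R w = gen_class W R u \<oplus>\<^bsub>Q\<^esub> (gen_class W R w \<ominus>\<^bsub>Q\<^esub> gen_class W R u)"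
    using gen_class_closed assms(2-4)
    by (subst Q.a_comm) (simp_all add: a_minus_def Q.a_assoc Q.l_neg)
  ultimately show ?thesis by simp
qed

text \<open>Closure under differences instead of sums takes care of negatives in the same
  step.\<close>

lemma presented_induct [consumes 1, case_names zero gen diff]:
  assumes "U \<in> carrier Q" and z: "P \<zero>\<^bsub>Q\<^esub>" and g: "\<And>w. w \<in> W \<Longrightarrow> P (gen_class W R w)"
    and d: "\<And>U V. \<lbrakk>U \<in> carrier Q; V \<in> carrier Q; P U; P V\<rbrakk> \<Longrightarrow> P (U \<ominus>\<^bsub>Q\<^esub> V)"
  shows "P U"
proof -
  obtain x where x: "Poly_Mapping.keys x \<subseteq> W" "U = H #>\<^bsub>F\<^esub> x"
    using assms(1) by (auto simp: carrier_presented)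
  have "P (H #>\<^bsub>F\<^esub> x)" using x(1)
  proof (induction x rule: free_Abelian_group_induct [consumes 1, case_names 1 2 3])
    case 1
    then show ?case using z coset_zero[of 0] H.one_closed by simp
  next
    case (2 x y)
    then show ?case unfolding coset_diff[OF 2(1,2)]
      by (intro d) (auto simp: carrier_presented)
  next
    case (3 a)
    then show ?case using g by (simp add: gen_class_def)
  qed
  then show ?thesis by (simp add: x)
qed

text \<open>\<open>induced\<close> takes the only element of the image of a coset. The image is a
  singleton because \<open>free_extend\<close> vanishes on the whole subgroup generated by
  \<open>R\<close> once it vanishes on \<open>R\<close>.\<close>

lemma induced_hom:
  assumes T: "abelian_group T" and f: "f \<in> W \<rightarrow> carrier T"
    and kill: "\<And>r. r \<in> R \<Longrightarrow> free_extend T f r = \<zero>\<^bsub>T\<^esub>"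
  shows "induced T f \<in> add_hom Q T" "\<And>w. w \<in> W \<Longrightarrow> induced T f (gen_class W R w) = f w"
proof -
  interpret T: abelian_group T by fact
  note fe = free_extend_hom[OF T f]
  \<comment> \<open>The bound on the keys is carried along because \<open>free_extend\<close> is
    additive only on elements supported in \<open>W\<close>.\<close>
  have killH: "Poly_Mapping.keys x \<subseteq> W \<and> free_extend T f x = \<zero>\<^bsub>T\<^esub>" if "x \<in> H" for x
    using that
  proof (induction rule: generate.induct)
    case one
    then show ?case by (simp add: free_extend_def)
  next
    case (incl h)
    then show ?case using kill rels by simp
  next
    case (inv h)
    have k: "Poly_Mapping.keys h \<subseteq> W" using rels inv by simp
    have "free_extend T f (0 - h) = \<zero>\<^bsub>T\<^esub> \<ominus>\<^bsub>T\<^esub> \<zero>\<^bsub>T\<^esub>"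
      using free_extend_minus[OF T f, of 0 h] k kill[OF inv] by (simp add: free_extend_def)
    then show ?case using k by (simp add: a_minus_def)
  next
    case (eng h g)
    have "Poly_Mapping.keys (h + g) \<subseteq> W" using eng.IH keys_add[of h g] by blast
    then show ?case using fe(2)[of h g] eng.IH by simp
  qed
  have val: "induced T f (H #>\<^bsub>F\<^esub> x) = free_extend T f x" if x: "Poly_Mapping.keys x \<subseteq> W" for x
  proof -
    have "free_extend T f y = free_extend T f x" if "y \<in> H #>\<^bsub>F\<^esub> x" for y
    proof -
      obtain z where z: "z \<in> H" "y = z + x" using \<open>y \<in> H #>\<^bsub>F\<^esub> x\<close> by (auto simp: r_coset_def)
      show ?thesis using killH[OF z(1)] fe(2)[of z x] fe(1)[OF x] x by (simp add: z)
    qed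
    moreover have "x \<in> H #>\<^bsub>F\<^esub> x" using F.rcos_self[of x H] subgroup_H x by simp
    ultimately have "free_extend T f ` (H #>\<^bsub>F\<^esub> x) = {free_extend T f x}" by blast
    then show ?thesis by (simp add: induced_def)
  qed
  show "induced T f \<in> add_hom Q T"
  proof (rule add_homI)
    fix U assume "U \<in> carrier Q"
    then obtain x where x: "Poly_Mapping.keys x \<subseteq> W" "U = H #>\<^bsub>F\<^esub> x"
      by (auto simp: carrier_presented)
    then show "induced T f U \<in> carrier T" using fe(1)[OF x(1)] by (simp add: val)
    fix V assume "V \<in> carrier Q"
    then obtain y where y: "Poly_Mapping.keys y \<subseteq> W" "V = H #>\<^bsub>F\<^esub> y"
      by (auto simp: carrier_presented)
    have "Poly_Mapping.keys (x + y) \<subseteq> W" using x(1) y(1) keys_add[of x y] by auto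
    then show "induced T f (U \<oplus>\<^bsub>Q\<^esub> V) = induced T f U \<oplus>\<^bsub>T\<^esub> induced T f V"
      using x y fe(2) by (simp add: add_presented val)
  qed
  show "induced T f (gen_class W R w) = f w" if "w \<in> W" for w
    using val[of "frag_of w"] fe(3)[OF that] that by (simp add: gen_class_def)
qed

lemma add_hom_eqI:
  assumes T: "abelian_group T" and "h \<in> add_hom Q T" "k \<in> add_hom Q T"
    and "\<And>w. w \<in> W \<Longrightarrow> h (gen_class W R w) = k (gen_class W R w)" and "U \<in> carrier Q"
  shows "h U = k U"
  using assms(5)
  by (induction rule: presented_induct)
    (simp_all add: assms(4) add_hom_zero[OF abelian_group_presented T assms(2)]
      add_hom_zero[OF abelian_group_presented T assms(3)]
      add_hom_diff[OF abelian_group_presented T assms(2)]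
      add_hom_diff[OF abelian_group_presented T assms(3)])

text \<open>Identifies an \<open>induced\<close> map with an additive map that is already at hand.
  That the values on generators kill the relations is then automatic, since they are the values of
  an additive map on classes.\<close>

lemma induced_eq:
  assumes T: "abelian_group T" and h: "h \<in> add_hom Q T"
    and f: "\<And>w. w \<in> W \<Longrightarrow> f w = h (gen_class W R w)" and U: "U \<in> carrier Q"
  shows "induced T f U = h U"
proof -
  interpret T: abelian_group T by fact
  have fW: "f \<in> W \<rightarrow> carrier T" using f gen_class_closed add_hom_closed[OF h] by auto
  have ext: "free_extend T f x = h (H #>\<^bsub>F\<^esub> x)" if "Poly_Mapping.keys x \<subseteq> W" for x
    using that
  proof (induction x rule: free_Abelian_group_induct [consumes 1, case_names 1 2 3])
    case 1
    then show ?case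
      using coset_zero[of 0] H.one_closed add_hom_zero[OF abelian_group_presented T h]
      by (simp add: free_extend_def)
  next
    case (2 x y)
    then show ?case
      by (simp add: free_extend_minus[OF T fW] coset_diff add_hom_diff[OF abelian_group_presented T h]
          carrier_presented) (subst add_hom_diff[OF abelian_group_presented T h]; auto simp: carrier_presented)
  next
    case (3 a)
    then show ?case using f[of a] free_extend_hom(3)[OF T fW, of a] by (simp add: gen_class_def)
  qed
  have kill: "free_extend T f r = \<zero>\<^bsub>T\<^esub>" if "r \<in> R" for r
    using ext[OF rels[OF that]] coset_zero[OF generate.incl[OF that]]
      add_hom_zero[OF abelian_group_presented T h] by simp
  note i = induced_hom[OF T fW kill]
  show ?thesis by (rule add_hom_eqI[OF T i(1) h _ U]) (use i(2) f in auto)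
qed

end

subsection \<open>Algebras and bimodules\<close>

lemma cring_complex_ring: "cring complex_ring"
  by (rule cring_from_type_algebra)

lemma complex_ring_simps [simp]:
  "carrier complex_ring = UNIV" "c \<otimes>\<^bsub>complex_ring\<^esub> d = c * d" "c \<oplus>\<^bsub>complex_ring\<^esub> d = c + d"
  "\<one>\<^bsub>complex_ring\<^esub> = 1" "\<zero>\<^bsub>complex_ring\<^esub> = 0"
  by (simp_all add: ring_of_type_algebra_def)

text \<open>Carries the group structure to records that share the additive fields, such as a tensor
  power and the presented group underneath it.\<close>

lemma abelian_group_cong:
  assumes "abelian_group M" "carrier N = carrier M" "add N = add M" "zero N = zero M"
  shows "abelian_group N"
proof -
  interpret M: abelian_group M by fact
  show ?thesis
    by (rule abelian_groupI; (unfold assms(2-4))?)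
      (auto simp: M.a_ac intro: bexI[where x = "\<ominus>\<^bsub>M\<^esub> x" for x] M.r_neg)
qed

lemma add_hom_cong:
  assumes "carrier M' = carrier M" "add M' = add M" "carrier N' = carrier N" "add N' = add N"
  shows "add_hom M' N' = add_hom M N"
  by (simp add: add_hom_def assms)

locale calgebra =
  fixes A :: "(complex, 'a, 'm) module_scheme" (structure)
  assumes complex_algebra: "complex_algebra A"
begin

lemma ring_A: "ring A" and module_A: "module complex_ring A"
  using complex_algebra by (simp_all add: complex_algebra_def)

sublocale A: ring A by (rule ring_A)

lemma smult_A_closed [simp]: "x \<in> carrier A \<Longrightarrow> c \<odot> x \<in> carrier A"
  using module.smult_closed[OF module_A] by simp

lemma smult_A_mult:
  "\<lbrakk>x \<in> carrier A; y \<in> carrier A\<rbrakk> \<Longrightarrow> (c \<odot> x) \<otimes> y = c \<odot> (x \<otimes> y)"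
  "\<lbrakk>x \<in> carrier A; y \<in> carrier A\<rbrakk> \<Longrightarrow> x \<otimes> (c \<odot> y) = c \<odot> (x \<otimes> y)"
  using complex_algebra by (simp_all add: complex_algebra_def)

abbreviation scal :: "complex \<Rightarrow> 'a" where "scal c \<equiv> c \<odot> \<one>"

lemma smult_eq_scal: "x \<in> carrier A \<Longrightarrow> c \<odot> x = scal c \<otimes> x"
  "x \<in> carrier A \<Longrightarrow> c \<odot> x = x \<otimes> scal c"
  by (simp_all add: smult_A_mult)

lemma scal_simps: "scal (c * d) = scal c \<otimes> scal d" "scal (c + d) = scal c \<oplus> scal d"
  "scal 1 = \<one>"
  using module.smult_assoc1[OF module_A, of c d "\<one>"]
    module.smult_l_distr[OF module_A, of c d "\<one>"]
    module.smult_one[OF module_A, of "\<one>"]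
  by (simp_all add: smult_A_mult(1))

end

locale bimod = calgebra A for A :: "(complex, 'a, 'm) module_scheme" (structure) +
  fixes E :: "('a, 'e) bimod"
  assumes bimodule: "bimodule A E"
begin

lemma module_E: "module complex_ring E"
  using bimodule by (simp add: bimodule_def)

lemma abelian_group_E: "abelian_group E"
  using module_E by (rule module.axioms)

sublocale E: abelian_group E by (rule abelian_group_E)

lemma act_closed [simp]:
  "\<lbrakk>a \<in> carrier A; x \<in> carrier E\<rbrakk> \<Longrightarrow> lact E a x \<in> carrier E"
  "\<lbrakk>a \<in> carrier A; x \<in> carrier E\<rbrakk> \<Longrightarrow> ract E x a \<in> carrier E"
  using bimodule by (simp_all add: bimodule_def)

lemma act_add:
  "\<lbrakk>a \<in> carrier A; x \<in> carrier E; y \<in> carrier E\<rbrakk> \<Longrightarrow>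
    lact E a (x \<oplus>\<^bsub>E\<^esub> y) = lact E a x \<oplus>\<^bsub>E\<^esub> lact E a y"
  "\<lbrakk>a \<in> carrier A; x \<in> carrier E; y \<in> carrier E\<rbrakk> \<Longrightarrow>
    ract E (x \<oplus>\<^bsub>E\<^esub> y) a = ract E x a \<oplus>\<^bsub>E\<^esub> ract E y a"
  using bimodule by (simp_all add: bimodule_def)

lemma act_plus:
  "\<lbrakk>a \<in> carrier A; b \<in> carrier A; x \<in> carrier E\<rbrakk> \<Longrightarrow>
    lact E (a \<oplus> b) x = lact E a x \<oplus>\<^bsub>E\<^esub> lact E b x"
  "\<lbrakk>a \<in> carrier A; b \<in> carrier A; x \<in> carrier E\<rbrakk> \<Longrightarrow>
    ract E x (a \<oplus> b) = ract E x a \<oplus>\<^bsub>E\<^esub> ract E x b"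
  using bimodule by (simp_all add: bimodule_def)

lemma act_mult:
  "\<lbrakk>a \<in> carrier A; b \<in> carrier A; x \<in> carrier E\<rbrakk> \<Longrightarrow>
    lact E (a \<otimes> b) x = lact E a (lact E b x)"
  "\<lbrakk>a \<in> carrier A; b \<in> carrier A; x \<in> carrier E\<rbrakk> \<Longrightarrow>
    ract E x (a \<otimes> b) = ract E (ract E x a) b"
  using bimodule by (simp_all add: bimodule_def)

lemma act_assoc:
  "\<lbrakk>a \<in> carrier A; b \<in> carrier A; x \<in> carrier E\<rbrakk> \<Longrightarrow>
    ract E (lact E a x) b = lact E a (ract E x b)"
  using bimodule by (simp add: bimodule_def)

lemma act_one [simp]:
  "x \<in> carrier E \<Longrightarrow> lact E \<one> x = x" "x \<in> carrier E \<Longrightarrow> ract E x \<one> = x"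
  using bimodule by (simp_all add: bimodule_def)

text \<open>The compatibility of the actions with complex scalars, read at the unit of the algebra.
  Scalars can thus be treated as elements \<open>scal c\<close>, and identities for the two actions
  cover them.\<close>

lemma smult_E: "x \<in> carrier E \<Longrightarrow> c \<odot>\<^bsub>E\<^esub> x = lact E (scal c) x"
  "x \<in> carrier E \<Longrightarrow> c \<odot>\<^bsub>E\<^esub> x = ract E x (scal c)"
proof -
  assume x: "x \<in> carrier E"
  have "lact E (scal c) x = c \<odot>\<^bsub>E\<^esub> lact E \<one> x" "ract E x (scal c) = c \<odot>\<^bsub>E\<^esub> ract E x \<one>"
    using bimodule x A.one_closed unfolding bimodule_def by blast+
  then show "c \<odot>\<^bsub>E\<^esub> x = lact E (scal c) x" "c \<odot>\<^bsub>E\<^esub> x = ract E x (scal c)"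
    using x by simp_all
qed

lemma lact_hom: "a \<in> carrier A \<Longrightarrow> lact E a \<in> add_hom E E"
  by (rule add_homI) (simp_all add: act_add)

lemma ract_hom: "a \<in> carrier A \<Longrightarrow> (\<lambda>x. ract E x a) \<in> add_hom E E"
  by (rule add_homI) (simp_all add: act_add)

end

text \<open>All axioms on complex scalars follow once the scalar multiplication is the action of
  \<open>scal c\<close>, and this action is the same from both sides.\<close>

lemma (in calgebra) bimoduleI:
  assumes E: "abelian_group E"
    and closed: "\<And>a x. \<lbrakk>a \<in> carrier A; x \<in> carrier E\<rbrakk> \<Longrightarrow> lact E a x \<in> carrier E"
      "\<And>a x. \<lbrakk>a \<in> carrier A; x \<in> carrier E\<rbrakk> \<Longrightarrow> ract E x a \<in> carrier E"
    and add: "\<And>a x y. \<lbrakk>a \<in> carrier A; x \<in> carrier E; y \<in> carrier E\<rbrakk> \<Longrightarrow>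
        lact E a (x \<oplus>\<^bsub>E\<^esub> y) = lact E a x \<oplus>\<^bsub>E\<^esub> lact E a y"
      "\<And>a x y. \<lbrakk>a \<in> carrier A; x \<in> carrier E; y \<in> carrier E\<rbrakk> \<Longrightarrow>
        ract E (x \<oplus>\<^bsub>E\<^esub> y) a = ract E x a \<oplus>\<^bsub>E\<^esub> ract E y a"
    and plus: "\<And>a b x. \<lbrakk>a \<in> carrier A; b \<in> carrier A; x \<in> carrier E\<rbrakk> \<Longrightarrow>
        lact E (a \<oplus> b) x = lact E a x \<oplus>\<^bsub>E\<^esub> lact E b x"
      "\<And>a b x. \<lbrakk>a \<in> carrier A; b \<in> carrier A; x \<in> carrier E\<rbrakk> \<Longrightarrow>
        ract E x (a \<oplus> b) = ract E x a \<oplus>\<^bsub>E\<^esub> ract E x b"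
    and mult: "\<And>a b x. \<lbrakk>a \<in> carrier A; b \<in> carrier A; x \<in> carrier E\<rbrakk> \<Longrightarrow>
        lact E (a \<otimes> b) x = lact E a (lact E b x)"
      "\<And>a b x. \<lbrakk>a \<in> carrier A; b \<in> carrier A; x \<in> carrier E\<rbrakk> \<Longrightarrow>
        ract E x (a \<otimes> b) = ract E (ract E x a) b"
    and assoc: "\<And>a b x. \<lbrakk>a \<in> carrier A; b \<in> carrier A; x \<in> carrier E\<rbrakk> \<Longrightarrow>
        ract E (lact E a x) b = lact E a (ract E x b)"
    and one: "\<And>x. x \<in> carrier E \<Longrightarrow> lact E \<one> x = x" "\<And>x. x \<in> carrier E \<Longrightarrow> ract E x \<one> = x"
    and smult: "\<And>c x. x \<in> carrier E \<Longrightarrow> c \<odot>\<^bsub>E\<^esub> x = lact E (scal c) x"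
      "\<And>c x. x \<in> carrier E \<Longrightarrow> lact E (scal c) x = ract E x (scal c)"
  shows "bimodule A E"
proof -
  have sr: "c \<odot>\<^bsub>E\<^esub> x = ract E x (scal c)" if "x \<in> carrier E" for c x
    using smult that by simp
  have "module complex_ring E"
  proof (rule moduleI)
    show "(a \<oplus>\<^bsub>complex_ring\<^esub> b) \<odot>\<^bsub>E\<^esub> x = a \<odot>\<^bsub>E\<^esub> x \<oplus>\<^bsub>E\<^esub> b \<odot>\<^bsub>E\<^esub> x" if "x \<in> carrier E" for a b x
      using that by (simp add: smult(1) scal_simps plus(1))
    show "(a \<otimes>\<^bsub>complex_ring\<^esub> b) \<odot>\<^bsub>E\<^esub> x = a \<odot>\<^bsub>E\<^esub> (b \<odot>\<^bsub>E\<^esub> x)" if "x \<in> carrier E" for a b x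
      using that by (simp add: smult(1) scal_simps(1) mult(1) closed del: smult(2))
    show "a \<odot>\<^bsub>E\<^esub> (x \<oplus>\<^bsub>E\<^esub> y) = a \<odot>\<^bsub>E\<^esub> x \<oplus>\<^bsub>E\<^esub> a \<odot>\<^bsub>E\<^esub> y" if "x \<in> carrier E" "y \<in> carrier E" for a x y
      using that abelian_monoid.a_closed[OF abelian_group.axioms(1)[OF E], of x y]
      by (simp add: smult(1) add(1))
    show "\<one>\<^bsub>complex_ring\<^esub> \<odot>\<^bsub>E\<^esub> x = x" if "x \<in> carrier E" for x
      using that by (simp add: smult(1) scal_simps(3) one)
    show "a \<odot>\<^bsub>E\<^esub> x \<in> carrier E" if "x \<in> carrier E" for a x
      using that by (simp add: smult(1) closed)
  qed (simp_all add: cring_complex_ring E)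
  moreover have "lact E (c \<odot> a) x = c \<odot>\<^bsub>E\<^esub> lact E a x" "lact E a (c \<odot>\<^bsub>E\<^esub> x) = c \<odot>\<^bsub>E\<^esub> lact E a x"
      "ract E x (c \<odot> a) = c \<odot>\<^bsub>E\<^esub> ract E x a" "ract E (c \<odot>\<^bsub>E\<^esub> x) a = c \<odot>\<^bsub>E\<^esub> ract E x a"
    if h: "a \<in> carrier A" "x \<in> carrier E" for c a x
  proof -
    note m = smult_eq_scal[OF h(1), of c] mult[of _ _ x] closed[OF h]
    show "lact E (c \<odot> a) x = c \<odot>\<^bsub>E\<^esub> lact E a x" "lact E a (c \<odot>\<^bsub>E\<^esub> x) = c \<odot>\<^bsub>E\<^esub> lact E a x"
      using h m smult(1) smult_A_closed[OF A.one_closed] by metis+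
    show "ract E x (c \<odot> a) = c \<odot>\<^bsub>E\<^esub> ract E x a" "ract E (c \<odot>\<^bsub>E\<^esub> x) a = c \<odot>\<^bsub>E\<^esub> ract E x a"
      using h m sr smult_A_closed[OF A.one_closed] by metis+
  qed
  ultimately show ?thesis
    unfolding bimodule_def by (intro conjI ballI allI) (simp_all add: closed add plus mult assoc one)
qed

lemma (in calgebra) bimodule_self: "bimodule A (self_bimod A)"
  by (rule bimoduleI)
    (simp_all add: self_bimod_def A.l_distr A.r_distr A.m_assoc smult_A_mult
      abelian_group_cong[OF A.is_abelian_group])

context
  fixes c :: "'e \<Rightarrow> 'u" and E :: "('a, 'e) bimod"
  assumes inj: "inj c"
begin

lemma relabel_simps:
  "carrier (relabel_bimod c E) = c ` carrier E"
  "\<zero>\<^bsub>relabel_bimod c E\<^esub> = c \<zero>\<^bsub>E\<^esub>"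
  "c x \<oplus>\<^bsub>relabel_bimod c E\<^esub> c y = c (x \<oplus>\<^bsub>E\<^esub> y)"
  "k \<odot>\<^bsub>relabel_bimod c E\<^esub> c x = c (k \<odot>\<^bsub>E\<^esub> x)"
  "lact (relabel_bimod c E) a (c x) = c (lact E a x)"
  "ract (relabel_bimod c E) (c x) a = c (ract E x a)"
  by (simp_all add: relabel_bimod_def inv_f_f[OF inj])

lemma relabel_hom: "c \<in> add_hom E (relabel_bimod c E)"
  by (rule add_homI) (simp_all add: relabel_simps)

lemma inv_relabel_hom: "inv_into UNIV c \<in> add_hom (relabel_bimod c E) E"
  by (rule add_homI) (auto simp: relabel_simps inv_f_f[OF inj])

lemma abelian_group_relabel:
  assumes "abelian_group E" shows "abelian_group (relabel_bimod c E)"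
proof -
  interpret E: abelian_group E by fact
  show ?thesis
  proof (rule abelian_groupI)
    fix x assume "x \<in> carrier (relabel_bimod c E)"
    then obtain x' where "x = c x'" "x' \<in> carrier E" by (auto simp: relabel_simps)
    then show "\<exists>y\<in>carrier (relabel_bimod c E). y \<oplus>\<^bsub>relabel_bimod c E\<^esub> x = \<zero>\<^bsub>relabel_bimod c E\<^esub>"
      by (intro bexI[of _ "c (\<ominus>\<^bsub>E\<^esub> x')"]) (simp_all add: relabel_simps E.l_neg)
  qed (auto simp: relabel_simps E.a_ac)
qed

end

lemma (in bimod) bimodule_relabel:
  assumes inj: "inj c" shows "bimodule A (relabel_bimod c E)"
proof -
  note s = relabel_simps[OF inj]
  show ?thesis
  proof (rule bimoduleI)
    show "abelian_group (relabel_bimod c E)"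
      by (rule abelian_group_relabel[OF inj abelian_group_E])
    show "k \<odot>\<^bsub>relabel_bimod c E\<^esub> x = lact (relabel_bimod c E) (scal k) x"
      if "x \<in> carrier (relabel_bimod c E)" for k x
      using that by (auto simp: s smult_E(1))
    show "lact (relabel_bimod c E) (scal k) x = ract (relabel_bimod c E) x (scal k)"
      if "x \<in> carrier (relabel_bimod c E)" for k x
      using that smult_E by (auto simp: s)
  qed (auto simp: s act_add act_plus act_mult act_assoc)
qed

subsection \<open>Tensor powers\<close>

text \<open>The multi-additive functions, balanced over the algebra, that factor through the tensor
  power. The relations are restated with \<open>#\<close>, the form that lists have after
  simplification.\<close>

definition balanced ::
  "(complex, 'a, 'm) module_scheme \<Rightarrow> ('a, 'e) bimod \<Rightarrow> nat \<Rightarrow> ('t, 'n) ring_scheme \<Rightarrow> ('e list \<Rightarrow> 't) \<Rightarrow> bool"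
  where
  "balanced A E n T f \<longleftrightarrow> f \<in> words E n \<rightarrow> carrier T \<and>
     (\<forall>us x x' vs. us @ x # vs \<in> words E n \<longrightarrow> x' \<in> carrier E \<longrightarrow>
        f (us @ (x \<oplus>\<^bsub>E\<^esub> x') # vs) = f (us @ x # vs) \<oplus>\<^bsub>T\<^esub> f (us @ x' # vs)) \<and>
     (\<forall>us x a y vs. us @ x # y # vs \<in> words E n \<longrightarrow> a \<in> carrier A \<longrightarrow>
        f (us @ ract E x a # y # vs) = f (us @ x # lact E a y # vs))"

lemma balancedI:
  assumes "\<And>xs. xs \<in> words E n \<Longrightarrow> f xs \<in> carrier T"
    and "\<And>us x x' vs. \<lbrakk>us @ x # vs \<in> words E n; x' \<in> carrier E\<rbrakk> \<Longrightarrow>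
        f (us @ (x \<oplus>\<^bsub>E\<^esub> x') # vs) = f (us @ x # vs) \<oplus>\<^bsub>T\<^esub> f (us @ x' # vs)"
    and "\<And>us x a y vs. \<lbrakk>us @ x # y # vs \<in> words E n; a \<in> carrier A\<rbrakk> \<Longrightarrow>
        f (us @ ract E x a # y # vs) = f (us @ x # lact E a y # vs)"
  shows "balanced A E n T f"
  using assms by (auto simp: balanced_def)

lemma balancedD:
  assumes "balanced A E n T f"
  shows "xs \<in> words E n \<Longrightarrow> f xs \<in> carrier T"
    and "\<lbrakk>us @ x # vs \<in> words E n; x' \<in> carrier E\<rbrakk> \<Longrightarrow>
        f (us @ (x \<oplus>\<^bsub>E\<^esub> x') # vs) = f (us @ x # vs) \<oplus>\<^bsub>T\<^esub> f (us @ x' # vs)"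
    and "\<lbrakk>us @ x # y # vs \<in> words E n; a \<in> carrier A\<rbrakk> \<Longrightarrow>
        f (us @ ract E x a # y # vs) = f (us @ x # lact E a y # vs)"
  using assms by (auto simp: balanced_def)

lemma balanced_compose:
  assumes "balanced A E n T f" "h \<in> add_hom T T'"
  shows "balanced A E n T' (\<lambda>xs. h (f xs))"
proof -
  have w: "us @ x' # vs \<in> words E n" if "us @ x # vs \<in> words E n" "x' \<in> carrier E" for us x x' vs
    using that by (auto simp: words_def)
  show ?thesis
    by (rule balancedI)
      (simp_all add: balancedD[OF assms(1)] add_hom_closed[OF assms(2)] add_hom_add[OF assms(2)] w)
qed

lemma keys_frag_diff: "Poly_Mapping.keys (frag_of u - frag_of v) \<subseteq> {u, v}"
  using keys_diff[of "frag_of u" "frag_of v"] by auto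

lemma keys_frag_diff2: "Poly_Mapping.keys (frag_of u - frag_of v - frag_of w) \<subseteq> {u, v, w}"
  using keys_diff[of "frag_of u - frag_of v" "frag_of w"] keys_frag_diff[of u v] by auto

context bimod
begin

lemma tpow_rels_cases:
  assumes "r \<in> tpow_rels A E n"
  obtains us x x' vs where
    "r = frag_of (us @ [x \<oplus>\<^bsub>E\<^esub> x'] @ vs) - frag_of (us @ [x] @ vs) - frag_of (us @ [x'] @ vs)"
    "us @ [x] @ vs \<in> words E n" "x' \<in> carrier E"
  | us x a y vs where
    "r = frag_of (us @ [ract E x a, y] @ vs) - frag_of (us @ [x, lact E a y] @ vs)"
    "us @ [x, y] @ vs \<in> words E n" "a \<in> carrier A"
  using assms unfolding tpow_rels_def by blast

lemma presentation_tpow: "presentation (words E n) (tpow_rels A E n)"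
proof
  fix r assume "r \<in> tpow_rels A E n"
  then show "Poly_Mapping.keys r \<subseteq> words E n"
  proof (cases rule: tpow_rels_cases)
    case (1 us x x' vs)
    have "{us @ [x \<oplus>\<^bsub>E\<^esub> x'] @ vs, us @ [x] @ vs, us @ [x'] @ vs} \<subseteq> words E n"
      using 1(2,3) by (auto simp: words_def)
    then show ?thesis unfolding 1(1) using keys_frag_diff2 by (rule order_trans[rotated])
  next
    case (2 us x a y vs)
    have "{us @ [ract E x a, y] @ vs, us @ [x, lact E a y] @ vs} \<subseteq> words E n"
      using 2(2,3) by (auto simp: words_def)
    then show ?thesis unfolding 2(1) using keys_frag_diff by (rule order_trans[rotated])
  qed
qed

interpretation pr: presentation "words E n" "tpow_rels A E n" for n
  by (rule presentation_tpow)

lemma tpow_simps: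
  "carrier (tpow A E n) = carrier (presented (words E n) (tpow_rels A E n))"
  "add (tpow A E n) = add (presented (words E n) (tpow_rels A E n))"
  "zero (tpow A E n) = zero (presented (words E n) (tpow_rels A E n))"
  by (simp_all add: tpow_def presented_bimod_def)

lemma word_tens_eq: "xs \<in> words E n \<Longrightarrow> word_tens A E xs = gen_class (words E n) (tpow_rels A E n) xs"
  by (simp add: word_tens_def words_def)

lemma abelian_group_tpow: "abelian_group (tpow A E n)"
  by (rule abelian_group_cong[OF pr.abelian_group_presented]) (simp_all add: tpow_simps)

lemma add_hom_tpow: "add_hom (tpow A E n) T = add_hom (presented (words E n) (tpow_rels A E n)) T"
  by (rule add_hom_cong) (simp_all add: tpow_simps)

lemma word_tens_closed: "xs \<in> words E n \<Longrightarrow> word_tens A E xs \<in> carrier (tpow A E n)"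
  by (simp add: tpow_simps pr.gen_class_closed word_tens_eq)

lemma word_tens_balanced: "balanced A E n (tpow A E n) (word_tens A E)"
proof (rule balancedI)
  fix us x x' vs assume w: "us @ x # vs \<in> words E n" "x' \<in> carrier E"
  then have w': "us @ x' # vs \<in> words E n" "us @ (x \<oplus>\<^bsub>E\<^esub> x') # vs \<in> words E n"
    by (auto simp: words_def)
  have "frag_of (us @ (x \<oplus>\<^bsub>E\<^esub> x') # vs) - frag_of (us @ x # vs) - frag_of (us @ x' # vs) \<in> tpow_rels A E n"
    unfolding tpow_rels_def using w by fastforce
  from pr.gen_class_add[OF this w'(2) w(1) w'(1)]
  show "word_tens A E (us @ (x \<oplus>\<^bsub>E\<^esub> x') # vs) =
      word_tens A E (us @ x # vs) \<oplus>\<^bsub>tpow A E n\<^esub> word_tens A E (us @ x' # vs)"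
    using w w' by (simp add: word_tens_eq tpow_simps)
next
  fix us x a y vs assume w: "us @ x # y # vs \<in> words E n" "a \<in> carrier A"
  then have w': "us @ ract E x a # y # vs \<in> words E n" "us @ x # lact E a y # vs \<in> words E n"
    by (auto simp: words_def)
  have "frag_of (us @ ract E x a # y # vs) - frag_of (us @ x # lact E a y # vs) \<in> tpow_rels A E n"
    unfolding tpow_rels_def using w by fastforce
  from pr.gen_class_eq[OF this w']
  show "word_tens A E (us @ ract E x a # y # vs) = word_tens A E (us @ x # lact E a y # vs)"
    using w' by (simp add: word_tens_eq)
qed (rule word_tens_closed)

lemma tpow_hom_eqI:
  assumes "abelian_group T" "h \<in> add_hom (tpow A E n) T" "k \<in> add_hom (tpow A E n) T"
    and "\<And>xs. xs \<in> words E n \<Longrightarrow> h (word_tens A E xs) = k (word_tens A E xs)"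
    and "U \<in> carrier (tpow A E n)"
  shows "h U = k U"
  by (rule pr.add_hom_eqI[where n = n and T = T])
    (use assms in \<open>simp_all add: add_hom_tpow tpow_simps word_tens_eq\<close>)

lemma tpow_induced_eq:
  assumes "abelian_group T" "h \<in> add_hom (tpow A E n) T"
    and "\<And>xs. xs \<in> words E n \<Longrightarrow> f xs = h (word_tens A E xs)" and "U \<in> carrier (tpow A E n)"
  shows "induced T f U = h U"
  by (rule pr.induced_eq[where n = n])
    (use assms in \<open>simp_all add: add_hom_tpow tpow_simps word_tens_eq\<close>)

text \<open>Universal property of the tensor power: the two equations in \<open>balanced\<close> say
  that the two families of relations are killed.\<close>

lemma tpow_induced:
  assumes T: "abelian_group T" and f: "balanced A E n T f"
  shows "induced T f \<in> add_hom (tpow A E n) T"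
    and "xs \<in> words E n \<Longrightarrow> induced T f (word_tens A E xs) = f xs"
proof -
  interpret T: abelian_group T by fact
  have fW: "f \<in> words E n \<rightarrow> carrier T" using balancedD(1)[OF f] by auto
  have kill: "free_extend T f r = \<zero>\<^bsub>T\<^esub>" if "r \<in> tpow_rels A E n" for r
    using that
  proof (cases rule: tpow_rels_cases)
    case (1 us x x' vs)
      from 1(2,3) have w: "us @ x # vs \<in> words E n" "us @ x' # vs \<in> words E n" "us @ (x \<oplus>\<^bsub>E\<^esub> x') # vs \<in> words E n"
        by (auto simp: words_def)
      have k: "Poly_Mapping.keys (frag_of (us @ (x \<oplus>\<^bsub>E\<^esub> x') # vs) - frag_of (us @ x # vs)) \<subseteq> words E n"
        using w by (intro order_trans[OF keys_frag_diff]) simp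
      have c: "f (us @ x # vs) \<in> carrier T" "f (us @ x' # vs) \<in> carrier T"
        using balancedD(1)[OF f] w by auto
      have "free_extend T f r = (f (us @ x # vs) \<oplus>\<^bsub>T\<^esub> f (us @ x' # vs)) \<ominus>\<^bsub>T\<^esub> f (us @ x # vs) \<ominus>\<^bsub>T\<^esub> f (us @ x' # vs)"
        unfolding 1(1) using w k 1(3)
        by (simp add: free_extend_minus[OF T fW] free_extend_hom(3)[OF T fW] balancedD(2)[OF f])
      also have "\<dots> = \<zero>\<^bsub>T\<^esub>"
        using c by (simp add: a_minus_def T.a_ac T.r_neg T.r_neg1)
      finally show ?thesis .
    next
      case (2 us x a y vs)
      from 2(2,3) have w: "us @ x # y # vs \<in> words E n" "us @ ract E x a # y # vs \<in> words E n"
          "us @ x # lact E a y # vs \<in> words E n"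
        by (auto simp: words_def)
      then show ?thesis unfolding 2(1) using 2(3) balancedD(1)[OF f w(3)]
        by (simp add: free_extend_minus[OF T fW] free_extend_hom(3)[OF T fW] balancedD(3)[OF f]
            a_minus_def T.r_neg)
  qed
  show "induced T f \<in> add_hom (tpow A E n) T"
    unfolding add_hom_tpow by (rule pr.induced_hom(1)[OF T fW kill])
  show "induced T f (word_tens A E xs) = f xs" if "xs \<in> words E n"
    using pr.induced_hom(2)[OF T fW kill that] word_tens_eq[OF that] by simp
qed

text \<open>The action meets a relation only at the head of the word. There additivity of the
  action, or the commuting of left and right action, preserves it; further inside it is the same
  relation behind a changed head.\<close>

lemma balanced_lact:
  assumes f: "balanced A E (Suc n) T f" and a: "a \<in> carrier A"
  shows "balanced A E (Suc n) T (\<lambda>xs. f (lact E a (hd xs) # tl xs))"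
proof (rule balancedI)
  fix xs assume "xs \<in> words E (Suc n)"
  then show "f (lact E a (hd xs) # tl xs) \<in> carrier T"
    using a by (intro balancedD(1)[OF f]) (cases xs; auto simp: words_def)
next
  fix us x x' vs assume "us @ x # vs \<in> words E (Suc n)" "x' \<in> carrier E"
  then show "f (lact E a (hd (us @ (x \<oplus>\<^bsub>E\<^esub> x') # vs)) # tl (us @ (x \<oplus>\<^bsub>E\<^esub> x') # vs)) =
      f (lact E a (hd (us @ x # vs)) # tl (us @ x # vs)) \<oplus>\<^bsub>T\<^esub>
      f (lact E a (hd (us @ x' # vs)) # tl (us @ x' # vs))"
    using a balancedD(2)[OF f, of "[]" "lact E a x" vs "lact E a x'"]
      balancedD(2)[OF f, of "lact E a (hd us) # tl us" x vs x']
    by (cases us) (auto simp: words_def act_add)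
next
  fix us x b y vs assume "us @ x # y # vs \<in> words E (Suc n)" "b \<in> carrier A"
  then show "f (lact E a (hd (us @ ract E x b # y # vs)) # tl (us @ ract E x b # y # vs)) =
      f (lact E a (hd (us @ x # lact E b y # vs)) # tl (us @ x # lact E b y # vs))"
    using a balancedD(3)[OF f, of "[]" "lact E a x" y vs b]
      balancedD(3)[OF f, of "lact E a (hd us) # tl us" x y vs b]
    by (cases us) (auto simp: words_def act_assoc)
qed

lemma balanced_ract:
  assumes f: "balanced A E (Suc n) T f" and a: "a \<in> carrier A"
  shows "balanced A E (Suc n) T (\<lambda>xs. f (butlast xs @ [ract E (last xs) a]))"
proof (rule balancedI)
  fix xs assume "xs \<in> words E (Suc n)"
  then show "f (butlast xs @ [ract E (last xs) a]) \<in> carrier T"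
    using a by (intro balancedD(1)[OF f]) (cases xs rule: rev_cases; auto simp: words_def)
next
  fix us x x' vs assume "us @ x # vs \<in> words E (Suc n)" "x' \<in> carrier E"
  then show "f (butlast (us @ (x \<oplus>\<^bsub>E\<^esub> x') # vs) @ [ract E (last (us @ (x \<oplus>\<^bsub>E\<^esub> x') # vs)) a]) =
      f (butlast (us @ x # vs) @ [ract E (last (us @ x # vs)) a]) \<oplus>\<^bsub>T\<^esub>
      f (butlast (us @ x' # vs) @ [ract E (last (us @ x' # vs)) a])"
    using a balancedD(2)[OF f, of us "ract E x a" "[]" "ract E x' a"]
      balancedD(2)[OF f, of us x "butlast vs @ [ract E (last vs) a]" x']
    by (cases vs rule: rev_cases) (auto simp: words_def act_add butlast_append)
next
  fix us x b y vs assume "us @ x # y # vs \<in> words E (Suc n)" "b \<in> carrier A"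
  then show "f (butlast (us @ ract E x b # y # vs) @ [ract E (last (us @ ract E x b # y # vs)) a]) =
      f (butlast (us @ x # lact E b y # vs) @ [ract E (last (us @ x # lact E b y # vs)) a])"
    using a balancedD(3)[OF f, of us x "ract E y a" "[]" b]
      balancedD(3)[OF f, of us x y "butlast vs @ [ract E (last vs) a]" b]
    by (cases vs rule: rev_cases) (auto simp: words_def act_assoc butlast_append)
qed

lemma balanced_cong:
  assumes "balanced A E n T f" "\<And>xs. xs \<in> words E n \<Longrightarrow> g xs = f xs"
  shows "balanced A E n T g"
proof -
  have w: "us @ x' # vs \<in> words E n" if "us @ x # vs \<in> words E n" "x' \<in> carrier E" for us x x' vs
    using that by (auto simp: words_def)
  have w2: "us @ x' # y' # vs \<in> words E n"
    if "us @ x # y # vs \<in> words E n" "x' \<in> carrier E" "y' \<in> carrier E" for us x x' y y' vs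
    using that by (auto simp: words_def)
  show ?thesis
  proof (rule balancedI)
    fix us x x' vs assume *: "us @ x # vs \<in> words E n" "x' \<in> carrier E"
    then have "x \<in> carrier E" by (auto simp: words_def)
    then show "g (us @ (x \<oplus>\<^bsub>E\<^esub> x') # vs) = g (us @ x # vs) \<oplus>\<^bsub>T\<^esub> g (us @ x' # vs)"
      using * w[OF *(1)] by (simp add: assms(2) balancedD[OF assms(1)])
  next
    fix us x a y vs assume *: "us @ x # y # vs \<in> words E n" "a \<in> carrier A"
    then have "x \<in> carrier E" "y \<in> carrier E" by (auto simp: words_def)
    then show "g (us @ ract E x a # y # vs) = g (us @ x # lact E a y # vs)"
      using * w2[OF *(1)] by (simp add: assms(2) balancedD[OF assms(1)])
  qed (simp add: assms(2) balancedD(1)[OF assms(1)])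
qed

text \<open>The length is \<open>Suc n\<close> because the actions are carried by the first and the
  last letter, which an empty word lacks.\<close>

lemma tpow_lact:
  assumes "a \<in> carrier A"
  shows "lact (tpow A E (Suc n)) a \<in> add_hom (tpow A E (Suc n)) (tpow A E (Suc n))"
    and "x # xs \<in> words E (Suc n) \<Longrightarrow>
      lact (tpow A E (Suc n)) a (word_tens A E (x # xs)) = word_tens A E (lact E a x # xs)"
proof -
  let ?T = "tpow A E (Suc n)" and ?Q = "presented (words E (Suc n)) (tpow_rels A E (Suc n))"
  let ?f = "\<lambda>xs. gen_class (words E (Suc n)) (tpow_rels A E (Suc n)) (lact E a (hd xs) # tl xs)"
  have l: "lact ?T a = induced ?Q ?f"
    by (simp add: tpow_def presented_bimod_def)
  have "balanced A E (Suc n) ?T ?f"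
    by (rule balanced_cong[OF balanced_lact[OF word_tens_balanced assms]])
      (subst word_tens_eq[where n = "Suc n"];
        use assms in \<open>auto simp: words_def neq_Nil_conv length_Suc_conv\<close>)
  then have b: "balanced A E (Suc n) ?Q ?f"
    by (simp add: balanced_def tpow_simps)
  note i = tpow_induced[OF pr.abelian_group_presented b]
  show "lact ?T a \<in> add_hom ?T ?T"
    unfolding l using i(1) by (simp add: add_hom_def tpow_simps)
  show "lact ?T a (word_tens A E (x # xs)) = word_tens A E (lact E a x # xs)"
    if w: "x # xs \<in> words E (Suc n)"
    unfolding l i(2)[OF w] using w assms
    by (subst word_tens_eq[where n = "Suc n"]) (auto simp: words_def)
qed

lemma tpow_ract:
  assumes "a \<in> carrier A"
  shows "(\<lambda>U. ract (tpow A E (Suc n)) U a) \<in> add_hom (tpow A E (Suc n)) (tpow A E (Suc n))"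
    and "xs @ [x] \<in> words E (Suc n) \<Longrightarrow>
      ract (tpow A E (Suc n)) (word_tens A E (xs @ [x])) a = word_tens A E (xs @ [ract E x a])"
proof -
  let ?T = "tpow A E (Suc n)" and ?Q = "presented (words E (Suc n)) (tpow_rels A E (Suc n))"
  let ?f = "\<lambda>xs. gen_class (words E (Suc n)) (tpow_rels A E (Suc n)) (butlast xs @ [ract E (last xs) a])"
  have l: "(\<lambda>U. ract ?T U a) = induced ?Q ?f"
    by (simp add: tpow_def presented_bimod_def fun_eq_iff)
  have "butlast xs @ [ract E (last xs) a] \<in> words E (Suc n)" if "xs \<in> words E (Suc n)" for xs
    using that assms by (cases xs rule: rev_cases) (auto simp: words_def)
  then have "balanced A E (Suc n) ?T ?f"
    by (intro balanced_cong[OF balanced_ract[OF word_tens_balanced assms]])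
      (simp add: word_tens_eq[where n = "Suc n"])
  then have b: "balanced A E (Suc n) ?Q ?f"
    by (simp add: balanced_def tpow_simps)
  note i = tpow_induced[OF pr.abelian_group_presented b]
  show "(\<lambda>U. ract ?T U a) \<in> add_hom ?T ?T"
    unfolding l using i(1) by (simp add: add_hom_def tpow_simps)
  show "ract ?T (word_tens A E (xs @ [x])) a = word_tens A E (xs @ [ract E x a])"
    if w: "xs @ [x] \<in> words E (Suc n)"
  proof -
    have "ract ?T (word_tens A E (xs @ [x])) a = induced ?Q ?f (word_tens A E (xs @ [x]))"
      using l by (rule fun_cong)
    also have "\<dots> = word_tens A E (xs @ [ract E x a])"
      unfolding i(2)[OF w] using w assms
      by (subst word_tens_eq[where n = "Suc n"]) (auto simp: words_def)
    finally show ?thesis .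
  qed
qed

text \<open>A complex scalar travels through a word: on each letter \<open>scal c\<close> acts
  equally from both sides, and balancedness hands it to the next letter. This is what makes the two
  actions of \<open>scal c\<close> on a tensor power agree.\<close>

lemma word_tens_scal_move:
  assumes "us @ x # xs \<in> words E (Suc n)"
  shows "word_tens A E (us @ lact E (scal c) x # xs) =
    word_tens A E (us @ butlast (x # xs) @ [ract E (last (x # xs)) (scal c)])"
  using assms
proof (induction xs arbitrary: us x)
  case Nil
  then show ?case using smult_E[of x c] by (simp add: words_def)
next
  case (Cons y ys)
  have "lact E (scal c) x = ract E x (scal c)"
    using Cons.prems smult_E[of x c] by (simp add: words_def)
  then have "word_tens A E (us @ lact E (scal c) x # y # ys) = word_tens A E ((us @ [x]) @ lact E (scal c) y # ys)"
    using balancedD(3)[OF word_tens_balanced Cons.prems, of "scal c"] by simp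
  also have "\<dots> = word_tens A E ((us @ [x]) @ butlast (y # ys) @ [ract E (last (y # ys)) (scal c)])"
    by (rule Cons.IH) (use Cons.prems in \<open>simp add: words_def\<close>)
  finally show ?case by simp
qed

text \<open>On generators the scalar changes the first letter just as \<open>scal c\<close> does, so
  \<open>induced_eq\<close> applies with the left action as the known additive map.\<close>

lemma tpow_smult:
  assumes "U \<in> carrier (tpow A E (Suc n))"
  shows "c \<odot>\<^bsub>tpow A E (Suc n)\<^esub> U = lact (tpow A E (Suc n)) (scal c) U"
proof -
  let ?T = "tpow A E (Suc n)" and ?Q = "presented (words E (Suc n)) (tpow_rels A E (Suc n))"
  have h: "lact ?T (scal c) \<in> add_hom ?Q ?Q"
    using tpow_lact(1)[of "scal c" n] by (simp add: add_hom_def tpow_simps)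
  have "induced ?Q (\<lambda>xs. gen_class (words E (Suc n)) (tpow_rels A E (Suc n)) ((c \<odot>\<^bsub>E\<^esub> hd xs) # tl xs)) U =
      lact ?T (scal c) U"
  proof (rule pr.induced_eq[OF pr.abelian_group_presented h])
    fix w assume w: "w \<in> words E (Suc n)"
    then obtain x xs where x: "w = x # xs" by (cases w) (auto simp: words_def)
    then have "(c \<odot>\<^bsub>E\<^esub> x) = lact E (scal c) x" "lact E (scal c) x # xs \<in> words E (Suc n)"
      using w smult_E(1)[of x c] by (auto simp: words_def)
    then show "gen_class (words E (Suc n)) (tpow_rels A E (Suc n)) ((c \<odot>\<^bsub>E\<^esub> hd w) # tl w) =
        lact ?T (scal c) (gen_class (words E (Suc n)) (tpow_rels A E (Suc n)) w)"
      using tpow_lact(2)[of "scal c" x xs n] w by (simp add: x word_tens_eq)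
  qed (use assms in \<open>simp add: tpow_simps\<close>)
  then show ?thesis by (simp add: tpow_def presented_bimod_def)
qed

lemma bimodule_tpow: "bimodule A (tpow A E (Suc n))"
proof -
  let ?T = "tpow A E (Suc n)"
  interpret T: abelian_group ?T by (rule abelian_group_tpow)
  note T = abelian_group_tpow[of "Suc n"]
  note l = tpow_lact[where n = n] and r = tpow_ract[where n = n]
  note cl = add_hom_closed[OF l(1)] add_hom_closed[OF r(1)]
  \<comment> \<open>Words are split at the front for the left action and at the back
    (\<open>eqI'\<close>) for the right action, at the letter which that action changes.\<close>
  have eqI: "h U = k U"
    if "\<And>x xs. x # xs \<in> words E (Suc n) \<Longrightarrow> h (word_tens A E (x # xs)) = k (word_tens A E (x # xs))"
      and "h \<in> add_hom ?T ?T" "k \<in> add_hom ?T ?T" "U \<in> carrier ?T" for h k U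
  proof (rule tpow_hom_eqI[OF T that(2,3) _ that(4)])
    fix xs assume "xs \<in> words E (Suc n)"
    then show "h (word_tens A E xs) = k (word_tens A E xs)"
      using that(1) by (cases xs) (auto simp: words_def)
  qed
  have eqI': "h U = k U"
    if "\<And>x xs. xs @ [x] \<in> words E (Suc n) \<Longrightarrow> h (word_tens A E (xs @ [x])) = k (word_tens A E (xs @ [x]))"
      and "h \<in> add_hom ?T ?T" "k \<in> add_hom ?T ?T" "U \<in> carrier ?T" for h k U
  proof (rule tpow_hom_eqI[OF T that(2,3) _ that(4)])
    fix xs assume "xs \<in> words E (Suc n)"
    then show "h (word_tens A E xs) = k (word_tens A E xs)"
      using that(1) by (cases xs rule: rev_cases) (auto simp: words_def)
  qed
  note lp = add_hom_plus[OF T l(1) l(1)] and rp = add_hom_plus[OF T r(1) r(1)]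
  note ll = add_hom_compose[OF l(1) l(1)] and rr = add_hom_compose[OF r(1) r(1)]
    and lr = add_hom_compose[OF l(1) r(1)] and rl = add_hom_compose[OF r(1) l(1)]
  show ?thesis
  proof (rule bimoduleI)
    fix a b U assume h: "a \<in> carrier A" "b \<in> carrier A" "U \<in> carrier ?T"
    show "lact ?T (a \<oplus> b) U = lact ?T a U \<oplus>\<^bsub>?T\<^esub> lact ?T b U"
    proof (rule eqI[OF _ l(1) lp], goal_cases word)
      case (word x xs)
      then show ?case
        using h balancedD(2)[OF word_tens_balanced, of "[]" "lact E a x" xs "Suc n" "lact E b x"]
        by (auto simp: l act_plus words_def)
    qed (use h in simp_all)
    show "ract ?T U (a \<oplus> b) = ract ?T U a \<oplus>\<^bsub>?T\<^esub> ract ?T U b"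
    proof (rule eqI'[OF _ r(1) rp], goal_cases word)
      case (word x xs)
      then show ?case
        using h balancedD(2)[OF word_tens_balanced, of xs "ract E x a" "[]" "Suc n" "ract E x b"]
        by (auto simp: r act_plus words_def)
    qed (use h in simp_all)
    show "lact ?T (a \<otimes> b) U = lact ?T a (lact ?T b U)"
    proof (rule eqI[OF _ l(1) ll], goal_cases word)
      case (word x xs)
      then show ?case using h l(2)[of a "lact E b x" xs] by (auto simp: l act_mult words_def)
    qed (use h in simp_all)
    show "ract ?T U (a \<otimes> b) = ract ?T (ract ?T U a) b"
    proof (rule eqI'[OF _ r(1) rr], goal_cases word)
      case (word x xs)
      then show ?case using h r(2)[of b xs "ract E x a"] by (auto simp: r act_mult words_def)
    qed (use h in simp_all)
    show "ract ?T (lact ?T a U) b = lact ?T a (ract ?T U b)"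
    proof (rule eqI[OF _ lr rl], goal_cases word)
      case (word x xs)
      show ?case
      \<comment> \<open>In a word of one letter both actions meet on that letter and commute there;
        otherwise they change different letters.\<close>
      proof (cases xs rule: rev_cases)
        case Nil
        then show ?thesis
          using h word l(2)[of a x "[]"] l(2)[of a "ract E x b" "[]"] r(2)[of b "[]" x] r(2)[of b "[]" "lact E a x"]
          by (auto simp: act_assoc words_def)
      next
        case (snoc ys y)
        then show ?thesis using h word l(2)[of a x "ys @ [y]"] l(2)[of a x "ys @ [ract E y b]"]
            r(2)[of b "x # ys" y] r(2)[of b "lact E a x # ys" y]
          by (auto simp: words_def)
      qed
    qed (use h in simp_all)
  next
    fix c U assume U: "U \<in> carrier ?T"
    show "lact ?T \<one> U = U"
      by (rule eqI[OF _ l(1)[OF A.one_closed] add_hom_ident U]) (auto simp: l words_def)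
    show "ract ?T U \<one> = U"
      by (rule eqI'[OF _ r(1)[OF A.one_closed] add_hom_ident U]) (auto simp: r words_def)
    show "c \<odot>\<^bsub>?T\<^esub> U = lact ?T (scal c) U"
      using U by (rule tpow_smult)
    show "lact ?T (scal c) U = ract ?T U (scal c)"
    proof (rule eqI[OF _ l(1) r(1) U], goal_cases word)
      case (word x xs)
      have "x # xs = butlast (x # xs) @ [last (x # xs)]" by simp
      then have "ract ?T (word_tens A E (x # xs)) (scal c) =
          word_tens A E (butlast (x # xs) @ [ract E (last (x # xs)) (scal c)])"
        using r(2)[of "scal c" "butlast (x # xs)" "last (x # xs)"] word by simp
      then show ?case
        using word word_tens_scal_move[of "[]" x xs n c] l(2)[OF _ word, of "scal c"] by simp
    qed simp_all
  qed (simp_all add: T cl add_hom_add[OF l(1)] add_hom_add[OF r(1)])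
qed

end

subsection \<open>The graded algebra of a pair of bimodules\<close>

text \<open>A bimodule map from the tensor product of \<open>P\<close> and \<open>N\<close> to the
  algebra, stored as a function of two arguments.\<close>

locale balanced_pairing = calgebra A + P: bimod A P + N: bimod A N
  for A :: "(complex, 'a, 'm) module_scheme" (structure) and P :: "('a, 'p) bimod" and N :: "('a, 'q) bimod" +
  fixes \<beta> :: "'p \<Rightarrow> 'q \<Rightarrow> 'a"
  assumes closed [simp]: "\<lbrakk>x \<in> carrier P; y \<in> carrier N\<rbrakk> \<Longrightarrow> \<beta> x y \<in> carrier A"
    and add1: "\<lbrakk>x \<in> carrier P; x' \<in> carrier P; y \<in> carrier N\<rbrakk> \<Longrightarrow> \<beta> (x \<oplus>\<^bsub>P\<^esub> x') y = \<beta> x y \<oplus> \<beta> x' y"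
    and add2: "\<lbrakk>x \<in> carrier P; y \<in> carrier N; y' \<in> carrier N\<rbrakk> \<Longrightarrow> \<beta> x (y \<oplus>\<^bsub>N\<^esub> y') = \<beta> x y \<oplus> \<beta> x y'"
    and lact: "\<lbrakk>a \<in> carrier A; x \<in> carrier P; y \<in> carrier N\<rbrakk> \<Longrightarrow> \<beta> (lact P a x) y = a \<otimes> \<beta> x y"
    and ract: "\<lbrakk>a \<in> carrier A; x \<in> carrier P; y \<in> carrier N\<rbrakk> \<Longrightarrow> \<beta> x (ract N y a) = \<beta> x y \<otimes> a"
    and bal: "\<lbrakk>a \<in> carrier A; x \<in> carrier P; y \<in> carrier N\<rbrakk> \<Longrightarrow> \<beta> (ract P x a) y = \<beta> x (lact N a y)"

text \<open>With the mixed laws \<open>\<epsilon>_\<phi>\<close> and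
  \<open>\<phi>_\<epsilon>\<close> this is a Morita context between the algebra and itself. The
  injections \<open>S\<close>, \<open>CP\<close>, \<open>CN\<close> are parameters so that
  exchanging \<open>P\<close> and \<open>N\<close> gives another instance.\<close>

locale pairing = calgebra A + P: bimod A P + N: bimod A N +
    \<epsilon>: balanced_pairing A P N \<epsilon> + \<phi>: balanced_pairing A N P \<phi>
  for A :: "(complex, 'a, 'm) module_scheme" (structure) and P :: "('a, 'p) bimod" and N :: "('a, 'q) bimod"
    and \<epsilon> \<phi> +
  fixes S :: "'a \<Rightarrow> 'u" and CP :: "('p list \<Rightarrow>\<^sub>0 int) set \<Rightarrow> 'u" and CN :: "('q list \<Rightarrow>\<^sub>0 int) set \<Rightarrow> 'u"
  assumes inj_S: "inj S" and inj_CP: "inj CP" and inj_CN: "inj CN"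
    and \<epsilon>_\<phi>: "\<lbrakk>x \<in> carrier P; y \<in> carrier N; x' \<in> carrier P\<rbrakk> \<Longrightarrow> lact P (\<epsilon> x y) x' = ract P x (\<phi> y x')"
    and \<phi>_\<epsilon>: "\<lbrakk>y \<in> carrier N; x \<in> carrier P; y' \<in> carrier N\<rbrakk> \<Longrightarrow> lact N (\<phi> y x) y' = ract N y (\<epsilon> x y')"
begin

definition M :: "int \<Rightarrow> ('a, 'u) bimod" where
  "M n = (if n = 0 then relabel_bimod S (self_bimod A)
     else if n > 0 then relabel_bimod CP (tpow A P (nat n))
     else relabel_bimod CN (tpow A N (nat (- n))))"

definition pw :: "'p list \<Rightarrow> 'u" where
  "pw xs = CP (word_tens A P xs)"

end

text \<open>Exchanging the two bimodules reverses the grading, so every statement about words in \<open>P\<close> has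
  a mirror image for words in \<open>N\<close>.\<close>

sublocale pairing \<subseteq> swap: pairing A N P \<phi> \<epsilon> S CN CP
  by unfold_locales
    (simp_all add: inj_S inj_CP inj_CN \<epsilon>_\<phi> \<phi>_\<epsilon>)

context pairing
begin

abbreviation nw :: "'q list \<Rightarrow> 'u" where "nw \<equiv> swap.pw"

lemma M_swap: "swap.M n = M (- n)"
  by (simp add: M_def swap.M_def)

lemma M_zero: "M 0 = relabel_bimod S (self_bimod A)"
  by (simp add: M_def)

lemma M_pos: "M (1 + int k) = relabel_bimod CP (tpow A P (Suc k))"
  by (simp add: M_def nat_add_distrib)

lemma M_pos': "0 < k \<Longrightarrow> M (int k) = relabel_bimod CP (tpow A P k)"
  by (simp add: M_def)

text \<open>Nonzero degrees are written as \<open>1 + int k\<close> up to sign, matching the length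
  \<open>Suc k\<close> at which the actions on tensor powers are available.\<close>

lemma M_cases:
  obtains "n = 0" | k where "n = 1 + int k" | k where "n = - (1 + int k)"
proof (cases n rule: int_cases3)
  case (pos k)
  then show ?thesis using that(2)[of "k - 1"] by simp
next
  case (neg k)
  then show ?thesis using that(3)[of "k - 1"] by simp
qed (use that in blast)

end

section \<open>The components as bimodules, and their generators\<close>

context pairing
begin

lemma bimodule_M: "bimodule A (M n)"
proof (cases n rule: M_cases)
  case 1
  interpret bimod A "self_bimod A" by unfold_locales (rule bimodule_self)
  show ?thesis using bimodule_relabel[OF inj_S] by (simp add: 1 M_zero)
next
  case (2 k)
  interpret bimod A "tpow A P (Suc k)" by unfold_locales (rule P.bimodule_tpow)
  show ?thesis using bimodule_relabel[OF inj_CP] by (simp add: 2 M_pos)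
next
  case (3 k)
  interpret bimod A "tpow A N (Suc k)" by unfold_locales (rule N.bimodule_tpow)
  show ?thesis using bimodule_relabel[OF inj_CN] swap.M_pos[of k] by (simp add: 3 M_swap)
qed

sublocale M: bimod A "M n" for n
  by unfold_locales (rule bimodule_M)

lemma S_hom: "S \<in> add_hom A (M 0)"
  using relabel_hom[OF inj_S, of "self_bimod A"] by (simp add: M_zero add_hom_def self_bimod_def)

lemma inv_S_hom: "inv_into UNIV S \<in> add_hom (M 0) A"
  using inv_relabel_hom[OF inj_S, of "self_bimod A"] by (simp add: M_zero add_hom_def self_bimod_def)

lemma S_closed [simp]: "a \<in> carrier A \<Longrightarrow> S a \<in> carrier (M 0)"
  by (rule add_hom_closed[OF S_hom])

lemma S_act [simp]:
  "\<lbrakk>a \<in> carrier A; b \<in> carrier A\<rbrakk> \<Longrightarrow> lact (M 0) a (S b) = S (a \<otimes> b)"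
  "\<lbrakk>a \<in> carrier A; b \<in> carrier A\<rbrakk> \<Longrightarrow> ract (M 0) (S a) b = S (a \<otimes> b)"
  by (simp_all add: M_zero relabel_simps[OF inj_S] self_bimod_def)

lemma carrier_M_zero: "carrier (M 0) = S ` carrier A"
  by (simp add: M_zero relabel_simps[OF inj_S] self_bimod_def)

lemma pw_balanced:
  assumes "0 < k" shows "balanced A P k (M (int k)) pw"
  using balanced_compose[OF P.word_tens_balanced relabel_hom[OF inj_CP], of k]
  by (simp add: M_pos'[OF assms] pw_def[abs_def])

lemma pw_closed [simp]: "\<lbrakk>xs \<noteq> []; set xs \<subseteq> carrier P\<rbrakk> \<Longrightarrow> pw xs \<in> carrier (M (int (length xs)))"
  using balancedD(1)[OF pw_balanced, of "length xs" xs] by (simp add: words_def)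

lemma pw_lact:
  assumes "set (x # xs) \<subseteq> carrier P" "a \<in> carrier A"
  shows "lact (M (1 + int (length xs))) a (pw (x # xs)) = pw (lact P a x # xs)"
  using P.tpow_lact(2)[of a x xs "length xs"] assms
  by (simp add: M_pos relabel_simps[OF inj_CP] pw_def words_def)

lemma pw_ract:
  assumes "set (xs @ [x]) \<subseteq> carrier P" "a \<in> carrier A"
  shows "ract (M (1 + int (length xs))) (pw (xs @ [x])) a = pw (xs @ [ract P x a])"
  using P.tpow_ract(2)[of a xs x "length xs"] assms
  by (simp add: M_pos relabel_simps[OF inj_CP] pw_def words_def)

end

context pairing
begin

lemma pw_hom_eqI:
  assumes T: "abelian_group T" and h: "h \<in> add_hom (M n) T" and k: "k \<in> add_hom (M n) T" and "0 < n"
    and eq: "\<And>xs. \<lbrakk>xs \<noteq> []; set xs \<subseteq> carrier P; n = int (length xs)\<rbrakk> \<Longrightarrow> h (pw xs) = k (pw xs)"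
    and u: "u \<in> carrier (M n)"
  shows "h u = k u"
proof -
  have M: "M n = relabel_bimod CP (tpow A P (nat n))" using \<open>0 < n\<close> by (simp add: M_def)
  obtain U where U: "u = CP U" "U \<in> carrier (tpow A P (nat n))"
    using u by (auto simp: M relabel_simps[OF inj_CP])
  note c = add_hom_compose[OF relabel_hom[OF inj_CP]]
  have "h (CP U) = k (CP U)"
  proof (rule P.tpow_hom_eqI[OF T _ _ _ U(2)])
    show "(\<lambda>U. h (CP U)) \<in> add_hom (tpow A P (nat n)) T" "(\<lambda>U. k (CP U)) \<in> add_hom (tpow A P (nat n)) T"
      using c h k unfolding M by blast+
    fix xs assume "xs \<in> words P (nat n)"
    then show "h (CP (word_tens A P xs)) = k (CP (word_tens A P xs))"
      using eq[of xs] \<open>0 < n\<close> by (cases "xs = []") (auto simp: pw_def words_def)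
  qed
  then show ?thesis by (simp add: U)
qed

end

context pairing
begin

text \<open>The main device for identities between additive maps on a component: scalars, words in
  \<open>P\<close> and words in \<open>N\<close> generate, so only these three cases are ever
  computed.\<close>

lemma M_hom_eqI:
  assumes "\<And>a. \<lbrakk>a \<in> carrier A; n = 0\<rbrakk> \<Longrightarrow> h (S a) = k (S a)"
    and "\<And>xs. \<lbrakk>xs \<noteq> []; set xs \<subseteq> carrier P; n = int (length xs)\<rbrakk> \<Longrightarrow> h (pw xs) = k (pw xs)"
    and "\<And>ys. \<lbrakk>ys \<noteq> []; set ys \<subseteq> carrier N; n = - int (length ys)\<rbrakk> \<Longrightarrow> h (nw ys) = k (nw ys)"
    and T: "abelian_group T" and h: "h \<in> add_hom (M n) T" and k: "k \<in> add_hom (M n) T"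
    and u: "u \<in> carrier (M n)"
  shows "h u = k u"
proof (cases "n = 0")
  case True
  then show ?thesis using assms(1) u by (auto simp: carrier_M_zero)
next
  case False
  show ?thesis
  proof (cases "n > 0")
    case True
    then show ?thesis using pw_hom_eqI[OF T h k _ assms(2) u] by blast
  next
    case n: False
    show ?thesis
      by (rule swap.pw_hom_eqI[OF T, of h "- n" k]) (use assms n False in \<open>auto simp: M_swap\<close>)
  qed
qed

definition extP :: "('a, 'u) bimod \<Rightarrow> ('p list \<Rightarrow> 'u) \<Rightarrow> 'u \<Rightarrow> 'u" where
  "extP T f u = induced T f (inv_into UNIV CP u)"

lemma extP:
  assumes "abelian_group T" "balanced A P k T f" "0 < k"
  shows "extP T f \<in> add_hom (M (int k)) T"
    and "xs \<in> words P k \<Longrightarrow> extP T f (pw xs) = f xs"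
  using add_hom_compose[OF inv_relabel_hom[OF inj_CP] P.tpow_induced(1)[OF assms(1,2)]]
    P.tpow_induced(2)[OF assms(1,2)]
  by (simp_all add: M_pos'[OF assms(3)] extP_def[abs_def] pw_def inv_f_f[OF inj_CP])

end

section \<open>Left multiplication by one letter\<close>

context pairing
begin

text \<open>The product of the letter \<open>x\<close> with a word in \<open>N\<close>. The scalar
  produced by \<epsilon> acts on the next letter; a word of one letter has no next letter, and the
  product lands in degree 0.\<close>

definition cancel :: "'p \<Rightarrow> 'q list \<Rightarrow> 'u" where
  "cancel x ys = (if tl ys = [] then S (\<epsilon> x (hd ys)) else nw (lact N (\<epsilon> x (hd ys)) (hd (tl ys)) # tl (tl ys)))"

text \<open>\<open>lam n x\<close> is multiplication by \<open>x\<close> from the left on the component of degree \<open>n\<close>.\<close>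

end

context pairing
begin

definition lam :: "int \<Rightarrow> 'p \<Rightarrow> 'u \<Rightarrow> 'u" where
  "lam n x = (if n = 0 then (\<lambda>u. pw [ract P x (inv_into UNIV S u)])
     else if n > 0 then extP (M (n + 1)) (\<lambda>xs. pw (x # xs))
     else swap.extP (M (n + 1)) (cancel x))"

lemma pw_single_hom: "(\<lambda>x. pw [x]) \<in> add_hom P (M 1)"
proof (rule add_homI)
  show "pw [x] \<in> carrier (M 1)" if "x \<in> carrier P" for x
    using pw_closed[of "[x]"] that by simp
  show "pw [x \<oplus>\<^bsub>P\<^esub> y] = pw [x] \<oplus>\<^bsub>M 1\<^esub> pw [y]" if "x \<in> carrier P" "y \<in> carrier P" for x y
    using balancedD(2)[OF pw_balanced, of 1 "[]" x "[]" y] that by (simp add: words_def)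
qed

lemma cons_balanced:
  assumes x: "x \<in> carrier P" and "0 < k"
  shows "balanced A P k (M (int k + 1)) (\<lambda>xs. pw (x # xs))"
proof -
  have b: "balanced A P (Suc k) (M (int k + 1)) pw"
    using pw_balanced[of "Suc k"] by (simp add: add.commute)
  show ?thesis
  proof (rule balancedI)
    fix xs assume "xs \<in> words P k"
    then show "pw (x # xs) \<in> carrier (M (int k + 1))"
      by (intro balancedD(1)[OF b]) (use x in \<open>simp add: words_def\<close>)
  next
    fix us y y' vs assume "us @ y # vs \<in> words P k" "y' \<in> carrier P"
    then show "pw (x # us @ (y \<oplus>\<^bsub>P\<^esub> y') # vs) = pw (x # us @ y # vs) \<oplus>\<^bsub>M (int k + 1)\<^esub> pw (x # us @ y' # vs)"
      using balancedD(2)[OF b, of "x # us" y vs y'] x by (simp add: words_def)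
  next
    fix us y a z vs assume "us @ y # z # vs \<in> words P k" "a \<in> carrier A"
    then show "pw (x # us @ ract P y a # z # vs) = pw (x # us @ y # lact P a z # vs)"
      using balancedD(3)[OF b, of "x # us" y z vs a] x by (simp add: words_def)
  qed
qed

text \<open>The first two letters of the word merge into one, so a relation is checked separately at
  the first letter, at the second, and beyond. A scalar between the first two letters passes through
  \<epsilon> by its right linearity.\<close>

lemma cancel_balanced:
  assumes x: "x \<in> carrier P"
  shows "balanced A N (Suc k) (M (- int k)) (cancel x)"
\<comment> \<open>For \<open>k = 0\<close> the word is a single letter and the value is a scalar;
  from \<open>k = 1\<close> on it is again a word in \<open>N\<close>.\<close>
proof (cases k)
  case 0
  have S_add: "S (a \<oplus> b) = S a \<oplus>\<^bsub>M 0\<^esub> S b" if "a \<in> carrier A" "b \<in> carrier A" for a b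
    using add_hom_add[OF S_hom] that .
  show ?thesis
    by (rule balancedI)
      (use x in \<open>auto simp: 0 cancel_def words_def length_Suc_conv append_eq_Cons_conv \<epsilon>.add2 S_add\<close>)
next
  case (Suc j)
  have b: "balanced A N k (M (- int k)) nw"
    using swap.pw_balanced[of k] Suc by (simp add: M_swap)
  have c: "cancel x (y # z # ys) = nw (lact N (\<epsilon> x y) z # ys)" for y z ys
    by (simp add: M_swap cancel_def)
  show ?thesis
  proof (rule balancedI)
    fix xs assume "xs \<in> words N (Suc k)"
    then obtain y z ys where "xs = y # z # ys" "y \<in> carrier N" "z # ys \<in> words N k"
      by (auto simp: words_def Suc length_Suc_conv)
    then show "cancel x xs \<in> carrier (M (- int k))"
      using x by (auto simp: c words_def intro!: balancedD(1)[OF b])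
  next
    fix us y y' vs assume w: "us @ y # vs \<in> words N (Suc k)" "y' \<in> carrier N"
    show "cancel x (us @ (y \<oplus>\<^bsub>N\<^esub> y') # vs) =
        cancel x (us @ y # vs) \<oplus>\<^bsub>M (- int k)\<^esub> cancel x (us @ y' # vs)"
    proof (cases us)
      case Nil
      then obtain z zs where v: "vs = z # zs"
        using w by (auto simp: words_def Suc length_Suc_conv)
      then show ?thesis
        using w x Nil balancedD(2)[OF b, of "[]" "lact N (\<epsilon> x y) z" zs "lact N (\<epsilon> x y') z"]
        by (simp add: c words_def \<epsilon>.add2 N.act_plus)
    next
      case (Cons u us')
      show ?thesis
      proof (cases us')
        case Nil
        then show ?thesis
          using w x Cons balancedD(2)[OF b, of "[]" "lact N (\<epsilon> x u) y" vs "lact N (\<epsilon> x u) y'"]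
          by (simp add: c words_def N.act_add)
      next
        case (Cons u2 us2)
        then show ?thesis
          using w x \<open>us = u # us'\<close> balancedD(2)[OF b, of "lact N (\<epsilon> x u) u2 # us2" y vs y']
          by (simp add: c words_def)
      qed
    qed
  next
    fix us y a z vs assume w: "us @ y # z # vs \<in> words N (Suc k)" "a \<in> carrier A"
    show "cancel x (us @ ract N y a # z # vs) = cancel x (us @ y # lact N a z # vs)"
    proof (cases us)
      case Nil
      then show ?thesis using w x by (simp add: c words_def \<epsilon>.ract N.act_mult)
    next
      case (Cons u us')
      show ?thesis
      proof (cases us')
        case Nil
        then show ?thesis
          using w x Cons balancedD(3)[OF b, of "[]" "lact N (\<epsilon> x u) y" z vs a]
          by (simp add: c words_def N.act_assoc)
      next
        case (Cons u2 us2)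
        then show ?thesis
          using w x \<open>us = u # us'\<close> balancedD(3)[OF b, of "lact N (\<epsilon> x u) u2 # us2" y z vs a]
          by (simp add: c words_def)
      qed
    qed
  qed
qed

end

context pairing
begin

lemma lam_hom:
  assumes x: "x \<in> carrier P" shows "lam n x \<in> add_hom (M n) (M (n + 1))"
proof (cases n rule: M_cases)
  case 1
  have r: "(\<lambda>a. ract P x a) \<in> add_hom A P"
    by (rule add_homI) (simp_all add: x P.act_plus)
  show ?thesis
    using add_hom_compose[OF add_hom_compose[OF inv_S_hom r] pw_single_hom] by (simp add: 1 lam_def)
next
  case (2 k)
  then show ?thesis
    using extP(1)[OF M.abelian_group_E cons_balanced[OF x, of "Suc k"]] by (simp add: lam_def add_ac)
next
  case (3 k)
  then show ?thesis
    using swap.extP(1)[OF M.abelian_group_E cancel_balanced[OF x, of k]] by (simp add: M_swap lam_def)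
qed

lemma lam_closed [simp]: "\<lbrakk>x \<in> carrier P; u \<in> carrier (M n)\<rbrakk> \<Longrightarrow> lam n x u \<in> carrier (M (n + 1))"
  by (rule add_hom_closed[OF lam_hom])

end

context pairing
begin

lemma lam_S: "\<lbrakk>x \<in> carrier P; a \<in> carrier A\<rbrakk> \<Longrightarrow> lam 0 x (S a) = pw [ract P x a]"
  by (simp add: lam_def inv_f_f[OF inj_S])

lemma lam_pw:
  assumes "set (x # xs) \<subseteq> carrier P" "xs \<noteq> []"
  shows "lam (int (length xs)) x (pw xs) = pw (x # xs)"
proof -
  have "extP (M (int (length xs) + 1)) (\<lambda>xs. pw (x # xs)) (pw xs) = pw (x # xs)"
    by (rule extP(2)[OF M.abelian_group_E cons_balanced]) (use assms in \<open>auto simp: words_def\<close>)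
  then show ?thesis using assms by (simp add: lam_def)
qed

lemma lam_cancel:
  assumes "x \<in> carrier P" "set ys \<subseteq> carrier N" "ys \<noteq> []"
  shows "lam (- int (length ys)) x (nw ys) = cancel x ys"
proof -
  obtain k where k: "length ys = Suc k" using assms by (cases ys) auto
  have "swap.extP (M (- int k)) (cancel x) (nw ys) = cancel x ys"
    by (rule swap.extP(2)[OF M.abelian_group_E cancel_balanced[OF assms(1), of k]])
      (use assms k in \<open>auto simp: words_def\<close>)
  then show ?thesis using k by (simp add: lam_def)
qed

lemma lam_nw_single: "\<lbrakk>x \<in> carrier P; y \<in> carrier N\<rbrakk> \<Longrightarrow> lam (-1) x (nw [y]) = S (\<epsilon> x y)"
  using lam_cancel[of x "[y]"] by (simp add: cancel_def)

end

context pairing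
begin

lemma nw_lact:
  assumes "set (y # ys) \<subseteq> carrier N" "a \<in> carrier A"
  shows "lact (M (- 1 - int (length ys))) a (nw (y # ys)) = nw (lact N a y # ys)"
  using swap.pw_lact[OF assms] by (simp add: M_swap)

lemma lam_nw:
  assumes "x \<in> carrier P" "set (y # ys) \<subseteq> carrier N" "ys \<noteq> []"
  shows "lam (- 1 - int (length ys)) x (nw (y # ys)) = lact (M (- int (length ys))) (\<epsilon> x y) (nw ys)"
proof -
  obtain z zs where ys: "ys = z # zs" using assms(3) by (cases ys) auto
  then show ?thesis
    using lam_cancel[of x "y # ys"] assms nw_lact[of z zs "\<epsilon> x y"] by (simp add: M_swap cancel_def)
qed

text \<open>Reads the empty word as the unit, so that cancelling the last remaining letter needs no
  separate formula.\<close>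

definition nw1 :: "'q list \<Rightarrow> 'u" where
  "nw1 ys = (if ys = [] then S \<one> else nw ys)"

lemma nw1_closed [simp]: "set ys \<subseteq> carrier N \<Longrightarrow> nw1 ys \<in> carrier (M (- int (length ys)))"
  using swap.pw_closed[of ys] by (simp add: M_swap nw1_def)

lemma lam_nw1:
  assumes "x \<in> carrier P" "set (y # ys) \<subseteq> carrier N"
  shows "lam (- 1 - int (length ys)) x (nw (y # ys)) = lact (M (- int (length ys))) (\<epsilon> x y) (nw1 ys)"
  using assms lam_nw_single[of x y] lam_nw[of x y ys] by (simp add: M_swap nw1_def)

end

section \<open>Letters, addition and the two actions of the algebra\<close>

context pairing
begin

lemma lam_add:
  assumes "x \<in> carrier P" "x' \<in> carrier P" "u \<in> carrier (M n)"
  shows "lam n (x \<oplus>\<^bsub>P\<^esub> x') u = lam n x u \<oplus>\<^bsub>M (n + 1)\<^esub> lam n x' u"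
proof (rule M_hom_eqI[OF _ _ _ M.abelian_group_E lam_hom add_hom_plus[OF M.abelian_group_E lam_hom lam_hom]], goal_cases scal pos neg)
  case (scal a)
  then show ?case using assms add_hom_add[OF pw_single_hom] by (simp add: lam_S P.act_add)
next
  case (pos xs)
  then show ?case using assms balancedD(2)[OF pw_balanced, of "Suc (length xs)" "[]" x xs x']
    by (simp add: lam_pw words_def add_ac)
next
  case (neg ys)
  then obtain z zs where "ys = z # zs" by (cases ys) auto
  then show ?case using neg assms by (simp add: M_swap lam_nw1 \<epsilon>.add1 M.act_plus)
qed (use assms in simp_all)

lemma lam_bal:
  assumes "x \<in> carrier P" "a \<in> carrier A" "u \<in> carrier (M n)"
  shows "lam n (ract P x a) u = lam n x (lact (M n) a u)"
proof (rule M_hom_eqI[OF _ _ _ M.abelian_group_E lam_hom add_hom_compose[OF M.lact_hom lam_hom]], goal_cases scal pos neg)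
  case (scal b)
  then show ?case using assms by (simp add: lam_S P.act_mult)
next
  case (pos xs)
  then obtain z zs where z: "xs = z # zs" by (cases xs) auto
  then show ?case
    using pos assms balancedD(3)[OF pw_balanced, of "Suc (length xs)" "[]" x z zs a]
      lam_pw[of x "lact P a z # zs"] lam_pw[of "ract P x a" "z # zs"]
    by (simp add: lam_pw pw_lact words_def)
next
  case (neg ys)
  then obtain z zs where z: "ys = z # zs" by (cases ys) auto
  then show ?case
    using neg assms lam_nw1[of x "lact N a z" zs] by (simp add: M_swap lam_nw1 nw_lact \<epsilon>.bal)
qed (use assms in simp_all)

lemma lam_lact:
  assumes "x \<in> carrier P" "a \<in> carrier A" "u \<in> carrier (M n)"
  shows "lam n (lact P a x) u = lact (M (n + 1)) a (lam n x u)"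
proof (rule M_hom_eqI[OF _ _ _ M.abelian_group_E lam_hom add_hom_compose[OF lam_hom M.lact_hom]], goal_cases scal pos neg)
  case (scal b)
  then show ?case using assms pw_lact[of "ract P x b" "[]" a] by (simp add: lam_S P.act_assoc)
next
  case (pos xs)
  then show ?case using assms pw_lact[of x xs a] by (simp add: lam_pw add_ac)
next
  case (neg ys)
  then obtain z zs where z: "ys = z # zs" by (cases ys) auto
  then show ?case using neg assms by (simp add: M_swap lam_nw1 \<epsilon>.lact M.act_mult)
qed (use assms in simp_all)

lemma lam_ract:
  assumes "x \<in> carrier P" "a \<in> carrier A" "u \<in> carrier (M n)"
  shows "lam n x (ract (M n) u a) = ract (M (n + 1)) (lam n x u) a"
proof (rule M_hom_eqI[OF _ _ _ M.abelian_group_E add_hom_compose[OF M.ract_hom lam_hom] add_hom_compose[OF lam_hom M.ract_hom]], goal_cases scal pos neg)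
  case (scal b)
  then show ?case using assms pw_ract[of "[]" "ract P x b" a] by (simp add: lam_S P.act_mult)
next
  case (pos xs)
  then obtain z zs where z: "xs = zs @ [z]" by (cases xs rule: rev_cases) auto
  then show ?case
    using pos assms pw_ract[of zs z a] pw_ract[of "x # zs" z a] lam_pw[of x xs] lam_pw[of x "zs @ [ract P z a]"]
    by (simp add: add_ac)
next
  case (neg ys)
  show ?case
  \<comment> \<open>\<open>lam\<close> works at the first letter, the right action at the last. They
    meet only in a word of one letter, where right linearity of \<epsilon> is used; in a longer word
    the scalar from \<epsilon> acts on the left of what remains, and left and right action
    commute.\<close>
  proof (cases ys rule: rev_cases)
    case (snoc zs z)
    show ?thesis
    proof (cases zs)
      case Nil
      then show ?thesis
        using neg assms snoc swap.pw_ract[of "[]" z a] by (simp add: M_swap lam_nw_single \<epsilon>.ract)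
    next
      case (Cons w ws)
      have n: "n = - int (length ws) - 2" "n + 1 = - 1 - int (length ws)" using neg snoc Cons by simp_all
      show ?thesis
        unfolding n(2) unfolding n(1)
        using Cons neg(2) assms snoc swap.pw_ract[of zs z a] swap.pw_ract[of ws z a]
          lam_nw[of x w "ws @ [z]"] lam_nw[of x w "ws @ [ract N z a]"] swap.pw_closed[of "ws @ [z]"]
          M.act_assoc[of "\<epsilon> x w" a "nw (ws @ [z])" "- 1 - int (length ws)"]
        by (simp add: M_swap algebra_simps)
    qed
  qed (use neg in simp)
qed (use assms in simp_all)

end

context pairing
begin

text \<open>On a word in \<open>N\<close>, the letter \<open>y\<close> is prepended and
  \<open>x\<close> cancels it at once; on scalars \<epsilon> is right linear. Only on a word in
  \<open>P\<close> do both pairings meet: \<open>y\<close> cancels the first letter, and the mixed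
  law exchanges this cancellation for that of \<open>x\<close> with \<open>y\<close>. The mirror
  image, with \<phi> in place of \<epsilon>, belongs to \<open>swap\<close>.\<close>

lemma lam_lam:
  assumes "x \<in> carrier P" "y \<in> carrier N" "u \<in> carrier (M n)"
  shows "lam (n - 1) x (swap.lam (- n) y u) = lact (M n) (\<epsilon> x y) u"
proof -
  have h: "swap.lam (- n) y \<in> add_hom (M n) (M (n - 1))"
    using swap.lam_hom[OF assms(2), of "- n"] by (simp add: M_swap algebra_simps)
  have h': "(\<lambda>u. lam (n - 1) x (swap.lam (- n) y u)) \<in> add_hom (M n) (M n)"
    using add_hom_compose[OF h lam_hom[OF assms(1), of "n - 1"]] by simp
  show ?thesis
  proof (rule M_hom_eqI[OF _ _ _ M.abelian_group_E h' M.lact_hom], goal_cases scal pos neg)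
    case (scal a)
    then show ?case using assms by (simp add: M_swap swap.lam_S lam_nw_single \<epsilon>.ract)
  next
    case (pos xs)
    then obtain z zs where z: "xs = z # zs" by (cases xs) auto
    then have "swap.lam (- n) y (pw xs) = lact (M (n - 1)) (\<phi> y z) (swap.nw1 zs)"
      using pos assms swap.lam_nw1[of y z zs] by (simp add: M_swap)
    then have "lam (n - 1) x (swap.lam (- n) y (pw xs)) = lam (n - 1) (ract P x (\<phi> y z)) (swap.nw1 zs)"
      using pos assms z swap.nw1_closed[of zs] by (simp add: M_swap lam_bal)
    \<comment> \<open>The scalar \<open>\<phi> y z\<close> has been moved onto \<open>x\<close> by
      balancedness; the mixed law now brings back \<open>z\<close> as a letter, multiplied by
      \<open>\<epsilon> x y\<close>.\<close>
    also have "\<dots> = lam (n - 1) (lact P (\<epsilon> x y) z) (swap.nw1 zs)"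
      using pos assms z by (simp add: \<epsilon>_\<phi>)
    also have "\<dots> = pw (lact P (\<epsilon> x y) z # zs)"
      using pos assms z lam_pw[of "lact P (\<epsilon> x y) z" zs] by (auto simp: M_swap swap.nw1_def lam_S)
    also have "\<dots> = lact (M n) (\<epsilon> x y) (pw xs)"
      using pos assms z by (simp add: pw_lact)
    finally show ?case .
  next
    case (neg ys)
    then have n: "n - 1 = - 1 - int (length ys)" by simp
    have "swap.lam (- n) y (nw ys) = nw (y # ys)"
      using neg assms swap.lam_pw[of y ys] by simp
    then show ?case unfolding n using lam_nw[of x y ys] neg assms by simp
  qed (use assms in simp_all)
qed

end

section \<open>Words as composites of their letters, and the product\<close>

context pairing
begin

text \<open>Here \<open>m\<close> is the degree of \<open>v\<close>; it has to be supplied because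
  each \<open>lam\<close> in the composite depends on the degree of its argument.\<close>

primrec act :: "int \<Rightarrow> 'p list \<Rightarrow> 'u \<Rightarrow> 'u" where
  "act m [] v = v"
| "act m (x # xs) v = lam (m + int (length xs)) x (act m xs v)"

lemma act_hom: "set xs \<subseteq> carrier P \<Longrightarrow> act m xs \<in> add_hom (M m) (M (m + int (length xs)))"
proof (induction xs)
  case Nil
  then show ?case using add_hom_ident[of "M m"] by (simp add: add_hom_def)
next
  case (Cons x xs)
  then show ?case
    using add_hom_compose[of "act m xs" "M m" "M (m + int (length xs))" "lam (m + int (length xs)) x"
        "M (m + int (length xs) + 1)"] lam_hom[of x "m + int (length xs)"]
    by (simp add: add_hom_def algebra_simps)
qed

lemma act_closed [simp]:
  "\<lbrakk>set xs \<subseteq> carrier P; v \<in> carrier (M m)\<rbrakk> \<Longrightarrow> act m xs v \<in> carrier (M (m + int (length xs)))"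
  by (rule add_hom_closed[OF act_hom])

lemma act_append: "act m (us @ vs) v = act (m + int (length vs)) us (act m vs v)"
  by (induction us) (simp_all add: algebra_simps)

text \<open>Additivity in one letter is \<open>lam_add\<close>, passed through the letters to its
  left. For neighbours, the scalar leaves the second letter by \<open>lam_lact\<close> and enters
  the first by \<open>lam_bal\<close>.\<close>

lemma act_balanced:
  assumes v: "v \<in> carrier (M m)"
  shows "balanced A P k (M (m + int k)) (\<lambda>xs. act m xs v)"
proof (rule balancedI)
  fix xs assume "xs \<in> words P k"
  then show "act m xs v \<in> carrier (M (m + int k))"
    using act_closed[of xs v m] v by (auto simp: words_def)
next
  fix us x x' vs assume w: "us @ x # vs \<in> words P k" "x' \<in> carrier P"
  let ?d = "m + int (length vs)"
  have s: "set us \<subseteq> carrier P" "x \<in> carrier P" "set vs \<subseteq> carrier P"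
    and k: "m + int k = ?d + 1 + int (length us)"
    using w by (auto simp: words_def)
  have a: "act m (us @ y # vs) v = act (?d + 1) us (lam ?d y (act m vs v))" for y
    by (simp add: act_append algebra_simps)
  show "act m (us @ (x \<oplus>\<^bsub>P\<^esub> x') # vs) v =
      act m (us @ x # vs) v \<oplus>\<^bsub>M (m + int k)\<^esub> act m (us @ x' # vs) v"
    unfolding a k using s w(2) v
    by (simp add: lam_add add_hom_add[OF act_hom])
next
  fix us x a y vs assume w: "us @ x # y # vs \<in> words P k" "a \<in> carrier A"
  then have "set us \<subseteq> carrier P" "x \<in> carrier P" "y \<in> carrier P" "set vs \<subseteq> carrier P"
    by (auto simp: words_def)
  then show "act m (us @ ract P x a # y # vs) v = act m (us @ x # lact P a y # vs) v"
    using v w(2) lam_lact[of y a "act m vs v" "m + int (length vs)"]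
      lam_closed[of y "act m vs v" "m + int (length vs)"]
    by (simp add: act_append lam_bal add_ac)
qed

lemma act_ract:
  assumes "set xs \<subseteq> carrier P" "v \<in> carrier (M m)" "a \<in> carrier A"
  shows "act m xs (ract (M m) v a) = ract (M (m + int (length xs))) (act m xs v) a"
  using assms by (induction xs) (simp_all add: lam_ract add_ac)

lemma act_pw:
  assumes "set xs \<subseteq> carrier P" "set ys \<subseteq> carrier P" "ys \<noteq> []"
  shows "act (int (length ys)) xs (pw ys) = pw (xs @ ys)"
  using assms
proof (induction xs)
  case (Cons x xs)
  then show ?case using lam_pw[of x "xs @ ys"] by (simp add: add_ac)
qed simp

lemma act_S_one:
  assumes "set xs \<subseteq> carrier P" "xs \<noteq> []"
  shows "act 0 xs (S \<one>) = pw xs"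
proof (cases xs rule: rev_cases)
  case (snoc us x)
  then show ?thesis using act_pw[of us "[x]"] assms by (simp add: act_append lam_S)
qed (use assms in simp)

lemma act_S:
  assumes "set xs \<subseteq> carrier P" "xs \<noteq> []" "a \<in> carrier A"
  shows "act 0 xs (S a) = ract (M (int (length xs))) (pw xs) a"
  using act_ract[OF assms(1) S_closed[OF A.one_closed] assms(3)] assms by (simp add: act_S_one)

text \<open>The last branch is the middle one for the exchanged pair: its \<open>act\<close> is that
  of \<open>swap\<close>, and the degree \<open>m\<close> changes sign because the exchange reverses
  the grading.\<close>

definition mul :: "int \<Rightarrow> int \<Rightarrow> 'u \<Rightarrow> 'u \<Rightarrow> 'u" where
  "mul n m u v = (if n = 0 then lact (M m) (inv_into UNIV S u) v
     else if n > 0 then extP (M (n + m)) (\<lambda>xs. act m xs v) u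
     else induced (M (n + m)) (\<lambda>ys. pairing.act A N P \<phi> S CN CP (- m) ys v) (inv_into UNIV CN u))"

end

context pairing
begin

text \<open>Lets every fact about products that begin with a word in \<open>P\<close> be read as one
  about words in \<open>N\<close>.\<close>

lemma mul_swap: "swap.mul n m u v = mul (- n) (- m) u v"
  by (simp add: mul_def swap.mul_def extP_def swap.extP_def M_swap)

lemma mul_S [simp]: "a \<in> carrier A \<Longrightarrow> mul 0 m (S a) v = lact (M m) a v"
  by (simp add: mul_def inv_f_f[OF inj_S])

lemma mul_pw:
  assumes "xs \<noteq> []" "set xs \<subseteq> carrier P" "v \<in> carrier (M m)"
  shows "mul (int (length xs)) m (pw xs) v = act m xs v"
  using extP(2)[OF M.abelian_group_E act_balanced[OF assms(3), of "length xs"], of xs] assms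
  by (simp add: mul_def words_def add_ac)

lemma mul_hom_pos:
  assumes "v \<in> carrier (M m)" "0 < n"
  shows "(\<lambda>u. mul n m u v) \<in> add_hom (M n) (M (n + m))"
  using extP(1)[OF M.abelian_group_E act_balanced[OF assms(1), of "nat n"]] assms
  by (simp add: mul_def[abs_def] add_ac)

end

context pairing
begin

lemma mul_nw:
  assumes "ys \<noteq> []" "set ys \<subseteq> carrier N" "v \<in> carrier (M m)"
  shows "mul (- int (length ys)) m (nw ys) v = swap.act (- m) ys v"
  using swap.mul_pw[of ys v "- m"] assms by (simp add: M_swap mul_swap)

lemma mul_hom1:
  assumes v: "v \<in> carrier (M m)" shows "(\<lambda>u. mul n m u v) \<in> add_hom (M n) (M (n + m))"
proof (cases n rule: M_cases)
  case 1
  have "(\<lambda>a. lact (M m) a v) \<in> add_hom A (M m)"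
    by (rule add_homI) (simp_all add: v M.act_plus)
  from add_hom_compose[OF inv_S_hom this] show ?thesis by (simp add: 1 mul_def[abs_def])
next
  case (2 k)
  then show ?thesis using mul_hom_pos[OF v, of n] by simp
next
  case (3 k)
  then have "0 < - n" by simp
  then show ?thesis using swap.mul_hom_pos[of v "- m" "- n"] v by (simp add: M_swap mul_swap add_ac)
qed

lemma mul_closed [simp]:
  "\<lbrakk>u \<in> carrier (M n); v \<in> carrier (M m)\<rbrakk> \<Longrightarrow> mul n m u v \<in> carrier (M (n + m))"
  using add_hom_closed[OF mul_hom1] .

lemma mul_add2:
  assumes "u \<in> carrier (M n)" "v \<in> carrier (M m)" "v' \<in> carrier (M m)"
  shows "mul n m u (v \<oplus>\<^bsub>M m\<^esub> v') = mul n m u v \<oplus>\<^bsub>M (n + m)\<^esub> mul n m u v'"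
proof (rule M_hom_eqI[OF _ _ _ M.abelian_group_E mul_hom1 add_hom_plus[OF M.abelian_group_E mul_hom1 mul_hom1]], goal_cases scal pos neg)
  case (scal a)
  then show ?case using assms by (simp add: M.act_add)
next
  case (pos xs)
  then show ?case using assms by (simp add: mul_pw add_hom_add[OF act_hom] add_ac)
next
  case (neg ys)
  then show ?case
    using assms add_hom_add[OF swap.act_hom[of ys "- m"], of v v'] by (simp add: mul_nw M_swap algebra_simps)
qed (use assms in simp_all)

lemma mul_hom2: "u \<in> carrier (M n) \<Longrightarrow> mul n m u \<in> add_hom (M m) (M (n + m))"
  by (rule add_homI) (simp_all add: mul_add2)

lemma mul_lact:
  assumes "a \<in> carrier A" "u \<in> carrier (M n)" "v \<in> carrier (M m)"
  shows "mul n m (lact (M n) a u) v = lact (M (n + m)) a (mul n m u v)"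
proof (rule M_hom_eqI[OF _ _ _ M.abelian_group_E add_hom_compose[OF M.lact_hom mul_hom1] add_hom_compose[OF mul_hom1 M.lact_hom]], goal_cases scal pos neg)
  case (scal b)
  then show ?case using assms by (simp add: M.act_mult)
next
  case (pos xs)
  then obtain z zs where z: "xs = z # zs" by (cases xs) auto
  then show ?case using pos assms mul_pw[of "z # zs" v m] mul_pw[of "lact P a z # zs" v m]
      lam_lact[of z a "act m zs v" "m + int (length zs)"]
    by (simp add: pw_lact algebra_simps)
next
  case (neg ys)
  then obtain z zs where z: "ys = z # zs" by (cases ys) auto
  have n: "n = - 1 - int (length zs)" using neg z by simp
  show ?case
    unfolding n z using neg(2) z assms(1,3) mul_nw[of "z # zs" v m] mul_nw[of "lact N a z # zs" v m]
      swap.lam_lact[of z a "swap.act (- m) zs v" "- m + int (length zs)"]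
      swap.act_closed[of zs v "- m"]
    by (simp add: nw_lact M_swap algebra_simps)
qed (use assms in simp_all)

lemma mul_nw1:
  assumes "set ys \<subseteq> carrier N" "v \<in> carrier (M m)"
  shows "mul (- int (length ys)) m (nw1 ys) v = swap.act (- m) ys v"
  using assms mul_nw[of ys v m] by (simp add: nw1_def)

text \<open>The letter case of associativity; its content is in negative degree. With
  \<open>z\<close> the first letter of the word, the left side has cancelled \<open>x\<close>
  against \<open>z\<close>, while on the right \<open>z\<close> acts first on the product of the
  remaining word with \<open>v\<close>. \<open>lam_lam\<close> equates the two, whether
  \<open>z\<close> is prepended or itself cancels.\<close>

lemma mul_lam:
  assumes x: "x \<in> carrier P" and u: "u \<in> carrier (M n)" and v: "v \<in> carrier (M m)"
  shows "mul (n + 1) m (lam n x u) v = lam (n + m) x (mul n m u v)"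
proof -
  have h: "(\<lambda>u. mul (n + 1) m (lam n x u) v) \<in> add_hom (M n) (M (n + m + 1))"
    using add_hom_compose[OF lam_hom[OF x, of n] mul_hom1[OF v, of "n + 1"]] by (simp add: algebra_simps)
  show ?thesis
  proof (rule M_hom_eqI[OF _ _ _ M.abelian_group_E h add_hom_compose[OF mul_hom1 lam_hom] u], goal_cases scal pos neg)
    case (scal a)
    then show ?case using x v mul_pw[of "[ract P x a]" v m] by (simp add: lam_S lam_bal)
  next
    case (pos xs)
    then show ?case using x v mul_pw[of "x # xs" v m] by (simp add: lam_pw mul_pw algebra_simps)
  next
    case (neg ys)
    then obtain z zs where z: "ys = z # zs" by (cases ys) auto
    let ?w = "swap.act (- m) zs v"
    have n: "n = - 1 - int (length zs)" "n + 1 = - int (length zs)" using neg z by simp_all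
    have c: "?w \<in> carrier (M (m - int (length zs)))"
      using swap.act_closed[of zs v "- m"] neg z v by (simp add: M_swap)
    have "mul (n + 1) m (lam n x (nw ys)) v = mul (- int (length zs)) m (lact (M (- int (length zs))) (\<epsilon> x z) (nw1 zs)) v"
      unfolding n(2) unfolding n(1) z using neg z x by (simp add: lam_nw1)
    also have "\<dots> = lact (M (m - int (length zs))) (\<epsilon> x z) ?w"
      using neg z x v by (simp add: mul_lact mul_nw1)
    also have "\<dots> = lam (m - int (length zs) - 1) x (swap.lam (- (m - int (length zs))) z ?w)"
      by (rule lam_lam[symmetric]) (use c x neg z in simp_all)
    also have "\<dots> = lam (n + m) x (mul n m (nw ys) v)"
    proof -
      have "n + m = m - int (length zs) - 1" "mul n m (nw ys) v = swap.lam (- (m - int (length zs))) z ?w"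
        using neg z v mul_nw[of ys v m] by simp_all
      then show ?thesis by (simp only:)
    qed
    finally show ?case .
  qed (use x v in simp_all)
qed

lemma mul_act:
  assumes "set xs \<subseteq> carrier P" "v \<in> carrier (M m)" "w \<in> carrier (M k)"
  shows "mul (m + int (length xs)) k (act m xs v) w = act (m + k) xs (mul m k v w)"
  using assms
proof (induction xs)
  case (Cons x xs)
  then show ?case
    using mul_lam[of x "act m xs v" "m + int (length xs)" w k] by (simp add: algebra_simps)
qed simp

end

section \<open>Associativity, units and scalars\<close>

context pairing
begin

lemma mul_assoc:
  assumes u: "u \<in> carrier (M n)" and v: "v \<in> carrier (M m)" and w: "w \<in> carrier (M k)"
  shows "mul (n + m) k (mul n m u v) w = mul n (m + k) u (mul m k v w)"
proof -
  have h: "(\<lambda>u. mul (n + m) k (mul n m u v) w) \<in> add_hom (M n) (M (n + (m + k)))"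
    using add_hom_compose[OF mul_hom1[OF v, of n] mul_hom1[OF w, of "n + m"]] by (simp add: algebra_simps)
  have vw: "mul m k v w \<in> carrier (M (m + k))" using v w by simp
  show ?thesis
  proof (rule M_hom_eqI[OF _ _ _ M.abelian_group_E h mul_hom1[OF vw] u], goal_cases scal pos neg)
    case (scal a)
    then show ?case using v w by (simp add: mul_lact)
  next
    case (pos xs)
    then have n: "n + m = m + int (length xs)" by simp
    show ?case unfolding n using pos v w vw mul_act[of xs v m w k] by (simp add: mul_pw)
  next
    case (neg ys)
    then have n: "n + m = m - int (length ys)" by simp
    show ?case
      unfolding n using neg v w vw swap.mul_act[of ys v "- m" w "- k"] by (simp add: mul_nw mul_swap M_swap)
  qed
qed

lemma mul_S_right:
  assumes u: "u \<in> carrier (M n)" and a: "a \<in> carrier A"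
  shows "mul n 0 u (S a) = ract (M n) u a"
proof -
  have h: "(\<lambda>u. mul n 0 u (S a)) \<in> add_hom (M n) (M n)"
    using mul_hom1[OF S_closed[OF a], of n] by simp
  show ?thesis
  proof (rule M_hom_eqI[OF _ _ _ M.abelian_group_E h M.ract_hom[OF a] u], goal_cases scal pos neg)
    case (pos xs)
    then show ?case using a by (simp add: mul_pw act_S)
  next
    case (neg ys)
    then show ?case using a swap.act_S[of ys a] by (simp add: mul_nw M_swap)
  qed (use a in simp_all)
qed

lemma mul_one_left: "u \<in> carrier (M n) \<Longrightarrow> mul 0 n (S \<one>) u = u"
  by simp

lemma mul_one_right: "u \<in> carrier (M n) \<Longrightarrow> mul n 0 u (S \<one>) = u"
  by (simp add: mul_S_right)

lemma mul_smult:
  assumes "u \<in> carrier (M n)" "v \<in> carrier (M m)"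
  shows "mul n m (c \<odot>\<^bsub>M n\<^esub> u) v = c \<odot>\<^bsub>M (n + m)\<^esub> mul n m u v"
    and "mul n m u (c \<odot>\<^bsub>M m\<^esub> v) = c \<odot>\<^bsub>M (n + m)\<^esub> mul n m u v"
proof -
  show "mul n m (c \<odot>\<^bsub>M n\<^esub> u) v = c \<odot>\<^bsub>M (n + m)\<^esub> mul n m u v"
    using assms by (simp add: M.smult_E(1) mul_lact)
  \<comment> \<open>A scalar on the second factor is multiplication by \<open>S (scal c)\<close>
    from the right, so associativity takes it out of the product.\<close>
  have "mul n m u (ract (M m) v (scal c)) = ract (M (n + m)) (mul n m u v) (scal c)"
    using mul_assoc[of u n v m "S (scal c)" 0] assms by (simp add: mul_S_right)
  then show "mul n m u (c \<odot>\<^bsub>M m\<^esub> v) = c \<odot>\<^bsub>M (n + m)\<^esub> mul n m u v"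
    using assms by (simp add: M.smult_E(2))
qed

lemma mul_pw_pw:
  assumes "set xs \<subseteq> carrier P" "set ys \<subseteq> carrier P" "xs \<noteq> []" "ys \<noteq> []"
    and "n = int (length xs)" "m = int (length ys)"
  shows "mul n m (pw xs) (pw ys) = pw (xs @ ys)"
  using assms by (simp add: mul_pw act_pw)

subsection \<open>Nested pairings\<close>

text \<open>The recursion takes \<open>xs\<close> from the front and \<open>ys\<close> from the
  back, since the innermost pair consists of the last letter of \<open>xs\<close> and the first of
  \<open>ys\<close>.\<close>

lemma nested_closed:
  "\<lbrakk>set xs \<subseteq> carrier P; set ys \<subseteq> carrier N; length xs = Suc n; length ys = Suc n\<rbrakk> \<Longrightarrow>
   nested P \<epsilon> (Suc n) xs ys \<in> carrier A"
proof (induction n arbitrary: xs ys)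
  case 0
  then show ?case by (auto simp: length_Suc_conv)
next
  case (Suc n)
  then obtain x xs' where x: "xs = x # xs'" by (cases xs) auto
  obtain ys' y where y: "ys = ys' @ [y]" using Suc.prems by (cases ys rule: rev_cases) auto
  show ?case using Suc by (simp add: x y)
qed

text \<open>Links cancellation letter by letter with the nested pairing. Letters of
  \<open>xs\<close> act from the last to the first. The scalar left behind by the tail of
  \<open>xs\<close> stands before the next letter of \<open>ys\<close>; \<open>lam_bal\<close> moves
  it onto \<open>x\<close>, which is where the recursion of \<open>nested\<close> puts it.\<close>

lemma act_nested:
  assumes "set xs \<subseteq> carrier P" "set ys \<subseteq> carrier N" "xs \<noteq> []" "length xs \<le> length ys"
  shows "act (- int (length ys)) xs (nw ys) =
    lact (M (int (length xs) - int (length ys))) (nested P \<epsilon> (length xs) xs (take (length xs) ys))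
      (nw1 (drop (length xs) ys))"
  using assms
proof (induction xs)
  case (Cons x xs)
  show ?case
  \<comment> \<open>A single letter is treated apart because \<open>nested\<close> is undefined at
    length 0.\<close>
  proof (cases "xs = []")
    case True
    obtain y zs where "ys = y # zs" using Cons.prems by (cases ys) auto
    then show ?thesis using True Cons.prems lam_nw1[of x y zs] by simp
  next
    case False
    define n where "n = length xs"
    have n: "n < length ys" "0 < n" using Cons.prems False by (simp_all add: n_def)
    \<comment> \<open>\<open>y\<close> is the letter that \<open>x\<close> meets after
      \<open>xs\<close> has cancelled the first \<open>n\<close> letters of \<open>ys\<close>;
      \<open>zs\<close> is what remains.\<close>
    define y where "y = ys ! n"
    define zs where "zs = drop (Suc n) ys"
    have d: "drop n ys = y # zs" "take (Suc n) ys = take n ys @ [y]"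
      using n by (simp_all add: y_def zs_def Cons_nth_drop_Suc take_Suc_conv_app_nth)
    have "set (drop n ys) \<subseteq> carrier N"
      using set_drop_subset[of n ys] Cons.prems(2) by (rule order_trans)
    then have yz: "set (y # zs) \<subseteq> carrier N" by (simp add: d)
    have len: "int n - int (length ys) = - 1 - int (length zs)"
      using n by (simp add: zs_def)
    define b where "b = nested P \<epsilon> n xs (take n ys)"
    obtain k where k: "n = Suc k" using n by (cases n) auto
    have "set (take n ys) \<subseteq> carrier N"
      using set_take_subset[of n ys] Cons.prems(2) by (rule order_trans)
    then have b: "b \<in> carrier A"
      unfolding b_def k by (intro nested_closed) (use Cons.prems n k in \<open>simp_all add: n_def\<close>)
    have "act (- int (length ys)) (x # xs) (nw ys) = lam (int n - int (length ys)) x (act (- int (length ys)) xs (nw ys))"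
      by (simp add: n_def algebra_simps)
    also have "\<dots> = lam (- 1 - int (length zs)) x (lact (M (- 1 - int (length zs))) b (nw (y # zs)))"
      using Cons.IH Cons.prems False n by (simp add: n_def[symmetric] b_def[symmetric] d len nw1_def)
    also have "\<dots> = lam (- 1 - int (length zs)) (ract P x b) (nw (y # zs))"
      using nw1_closed[of "y # zs"] yz Cons.prems b
      by (subst lam_bal) (auto simp: nw1_def algebra_simps)
    also have "\<dots> = lact (M (- int (length zs))) (\<epsilon> (ract P x b) y) (nw1 zs)"
      using yz Cons.prems b by (simp add: lam_nw1)
    also have "\<epsilon> (ract P x b) y = nested P \<epsilon> (Suc n) (x # xs) (take (Suc n) ys)"
      using d(2) by (simp add: k b_def)
    finally have "act (- int (length ys)) (x # xs) (nw ys) =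
        lact (M (- int (length zs))) (nested P \<epsilon> (Suc n) (x # xs) (take (Suc n) ys)) (nw1 zs)" .
    moreover have "int (length (x # xs)) - int (length ys) = - int (length zs)" "length (x # xs) = Suc n"
      using n by (simp_all add: n_def zs_def)
    ultimately show ?thesis by (simp only: zs_def)
  qed
qed simp

text \<open>The last letters of \<open>xs\<close>, as many as \<open>ys\<close> has, cancel
  \<open>ys\<close> down to a scalar; the letters before them receive that scalar from the
  right.\<close>

lemma act_nested_long:
  assumes "set xs \<subseteq> carrier P" "set ys \<subseteq> carrier N" "ys \<noteq> []" "length ys < length xs"
  shows "act (- int (length ys)) xs (nw ys) =
    ract (M (int (length xs) - int (length ys))) (pw (take (length xs - length ys) xs))
      (nested P \<epsilon> (length ys) (drop (length xs - length ys) xs) ys)"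
proof -
  define k where "k = length xs - length ys"
  have "0 < length ys" using assms by simp
  define us where "us = take k xs"
  define vs where "vs = drop k xs"
  have "length vs = length ys" using assms by (simp add: vs_def k_def)
  moreover from this have "vs \<noteq> []" using assms(3) by auto
  moreover have "length us = k" using \<open>0 < length ys\<close> by (simp add: us_def k_def)
  moreover from this have "us \<noteq> []" using assms(4) by (auto simp: k_def)
  ultimately have uv: "xs = us @ vs" "length vs = length ys" "us \<noteq> []" "vs \<noteq> []"
      "int (length us) = int (length xs) - int (length ys)"
    using assms by (simp_all add: us_def vs_def k_def)
  have s: "set us \<subseteq> carrier P" "set vs \<subseteq> carrier P" using assms(1) uv(1) by auto
  let ?b = "nested P \<epsilon> (length ys) vs ys"
  have b: "?b \<in> carrier A"
    using nested_closed[OF s(2) assms(2), of "length ys - 1"] uv(2) assms(3) by (cases ys) auto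
  have "act (- int (length ys)) xs (nw ys) = act 0 us (act (- int (length ys)) vs (nw ys))"
    by (simp add: uv(1,2) act_append)
  also have "act (- int (length ys)) vs (nw ys) = S ?b"
    using act_nested[OF s(2) assms(2) uv(4)] uv(2) b by (simp add: nw1_def)
  also have "act 0 us (S ?b) = ract (M (int (length us))) (pw us) ?b"
    by (rule act_S) (use s uv b in auto)
  finally show ?thesis using uv(5) by (simp add: us_def vs_def k_def)
qed

end

subsection \<open>The star operation\<close>

text \<open>For an involutive \<open>st\<close>, these are the bimodule maps from the conjugate of
  \<open>P\<close> to \<open>N\<close>.\<close>

locale antilinear =
  fixes A :: "(complex, 'a, 'm) module_scheme" (structure) and P :: "('a, 'p) bimod" and N :: "('a, 'q) bimod"
    and st :: "'a \<Rightarrow> 'a" and h :: "'p \<Rightarrow> 'q"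
  assumes closed [simp]: "x \<in> carrier P \<Longrightarrow> h x \<in> carrier N"
    and add: "\<lbrakk>x \<in> carrier P; x' \<in> carrier P\<rbrakk> \<Longrightarrow> h (x \<oplus>\<^bsub>P\<^esub> x') = h x \<oplus>\<^bsub>N\<^esub> h x'"
    and lact: "\<lbrakk>a \<in> carrier A; x \<in> carrier P\<rbrakk> \<Longrightarrow> h (lact P a x) = ract N (h x) (st a)"
    and ract: "\<lbrakk>a \<in> carrier A; x \<in> carrier P\<rbrakk> \<Longrightarrow> h (ract P x a) = lact N (st a) (h x)"

text \<open>Both pairings are required to be compatible with the star, which keeps the hypotheses
  invariant under exchange. For a line module the law for \<epsilon> is the Hermitian condition, and
  the one for \<phi> is derived from it.\<close>

locale star_pairing = pairing A P N \<epsilon> \<phi> S CP CN + stP: antilinear A P N st stP + stN: antilinear A N P st stN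
  for A :: "(complex, 'a, 'm) module_scheme" (structure) and P :: "('a, 'p) bimod" and N :: "('a, 'q) bimod"
    and \<epsilon> \<phi> and S :: "'a \<Rightarrow> 'u" and CP CN and st stP stN +
  assumes st_closed [simp]: "a \<in> carrier A \<Longrightarrow> st a \<in> carrier A"
    and st_add: "\<lbrakk>a \<in> carrier A; b \<in> carrier A\<rbrakk> \<Longrightarrow> st (a \<oplus> b) = st a \<oplus> st b"
    and st_mult: "\<lbrakk>a \<in> carrier A; b \<in> carrier A\<rbrakk> \<Longrightarrow> st (a \<otimes> b) = st b \<otimes> st a"
    and st_st [simp]: "a \<in> carrier A \<Longrightarrow> st (st a) = a"
    and st_smult: "a \<in> carrier A \<Longrightarrow> st (c \<odot> a) = cnj c \<odot> st a"
    and stN_stP [simp]: "x \<in> carrier P \<Longrightarrow> stN (stP x) = x"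
    and stP_stN [simp]: "y \<in> carrier N \<Longrightarrow> stP (stN y) = y"
    and \<epsilon>_star: "\<lbrakk>x \<in> carrier P; y \<in> carrier N\<rbrakk> \<Longrightarrow> st (\<epsilon> x y) = \<epsilon> (stN y) (stP x)"
    and \<phi>_star: "\<lbrakk>y \<in> carrier N; x \<in> carrier P\<rbrakk> \<Longrightarrow> st (\<phi> y x) = \<phi> (stP x) (stN y)"

sublocale star_pairing \<subseteq> swap: star_pairing A N P \<phi> \<epsilon> S CN CP st stN stP
  by unfold_locales
    (simp_all add: st_add st_mult st_smult \<epsilon>_star \<phi>_star)

context star_pairing
begin

definition starM :: "int \<Rightarrow> 'u \<Rightarrow> 'u" where
  "starM n u = (if n = 0 then S (st (inv_into UNIV S u))
     else if n > 0 then extP (M (- n)) (\<lambda>xs. nw (rev (map stP xs))) u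
     else swap.extP (M (- n)) (\<lambda>ys. pw (rev (map stN ys))) u)"

lemma stP_image [simp]: "set xs \<subseteq> carrier P \<Longrightarrow> stP ` set xs \<subseteq> carrier N"
  by auto

lemma starM_S [simp]: "starM 0 (S a) = S (st a)"
  by (simp add: starM_def inv_f_f[OF inj_S])

text \<open>Reversal makes the second of two neighbours the first, and the star turns a left action
  into a right one. The two effects together map a balancing relation to a balancing relation for
  \<open>st a\<close>.\<close>

lemma rev_star_balanced:
  assumes "0 < k" shows "balanced A P k (M (- int k)) (\<lambda>xs. nw (rev (map stP xs)))"
proof -
  have b: "balanced A N k (M (- int k)) nw"
    using swap.pw_balanced[OF assms] by (simp add: M_swap)
  show ?thesis
  proof (rule balancedI)
    fix xs assume "xs \<in> words P k"
    then show "nw (rev (map stP xs)) \<in> carrier (M (- int k))"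
      by (intro balancedD(1)[OF b]) (auto simp: words_def)
  next
    fix us x x' vs assume "us @ x # vs \<in> words P k" "x' \<in> carrier P"
    then show "nw (rev (map stP (us @ (x \<oplus>\<^bsub>P\<^esub> x') # vs))) =
        nw (rev (map stP (us @ x # vs))) \<oplus>\<^bsub>M (- int k)\<^esub> nw (rev (map stP (us @ x' # vs)))"
      using balancedD(2)[OF b, of "rev (map stP vs)" "stP x" "rev (map stP us)" "stP x'"]
      by (auto simp: words_def stP.add)
  next
    fix us x a y vs assume "us @ x # y # vs \<in> words P k" "a \<in> carrier A"
    then show "nw (rev (map stP (us @ ract P x a # y # vs))) = nw (rev (map stP (us @ x # lact P a y # vs)))"
      using balancedD(3)[OF b, of "rev (map stP vs)" "stP y" "stP x" "rev (map stP us)" "st a"]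
      by (auto simp: words_def stP.ract stP.lact)
  qed
qed

lemma starM_pw:
  assumes "xs \<noteq> []" "set xs \<subseteq> carrier P"
  shows "starM (int (length xs)) (pw xs) = nw (rev (map stP xs))"
  using extP(2)[OF M.abelian_group_E rev_star_balanced, of "length xs" xs] assms
  by (simp add: starM_def words_def)

lemma starM_hom_pos: "0 < n \<Longrightarrow> starM n \<in> add_hom (M n) (M (- n))"
  using extP(1)[OF M.abelian_group_E rev_star_balanced, of "nat n"] by (simp add: starM_def[abs_def])

end

context star_pairing
begin

lemma starM_swap: "swap.starM n u = starM (- n) u"
  by (simp add: starM_def swap.starM_def M_swap)

lemma starM_nw:
  assumes "ys \<noteq> []" "set ys \<subseteq> carrier N"
  shows "starM (- int (length ys)) (nw ys) = pw (rev (map stN ys))"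
  using swap.starM_pw[of ys] assms by (simp add: starM_swap)

lemma starM_nw1:
  assumes "set ys \<subseteq> carrier N"
  shows "starM (- int (length ys)) (nw1 ys) = swap.nw1 (rev (map stN ys))"
proof -
  \<comment> \<open>An involutive antihomomorphism fixes the unit: apply \<open>st\<close> to the
    product of \<open>st \<one>\<close> and \<open>\<one>\<close>.\<close>
  have "st \<one> = \<one>"
    using st_mult[of "st \<one>" "\<one>"] by simp
  then show ?thesis using starM_nw[of ys] assms by (simp add: nw1_def swap.nw1_def)
qed

lemma starM_hom: "starM n \<in> add_hom (M n) (M (- n))"
proof (cases n rule: M_cases)
  case 1
  have "st \<in> add_hom A A" by (rule add_homI) (simp_all add: st_add)
  from add_hom_compose[OF add_hom_compose[OF inv_S_hom this] S_hom]
  show ?thesis by (simp add: 1 starM_def[abs_def])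
next
  case (2 k)
  then show ?thesis using starM_hom_pos[of n] by linarith
next
  case (3 k)
  then have "0 < - n" by simp
  then show ?thesis using swap.starM_hom_pos[of "- n"] by (simp add: starM_swap[abs_def] M_swap)
qed

lemma starM_closed [simp]: "u \<in> carrier (M n) \<Longrightarrow> starM n u \<in> carrier (M (- n))"
  by (rule add_hom_closed[OF starM_hom])

lemma starM_starM:
  assumes u: "u \<in> carrier (M n)" shows "starM (- n) (starM n u) = u"
proof -
  have h: "(\<lambda>u. starM (- n) (starM n u)) \<in> add_hom (M n) (M n)"
    using add_hom_compose[OF starM_hom[of n] starM_hom[of "- n"]] by simp
  have mP: "map (\<lambda>x. stN (stP x)) xs = xs" if "set xs \<subseteq> carrier P" for xs
    using that by (intro map_idI) auto
  have mN: "map (\<lambda>x. stP (stN x)) xs = xs" if "set xs \<subseteq> carrier N" for xs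
    using that by (intro map_idI) auto
  show ?thesis
  proof (rule M_hom_eqI[OF _ _ _ M.abelian_group_E h add_hom_ident u], goal_cases scal pos neg)
    case (pos xs)
    then show ?case
      using starM_nw[of "rev (map stP xs)"] by (auto simp: starM_pw rev_map o_def mP)
  next
    case (neg ys)
    then show ?case
      using starM_pw[of "rev (map stN ys)"] by (auto simp: starM_nw rev_map o_def mN)
  qed simp
qed

lemma starM_lact_pw:
  assumes "a \<in> carrier A" "xs \<noteq> []" "set xs \<subseteq> carrier P" "n = int (length xs)"
  shows "starM n (lact (M n) a (pw xs)) = ract (M (- n)) (starM n (pw xs)) (st a)"
proof -
  obtain z zs where z: "xs = z # zs" using assms by (cases xs) auto
  have "set (rev (map stP zs) @ [stP z]) \<subseteq> carrier N" using assms z by auto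
  then show ?thesis using assms z starM_pw[of "lact P a z # zs"] starM_pw[of "z # zs"]
      swap.pw_ract[of "rev (map stP zs)" "stP z" "st a"]
    by (simp add: pw_lact stP.lact M_swap)
qed

end

section \<open>Order reversal\<close>

context star_pairing
begin

lemma starM_lact:
  assumes a: "a \<in> carrier A" and u: "u \<in> carrier (M n)"
  shows "starM n (lact (M n) a u) = ract (M (- n)) (starM n u) (st a)"
proof (rule M_hom_eqI[OF _ _ _ M.abelian_group_E add_hom_compose[OF M.lact_hom starM_hom] add_hom_compose[OF starM_hom M.ract_hom] u], goal_cases scal pos neg)
  case (scal b)
  then show ?case using a by (simp add: st_mult)
next
  case (neg ys)
  then show ?case using swap.starM_lact_pw[OF a, of ys "- n"] by (simp add: starM_swap M_swap)
qed (use a starM_lact_pw in simp_all)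

lemma starM_smult:
  assumes "u \<in> carrier (M n)"
  shows "starM n (c \<odot>\<^bsub>M n\<^esub> u) = cnj c \<odot>\<^bsub>M (- n)\<^esub> starM n u"
proof -
  have "st (scal c) = cnj c \<odot> st \<one>" by (simp add: st_smult)
  also have "st \<one> = \<one>" using st_mult[of "st \<one>" "\<one>"] by simp
  finally show ?thesis
    using assms by (simp add: M.smult_E(1)[of u] starM_lact M.smult_E(2)[OF starM_closed])
qed

text \<open>The letter case of order reversal. In negative degree both sides cancel, at opposite
  ends: \<open>x\<close> cancels the first letter \<open>z\<close>, and after reversal the star of
  \<open>z\<close>, now last, cancels the star of \<open>x\<close>. By
  \<open>\<epsilon>_star\<close> the scalars left behind match.\<close>

lemma starM_lam:
  assumes x: "x \<in> carrier P" and u: "u \<in> carrier (M n)"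
  shows "starM (n + 1) (lam n x u) = mul (- n) (- 1) (starM n u) (nw [stP x])"
proof -
  have c: "nw [stP x] \<in> carrier (M (- 1))"
    using swap.pw_closed[of "[stP x]"] x by (simp add: M_swap)
  have h: "(\<lambda>u. starM (n + 1) (lam n x u)) \<in> add_hom (M n) (M (- n + - 1))"
    using add_hom_compose[OF lam_hom[OF x, of n] starM_hom[of "n + 1"]] by (simp add: algebra_simps)
  show ?thesis
  proof (rule M_hom_eqI[OF _ _ _ M.abelian_group_E h add_hom_compose[OF starM_hom mul_hom1[OF c]] u], goal_cases scal pos neg)
    case (scal a)
    then show ?case using x starM_pw[of "[ract P x a]"] nw_lact[of "stP x" "[]" "st a"]
      by (simp add: lam_S stP.ract)
  next
    case (pos xs)
    have "set (rev (map stP xs)) \<subseteq> carrier N" using pos by auto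
    then show ?case
      using pos x starM_pw[of "x # xs"] swap.mul_pw_pw[of "rev (map stP xs)" "[stP x]" n 1]
      by (simp add: lam_pw starM_pw mul_swap add_ac)
  next
    case (neg ys)
    then obtain z zs where z: "ys = z # zs" by (cases ys) auto
    define ws where "ws = rev (map stN zs)"
    have ws: "set ws \<subseteq> carrier P" "length zs = length ws" using neg z by (auto simp: ws_def)
    have n: "n = - 1 - int (length zs)" "n + 1 = - int (length zs)" using neg z by simp_all
    have e: "\<epsilon> (stN z) (stP x) \<in> carrier A" using neg z x by simp
    have "starM (n + 1) (lam n x (nw ys)) = starM (- int (length zs)) (lact (M (- int (length zs))) (\<epsilon> x z) (nw1 zs))"
      unfolding n(2) unfolding n(1) z using neg z x by (simp add: lam_nw1)
    also have "\<dots> = ract (M (int (length zs))) (swap.nw1 ws) (\<epsilon> (stN z) (stP x))"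
      using neg z x by (simp add: starM_lact starM_nw1 ws_def \<epsilon>_star)
    also have "\<dots> = act 0 ws (S (\<epsilon> (stN z) (stP x)))"
      using ws e act_S[of ws "\<epsilon> (stN z) (stP x)"] by (simp add: swap.nw1_def)
    \<comment> \<open>The scalar is read backwards, as \<open>stN z\<close> cancelling
      \<open>stP x\<close>; this exhibits a product with the word \<open>[stP x]\<close> on the
      right.\<close>
    also have "\<dots> = act (- 1) (ws @ [stN z]) (nw [stP x])"
      using x neg z by (simp add: act_append lam_nw_single)
    also have "\<dots> = mul (int (length (ws @ [stN z]))) (- 1) (pw (ws @ [stN z])) (nw [stP x])"
      using ws neg z c by (subst mul_pw) auto
    also have "\<dots> = mul (- n) (- 1) (starM n (nw ys)) (nw [stP x])"
    proof -
      have "starM n (nw ys) = pw (ws @ [stN z])"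
        using starM_nw[OF neg(1,2)] neg(3) z by (simp add: ws_def)
      moreover have "- n = int (length (ws @ [stN z]))"
        using n(1) ws(2) by simp
      ultimately show ?thesis by (simp only:)
    qed
    finally show ?case .
  qed
qed

text \<open>Writing the reversed word with \<open>nw1\<close> lets the induction start at the empty
  word, where the factor is the unit.\<close>

lemma starM_act:
  assumes "set xs \<subseteq> carrier P" "v \<in> carrier (M m)"
  shows "starM (m + int (length xs)) (act m xs v) =
    mul (- m) (- int (length xs)) (starM m v) (nw1 (rev (map stP xs)))"
  using assms
proof (induction xs)
  case Nil
  then show ?case by (simp add: nw1_def mul_one_right)
next
  case (Cons x xs)
  let ?r = "rev (map stP xs)" and ?k = "int (length xs)"
  have r: "set ?r \<subseteq> carrier N" using Cons.prems by auto
  have c: "nw1 ?r \<in> carrier (M (- ?k))" using nw1_closed[OF r] by simp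
  have cx: "nw [stP x] \<in> carrier (M (- 1))"
    using swap.pw_closed[of "[stP x]"] Cons.prems by (simp add: M_swap)
  have "starM (m + int (length (x # xs))) (act m (x # xs) v) = starM (m + ?k + 1) (lam (m + ?k) x (act m xs v))"
    by (simp add: algebra_simps)
  also have "\<dots> = mul (- (m + ?k)) (- 1) (starM (m + ?k) (act m xs v)) (nw [stP x])"
    by (rule starM_lam) (use Cons.prems in simp_all)
  also have "\<dots> = mul (- m + - ?k) (- 1) (mul (- m) (- ?k) (starM m v) (nw1 ?r)) (nw [stP x])"
    using Cons by simp
  also have "\<dots> = mul (- m) (- ?k + - 1) (starM m v) (mul (- ?k) (- 1) (nw1 ?r) (nw [stP x]))"
    by (rule mul_assoc) (use Cons.prems c cx in simp_all)
  also have "mul (- ?k) (- 1) (nw1 ?r) (nw [stP x]) = nw1 (rev (map stP (x # xs)))"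
  proof (cases "xs = []")
    case True
    then show ?thesis using cx by (simp add: nw1_def)
  next
    case False
    then show ?thesis
      using swap.mul_pw_pw[of ?r "[stP x]" ?k 1] r Cons.prems by (simp add: nw1_def mul_swap)
  qed
  finally show ?case by (simp add: algebra_simps)
qed

end

context star_pairing
begin

lemma starM_mul:
  assumes u: "u \<in> carrier (M n)" and v: "v \<in> carrier (M m)"
  shows "starM (n + m) (mul n m u v) = mul (- m) (- n) (starM m v) (starM n u)"
proof -
  have h: "(\<lambda>u. starM (n + m) (mul n m u v)) \<in> add_hom (M n) (M (- m + - n))"
    using add_hom_compose[OF mul_hom1[OF v, of n] starM_hom[of "n + m"]] by (simp add: algebra_simps)
  have sv: "starM m v \<in> carrier (M (- m))" using v by simp
  show ?thesis
  proof (rule M_hom_eqI[OF _ _ _ M.abelian_group_E h add_hom_compose[OF starM_hom mul_hom2[OF sv]] u], goal_cases scal pos neg)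
    case (scal a)
    then show ?case using v by (simp add: starM_lact mul_S_right)
  next
    case (pos xs)
    then show ?case using v starM_act[of xs v m] by (simp add: mul_pw starM_pw nw1_def add_ac)
  next
    case (neg ys)
    then show ?case using v swap.starM_act[of ys v "- m"]
      by (simp add: mul_nw starM_nw swap.nw1_def starM_swap mul_swap M_swap add_ac)
  qed
qed

end

subsection \<open>Binary tensor products\<close>

locale bimod_pair = E: bimod A E + F: bimod A F
  for A :: "(complex, 'a, 'm) module_scheme" (structure) and E :: "('a, 'e) bimod" and F :: "('a, 'f) bimod"
begin

abbreviation "W \<equiv> carrier E \<times> carrier F"
abbreviation "R \<equiv> tensor_rels A E F"
abbreviation "T \<equiv> tensor A E F"
abbreviation "tn \<equiv> tens A E F"

lemma tensor_rels_cases: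
  assumes "r \<in> R"
  obtains x x' y where "r = frag_of (x \<oplus>\<^bsub>E\<^esub> x', y) - frag_of (x, y) - frag_of (x', y)"
      "x \<in> carrier E" "x' \<in> carrier E" "y \<in> carrier F"
    | x y y' where "r = frag_of (x, y \<oplus>\<^bsub>F\<^esub> y') - frag_of (x, y) - frag_of (x, y')"
      "x \<in> carrier E" "y \<in> carrier F" "y' \<in> carrier F"
    | x a y where "r = frag_of (ract E x a, y) - frag_of (x, lact F a y)"
      "x \<in> carrier E" "a \<in> carrier A" "y \<in> carrier F"
  using assms unfolding tensor_rels_def by blast

lemma presentation_tensor: "presentation W R"
proof
  fix r assume "r \<in> R"
  then show "Poly_Mapping.keys r \<subseteq> W"
  proof (cases rule: tensor_rels_cases)
    case (1 x x' y)
    show ?thesis unfolding 1(1)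
      by (rule order_trans[OF keys_frag_diff2]) (use 1(2-4) in simp)
  next
    case (2 x y y')
    show ?thesis unfolding 2(1)
      by (rule order_trans[OF keys_frag_diff2]) (use 2(2-4) in simp)
  next
    case (3 x a y)
    show ?thesis unfolding 3(1)
      by (rule order_trans[OF keys_frag_diff]) (use 3(2-4) in simp)
  qed
qed

interpretation pr: presentation W R by (rule presentation_tensor)

lemma tensor_simps:
  "carrier T = carrier (presented W R)" "add T = add (presented W R)" "zero T = zero (presented W R)"
  by (simp_all add: tensor_def presented_bimod_def)

lemma abelian_group_tensor: "abelian_group T"
  by (rule abelian_group_cong[OF pr.abelian_group_presented]) (simp_all add: tensor_simps)

lemma add_hom_tensor: "add_hom T Y = add_hom (presented W R) Y"
  by (rule add_hom_cong) (simp_all add: tensor_simps)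

lemma tens_closed: "\<lbrakk>x \<in> carrier E; y \<in> carrier F\<rbrakk> \<Longrightarrow> tn x y \<in> carrier T"
  by (simp add: tens_def tensor_simps pr.gen_class_closed)

lemma tens_add1:
  assumes "x \<in> carrier E" "x' \<in> carrier E" "y \<in> carrier F"
  shows "tn (x \<oplus>\<^bsub>E\<^esub> x') y = tn x y \<oplus>\<^bsub>T\<^esub> tn x' y"
proof -
  have "frag_of (x \<oplus>\<^bsub>E\<^esub> x', y) - frag_of (x, y) - frag_of (x', y) \<in> R"
    unfolding tensor_rels_def using assms by blast
  from pr.gen_class_add[OF this] show ?thesis using assms by (simp add: tens_def tensor_simps)
qed

lemma tens_add2:
  assumes "x \<in> carrier E" "y \<in> carrier F" "y' \<in> carrier F"
  shows "tn x (y \<oplus>\<^bsub>F\<^esub> y') = tn x y \<oplus>\<^bsub>T\<^esub> tn x y'"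
proof -
  have "frag_of (x, y \<oplus>\<^bsub>F\<^esub> y') - frag_of (x, y) - frag_of (x, y') \<in> R"
    unfolding tensor_rels_def using assms by blast
  from pr.gen_class_add[OF this] show ?thesis using assms by (simp add: tens_def tensor_simps)
qed

lemma tens_bal:
  assumes "x \<in> carrier E" "a \<in> carrier A" "y \<in> carrier F"
  shows "tn (ract E x a) y = tn x (lact F a y)"
proof -
  have "frag_of (ract E x a, y) - frag_of (x, lact F a y) \<in> R"
    unfolding tensor_rels_def using assms by blast
  from pr.gen_class_eq[OF this] show ?thesis using assms by (simp add: tens_def)
qed

lemma tensor_induced:
  assumes Y: "abelian_group Y"
    and closed: "\<And>x y. \<lbrakk>x \<in> carrier E; y \<in> carrier F\<rbrakk> \<Longrightarrow> g (x, y) \<in> carrier Y"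
    and add1: "\<And>x x' y. \<lbrakk>x \<in> carrier E; x' \<in> carrier E; y \<in> carrier F\<rbrakk> \<Longrightarrow>
        g (x \<oplus>\<^bsub>E\<^esub> x', y) = g (x, y) \<oplus>\<^bsub>Y\<^esub> g (x', y)"
    and add2: "\<And>x y y'. \<lbrakk>x \<in> carrier E; y \<in> carrier F; y' \<in> carrier F\<rbrakk> \<Longrightarrow>
        g (x, y \<oplus>\<^bsub>F\<^esub> y') = g (x, y) \<oplus>\<^bsub>Y\<^esub> g (x, y')"
    and bal: "\<And>x a y. \<lbrakk>x \<in> carrier E; a \<in> carrier A; y \<in> carrier F\<rbrakk> \<Longrightarrow>
        g (ract E x a, y) = g (x, lact F a y)"
  shows "induced Y g \<in> add_hom T Y"
    and "\<lbrakk>x \<in> carrier E; y \<in> carrier F\<rbrakk> \<Longrightarrow> induced Y g (tn x y) = g (x, y)"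
proof -
  interpret Y: abelian_group Y by fact
  have gW: "g \<in> W \<rightarrow> carrier Y" using closed by auto
  note fe = free_extend_minus[OF Y gW] free_extend_hom(3)[OF Y gW]
  have kill: "free_extend Y g r = \<zero>\<^bsub>Y\<^esub>" if "r \<in> R" for r
    using that
  proof (cases rule: tensor_rels_cases)
    case (1 x x' y)
    have k: "Poly_Mapping.keys (frag_of (x \<oplus>\<^bsub>E\<^esub> x', y) - frag_of (x, y)) \<subseteq> W"
      by (rule order_trans[OF keys_frag_diff]) (use 1(2-4) in simp)
    have "free_extend Y g r = (g (x, y) \<oplus>\<^bsub>Y\<^esub> g (x', y)) \<ominus>\<^bsub>Y\<^esub> g (x, y) \<ominus>\<^bsub>Y\<^esub> g (x', y)"
      unfolding 1(1) using k 1(2-4) by (simp add: fe add1)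
    then show ?thesis
      using closed[OF 1(2,4)] closed[OF 1(3,4)] by (simp add: a_minus_def Y.a_ac Y.r_neg Y.r_neg1)
  next
    case (2 x y y')
    have k: "Poly_Mapping.keys (frag_of (x, y \<oplus>\<^bsub>F\<^esub> y') - frag_of (x, y)) \<subseteq> W"
      by (rule order_trans[OF keys_frag_diff]) (use 2(2-4) in simp)
    have "free_extend Y g r = (g (x, y) \<oplus>\<^bsub>Y\<^esub> g (x, y')) \<ominus>\<^bsub>Y\<^esub> g (x, y) \<ominus>\<^bsub>Y\<^esub> g (x, y')"
      unfolding 2(1) using k 2(2-4) by (simp add: fe add2)
    then show ?thesis
      using closed[OF 2(2,3)] closed[OF 2(2,4)] by (simp add: a_minus_def Y.a_ac Y.r_neg Y.r_neg1)
  next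
    case (3 x a y)
    have "free_extend Y g r = g (x, lact F a y) \<ominus>\<^bsub>Y\<^esub> g (x, lact F a y)"
      unfolding 3(1) using 3(2-4) by (simp add: fe bal)
    then show ?thesis
      using closed[OF 3(2), of "lact F a y"] 3(3,4) by (simp add: a_minus_def Y.r_neg)
  qed
  show "induced Y g \<in> add_hom T Y"
    unfolding add_hom_tensor by (rule pr.induced_hom(1)[OF Y gW kill])
  show "induced Y g (tn x y) = g (x, y)" if "x \<in> carrier E" "y \<in> carrier F"
    unfolding tens_def using pr.induced_hom(2)[OF Y gW kill] that by simp
qed

lemma tensor_lact:
  assumes a: "a \<in> carrier A"
  shows "lact T a \<in> add_hom T T"
    and "\<lbrakk>x \<in> carrier E; y \<in> carrier F\<rbrakk> \<Longrightarrow> lact T a (tn x y) = tn (lact E a x) y"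
proof -
  let ?g = "\<lambda>w. gen_class W R (lact E a (fst w), snd w)"
  have l: "lact T a = induced (presented W R) ?g"
    by (simp add: tensor_def presented_bimod_def split_def)
  have g: "?g (x, y) = tn (lact E a x) y" for x y by (simp add: tens_def)
  note t = a tens_closed[unfolded tensor_simps] tens_add1[unfolded tensor_simps]
    tens_add2[unfolded tensor_simps] tens_bal[symmetric] E.act_add E.act_assoc[symmetric]
  have "induced (presented W R) ?g \<in> add_hom T (presented W R)"
    by (rule tensor_induced(1)[OF pr.abelian_group_presented]; unfold g) (simp_all add: t)
  then show "lact T a \<in> add_hom T T"
    unfolding l by (simp add: add_hom_def tensor_simps)
  show "lact T a (tn x y) = tn (lact E a x) y" if "x \<in> carrier E" "y \<in> carrier F"
    unfolding l
    by (rule trans[OF tensor_induced(2)[OF pr.abelian_group_presented]]; (unfold g)?)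
      (use that in \<open>simp_all add: t\<close>)
qed

lemma tensor_ract:
  assumes a: "a \<in> carrier A" and "x \<in> carrier E" "y \<in> carrier F"
  shows "ract T (tn x y) a = tn x (ract F y a)"
proof -
  let ?g = "\<lambda>w. gen_class W R (fst w, ract F (snd w) a)"
  have l: "ract T U a = induced (presented W R) ?g U" for U
    by (simp add: tensor_def presented_bimod_def split_def)
  have g: "?g (x, y) = tn x (ract F y a)" for x y by (simp add: tens_def)
  note t = a tens_closed[unfolded tensor_simps] tens_add1[unfolded tensor_simps]
    tens_add2[unfolded tensor_simps] tens_bal F.act_add F.act_assoc
  show ?thesis
    unfolding l
    by (rule trans[OF tensor_induced(2)[OF pr.abelian_group_presented]]; (unfold g)?)
      (use assms in \<open>simp_all add: t\<close>)
qed

end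

subsection \<open>Dual bimodules\<close>

context bimod
begin

abbreviation "D \<equiv> dual A E"

lemma carrier_dual: "\<alpha> \<in> carrier D \<longleftrightarrow> \<alpha> \<in> extensional (carrier E) \<and>
    (\<forall>x\<in>carrier E. \<alpha> x \<in> carrier A) \<and>
    (\<forall>x\<in>carrier E. \<forall>y\<in>carrier E. \<alpha> (x \<oplus>\<^bsub>E\<^esub> y) = \<alpha> x \<oplus> \<alpha> y) \<and>
    (\<forall>a\<in>carrier A. \<forall>x\<in>carrier E. \<alpha> (lact E a x) = a \<otimes> \<alpha> x)"
  by (auto simp: dual_def left_hom_def self_bimod_def)

lemma dualD:
  assumes "\<alpha> \<in> carrier D"
  shows "x \<in> carrier E \<Longrightarrow> \<alpha> x \<in> carrier A"
    and "\<lbrakk>x \<in> carrier E; y \<in> carrier E\<rbrakk> \<Longrightarrow> \<alpha> (x \<oplus>\<^bsub>E\<^esub> y) = \<alpha> x \<oplus> \<alpha> y"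
    and "\<lbrakk>a \<in> carrier A; x \<in> carrier E\<rbrakk> \<Longrightarrow> \<alpha> (lact E a x) = a \<otimes> \<alpha> x"
  using assms by (simp_all add: carrier_dual)

lemma dual_eqI:
  assumes "\<alpha> \<in> carrier D" "\<beta> \<in> carrier D" "\<And>x. x \<in> carrier E \<Longrightarrow> \<alpha> x = \<beta> x"
  shows "\<alpha> = \<beta>"
  using assms by (intro extensionalityI[of _ "carrier E"]) (simp_all add: carrier_dual)

lemma dual_apply:
  assumes "x \<in> carrier E"
  shows "\<zero>\<^bsub>D\<^esub> x = \<zero>" "(\<alpha> \<oplus>\<^bsub>D\<^esub> \<beta>) x = \<alpha> x \<oplus> \<beta> x" "(c \<odot>\<^bsub>D\<^esub> \<alpha>) x = c \<odot> \<alpha> x"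
    "lact D a \<alpha> x = \<alpha> (ract E x a)" "ract D \<alpha> a x = \<alpha> x \<otimes> a"
  using assms by (simp_all add: dual_def)

lemma dual_closed:
  "\<zero>\<^bsub>D\<^esub> \<in> carrier D"
  "\<lbrakk>\<alpha> \<in> carrier D; \<beta> \<in> carrier D\<rbrakk> \<Longrightarrow> \<alpha> \<oplus>\<^bsub>D\<^esub> \<beta> \<in> carrier D"
  "\<lbrakk>a \<in> carrier A; \<alpha> \<in> carrier D\<rbrakk> \<Longrightarrow> lact D a \<alpha> \<in> carrier D"
  "\<lbrakk>a \<in> carrier A; \<alpha> \<in> carrier D\<rbrakk> \<Longrightarrow> ract D \<alpha> a \<in> carrier D"
proof -
  have e: "\<zero>\<^bsub>D\<^esub> \<in> extensional (carrier E)" "\<alpha> \<oplus>\<^bsub>D\<^esub> \<beta> \<in> extensional (carrier E)"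
      "lact D a \<alpha> \<in> extensional (carrier E)" "ract D \<alpha> a \<in> extensional (carrier E)" for \<alpha> \<beta> a
    by (simp_all add: dual_def)
  show "\<zero>\<^bsub>D\<^esub> \<in> carrier D"
    unfolding carrier_dual using e by (simp add: dual_apply)
  show "\<alpha> \<oplus>\<^bsub>D\<^esub> \<beta> \<in> carrier D" if "\<alpha> \<in> carrier D" "\<beta> \<in> carrier D"
    unfolding carrier_dual using e dualD[OF that(1)] dualD[OF that(2)]
    by (simp add: dual_apply A.r_distr A.a_ac)
  show "lact D a \<alpha> \<in> carrier D" if "a \<in> carrier A" "\<alpha> \<in> carrier D"
    unfolding carrier_dual using e that(1) dualD[OF that(2)]
    by (simp add: dual_apply act_add act_assoc)
  show "ract D \<alpha> a \<in> carrier D" if "a \<in> carrier A" "\<alpha> \<in> carrier D"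
    unfolding carrier_dual using e that(1) dualD[OF that(2)]
    by (simp add: dual_apply A.l_distr A.m_assoc)
qed

lemmas dual_simps = dual_closed dual_apply dualD

lemma abelian_group_dual: "abelian_group D"
proof (rule abelian_groupI)
  fix \<alpha> assume a: "\<alpha> \<in> carrier D"
  note d = dualD[OF a]
  define \<beta> where "\<beta> = (\<lambda>x\<in>carrier E. \<ominus> \<alpha> x)"
  have b: "\<beta> \<in> carrier D"
    unfolding carrier_dual by (simp add: \<beta>_def d A.minus_add A.r_minus)
  have "\<beta> \<oplus>\<^bsub>D\<^esub> \<alpha> = \<zero>\<^bsub>D\<^esub>"
    by (rule dual_eqI) (use a b d in \<open>simp_all add: dual_closed dual_apply \<beta>_def A.l_neg\<close>)
  then show "\<exists>y\<in>carrier D. y \<oplus>\<^bsub>D\<^esub> \<alpha> = \<zero>\<^bsub>D\<^esub>" using b by blast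
next
  fix \<alpha> \<beta> \<gamma> assume a: "\<alpha> \<in> carrier D" "\<beta> \<in> carrier D" "\<gamma> \<in> carrier D"
  show "\<alpha> \<oplus>\<^bsub>D\<^esub> \<beta> \<oplus>\<^bsub>D\<^esub> \<gamma> = \<alpha> \<oplus>\<^bsub>D\<^esub> (\<beta> \<oplus>\<^bsub>D\<^esub> \<gamma>)"
    by (rule dual_eqI) (use a in \<open>simp_all add: dual_simps A.a_assoc\<close>)
next
  fix \<alpha> \<beta> assume a: "\<alpha> \<in> carrier D" "\<beta> \<in> carrier D"
  show "\<alpha> \<oplus>\<^bsub>D\<^esub> \<beta> = \<beta> \<oplus>\<^bsub>D\<^esub> \<alpha>"
    by (rule dual_eqI) (use a in \<open>simp_all add: dual_simps A.a_comm\<close>)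
next
  fix \<alpha> assume a: "\<alpha> \<in> carrier D"
  show "\<zero>\<^bsub>D\<^esub> \<oplus>\<^bsub>D\<^esub> \<alpha> = \<alpha>"
    by (rule dual_eqI) (use a in \<open>simp_all add: dual_simps\<close>)
qed (simp_all add: dual_closed)

lemma bimodule_dual: "bimodule A D"
proof (rule bimoduleI)
  fix a b \<alpha> \<beta> assume h: "a \<in> carrier A" "b \<in> carrier A" "\<alpha> \<in> carrier D"
  show "lact D (a \<oplus> b) \<alpha> = lact D a \<alpha> \<oplus>\<^bsub>D\<^esub> lact D b \<alpha>"
    by (rule dual_eqI) (use h in \<open>simp_all add: dual_simps act_plus\<close>)
  show "ract D \<alpha> (a \<oplus> b) = ract D \<alpha> a \<oplus>\<^bsub>D\<^esub> ract D \<alpha> b"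
    by (rule dual_eqI) (use h in \<open>simp_all add: dual_simps A.r_distr\<close>)
  show "lact D (a \<otimes> b) \<alpha> = lact D a (lact D b \<alpha>)"
    by (rule dual_eqI) (use h in \<open>simp_all add: dual_simps act_mult\<close>)
  show "ract D \<alpha> (a \<otimes> b) = ract D (ract D \<alpha> a) b"
    by (rule dual_eqI) (use h in \<open>simp_all add: dual_simps A.m_assoc\<close>)
  show "ract D (lact D a \<alpha>) b = lact D a (ract D \<alpha> b)"
    by (rule dual_eqI) (use h in \<open>simp_all add: dual_simps\<close>)
next
  fix a \<alpha> \<beta> assume h: "a \<in> carrier A" "\<alpha> \<in> carrier D" "\<beta> \<in> carrier D"
  show "lact D a (\<alpha> \<oplus>\<^bsub>D\<^esub> \<beta>) = lact D a \<alpha> \<oplus>\<^bsub>D\<^esub> lact D a \<beta>"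
    by (rule dual_eqI) (use h in \<open>simp_all add: dual_simps\<close>)
  show "ract D (\<alpha> \<oplus>\<^bsub>D\<^esub> \<beta>) a = ract D \<alpha> a \<oplus>\<^bsub>D\<^esub> ract D \<beta> a"
    by (rule dual_eqI) (use h in \<open>simp_all add: dual_simps A.l_distr\<close>)
next
  fix \<alpha> assume h: "\<alpha> \<in> carrier D"
  show "lact D \<one> \<alpha> = \<alpha>"
    by (rule dual_eqI) (use h in \<open>simp_all add: dual_simps\<close>)
  show "ract D \<alpha> \<one> = \<alpha>"
    by (rule dual_eqI) (use h in \<open>simp_all add: dual_simps\<close>)
next
  fix \<alpha> c assume h: "\<alpha> \<in> carrier D"
  \<comment> \<open>From either side \<open>scal c\<close> acts on the argument as the complex
    scalar, so it can be moved to the left, where the functional is linear.\<close>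
  have s: "\<alpha> (ract E x (scal c)) = c \<odot> \<alpha> x" if "x \<in> carrier E" for x
    using that h smult_E[of x c] dualD(3)[OF h, of "scal c" x] dualD(1)[OF h that]
    by (simp add: smult_A_mult)
  have "c \<odot>\<^bsub>D\<^esub> \<alpha> = (\<lambda>x\<in>carrier E. c \<odot> \<alpha> x)" by (simp add: dual_def)
  also have "\<dots> = lact D (scal c) \<alpha>" by (simp add: dual_def s restrict_def fun_eq_iff)
  finally show "c \<odot>\<^bsub>D\<^esub> \<alpha> = lact D (scal c) \<alpha>" .
  show "lact D (scal c) \<alpha> = ract D \<alpha> (scal c)"
    by (rule dual_eqI) (use h in \<open>simp_all add: dual_simps s smult_A_mult\<close>)
qed (simp_all add: dual_closed abelian_group_dual)

end

text \<open>The dual is not made a sublocale of \<^locale>\<open>bimod\<close>, which would generate all iterated duals.\<close>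

locale bimod_with_dual = bimod A E + dual: bimod A "dual A E"
  for A :: "(complex, 'a, 'm) module_scheme" (structure) and E :: "('a, 'e) bimod"

sublocale bimod_with_dual \<subseteq> ED: bimod_pair A E "dual A E" by unfold_locales

sublocale bimod_with_dual \<subseteq> DE: bimod_pair A "dual A E" E by unfold_locales

section \<open>Evaluation, dual bases and coevaluation\<close>

context bimod_with_dual
begin

lemma ev_tens:
  assumes "x \<in> carrier E" "\<alpha> \<in> carrier D"
  shows "ev A E (tens A E D x \<alpha>) = \<alpha> x"
  unfolding ev_def
  by (subst ED.tensor_induced(2)[OF A.is_abelian_group])
    (use assms in \<open>simp_all add: dualD dual_apply\<close>)

lemma dual_basis_exists:
  assumes "left_fgp A E" shows "\<exists>n b \<beta>. dual_basis A E n b \<beta>"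
proof -
  obtain n where "\<exists>i \<in> left_hom A E (free_bimod A n). \<exists>p \<in> left_hom A (free_bimod A n) E.
      \<forall>x\<in>carrier E. p (i x) = x"
    using assms unfolding left_fgp_def by (rule exE)
  then obtain i where i: "i \<in> left_hom A E (free_bimod A n)"
    and "\<exists>p \<in> left_hom A (free_bimod A n) E. \<forall>x\<in>carrier E. p (i x) = x"
    by (rule bexE)
  from this(2) obtain p where p: "p \<in> left_hom A (free_bimod A n) E" and "\<forall>x\<in>carrier E. p (i x) = x"
    by (rule bexE)
  then have pi: "p (i x) = x" if "x \<in> carrier E" for x using that by simp
  let ?F = "free_bimod A n"
  \<comment> \<open>Unit vectors of the free module. Their images under the retraction
    \<open>p\<close> become the basis, and the coordinates of the section \<open>i\<close> become
    the dual functionals.\<close>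
  define e where "e k = (\<lambda>j\<in>{..<n}. if j = k then \<one> else \<zero>)" for k
  have e: "e k \<in> carrier ?F" for k by (simp add: e_def free_bimod_def)
  have p_closed: "p v \<in> carrier E" if "v \<in> carrier ?F" for v
    using p that by (auto simp: left_hom_def)
  have p_add: "p (v \<oplus>\<^bsub>?F\<^esub> w) = p v \<oplus>\<^bsub>E\<^esub> p w" if "v \<in> carrier ?F" "w \<in> carrier ?F" for v w
    using p that by (auto simp: left_hom_def)
  have p_lin: "p (lact ?F a v) = lact E a (p v)" if "a \<in> carrier A" "v \<in> carrier ?F" for a v
    using p that by (auto simp: left_hom_def)
  have i_closed: "i x \<in> {..<n} \<rightarrow>\<^sub>E carrier A" if "x \<in> carrier E" for x
    using i that by (auto simp: left_hom_def free_bimod_def)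
  have i_add: "i (x \<oplus>\<^bsub>E\<^esub> y) k = i x k \<oplus> i y k" if "x \<in> carrier E" "y \<in> carrier E" "k < n" for x y k
    using i that by (auto simp: left_hom_def free_bimod_def)
  have i_lin: "i (lact E a x) k = a \<otimes> i x k" if "a \<in> carrier A" "x \<in> carrier E" "k < n" for a x k
    using i that by (auto simp: left_hom_def free_bimod_def)
  \<comment> \<open>\<open>tr v m\<close> keeps the first \<open>m\<close> coordinates. Thus
    \<open>v\<close> is built up by one multiple of a unit vector at a time, and \<open>p\<close> is
    applied to sums of two vectors only.\<close>
  define tr where "tr v m = (\<lambda>j\<in>{..<n}. if j < m then v j else \<zero>)" for v :: "nat \<Rightarrow> 'a" and m
  have p_tr: "p (tr v m) = (\<Oplus>\<^bsub>E\<^esub>k\<in>{..<m}. lact E (v k) (p (e k)))"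
    if v: "v \<in> {..<n} \<rightarrow>\<^sub>E carrier A" and "m \<le> n" for v m
    using that(2)
  proof (induction m)
    case 0
    have c: "tr v 0 \<in> carrier ?F" by (simp add: tr_def free_bimod_def)
    \<comment> \<open>The zero vector equals its own double, hence so does its image under
      \<open>p\<close>, which must then be zero.\<close>
    have "tr v 0 \<oplus>\<^bsub>?F\<^esub> tr v 0 = tr v 0" by (auto simp: tr_def free_bimod_def)
    then have "p (tr v 0) \<oplus>\<^bsub>E\<^esub> p (tr v 0) = p (tr v 0)" using p_add[OF c c] by simp
    then show ?case using p_closed[OF c] by simp
  next
    case (Suc m)
    have vk: "v k \<in> carrier A" if "k < n" for k using v that by auto
    have c: "tr v m \<in> carrier ?F" "lact ?F (v m) (e m) \<in> carrier ?F"
      using vk Suc.prems by (auto simp: tr_def e_def free_bimod_def)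
    have "tr v (Suc m) = tr v m \<oplus>\<^bsub>?F\<^esub> lact ?F (v m) (e m)"
      using vk Suc.prems by (auto simp: tr_def e_def free_bimod_def fun_eq_iff less_Suc_eq)
    then have "p (tr v (Suc m)) = p (tr v m) \<oplus>\<^bsub>E\<^esub> lact E (v m) (p (e m))"
      using p_add[OF c] p_lin[of "v m" "e m"] vk[of m] Suc.prems e by simp
    also have "\<dots> = lact E (v m) (p (e m)) \<oplus>\<^bsub>E\<^esub> (\<Oplus>\<^bsub>E\<^esub>k\<in>{..<m}. lact E (v k) (p (e k)))"
      using Suc vk p_closed[OF e] p_closed[OF c(1)] by (simp add: E.a_comm)
    also have "\<dots> = (\<Oplus>\<^bsub>E\<^esub>k\<in>{..<Suc m}. lact E (v k) (p (e k)))"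
      unfolding lessThan_Suc
      by (rule E.finsum_insert[symmetric]) (use Suc.prems vk p_closed[OF e] in auto)
    finally show ?case .
  qed
  define \<beta> where "\<beta> k = (\<lambda>x\<in>carrier E. i x k)" for k
  have "\<beta> k \<in> carrier D" if "k < n" for k
    unfolding carrier_dual using that i_closed i_add i_lin by (auto simp: \<beta>_def)
  moreover have "x = (\<Oplus>\<^bsub>E\<^esub>k\<in>{..<n}. lact E (\<beta> k x) (p (e k)))" if x: "x \<in> carrier E" for x
  proof -
    have "tr (i x) n = i x"
      using i_closed[OF x] by (auto simp: tr_def fun_eq_iff PiE_def extensional_def)
    then show ?thesis using p_tr[OF i_closed[OF x], of n] pi[OF x] x by (simp add: \<beta>_def)
  qed
  ultimately have "dual_basis A E n (\<lambda>k. p (e k)) \<beta>"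
    unfolding dual_basis_def using p_closed e by simp
  then show ?thesis by blast
qed

text \<open>\<open>coev_one\<close> is a choice among the sums given by dual bases; as a dual basis
  exists, the chosen element comes from one, and that basis is exposed here.\<close>

lemma coev_one_dual_basis:
  assumes "left_fgp A E"
  obtains n b \<beta> where "dual_basis A E n b \<beta>"
    "coev_one A E = (\<Oplus>\<^bsub>DE.T\<^esub>i\<in>{..<n}. DE.tn (\<beta> i) (b i))"
proof -
  have "\<exists>t n b \<beta>. dual_basis A E n b \<beta> \<and> t = (\<Oplus>\<^bsub>DE.T\<^esub>i\<in>{..<n}. DE.tn (\<beta> i) (b i))"
    using dual_basis_exists[OF assms] by blast
  from someI_ex[OF this] show ?thesis using that unfolding coev_one_def by blast
qed

lemma coev_eq:
  assumes "left_fgp A E"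
  obtains n b \<beta> where "dual_basis A E n b \<beta>"
    "\<And>a. a \<in> carrier A \<Longrightarrow> coev A E a = (\<Oplus>\<^bsub>DE.T\<^esub>i\<in>{..<n}. DE.tn (lact D a (\<beta> i)) (b i))"
proof -
  obtain n b \<beta> where db: "dual_basis A E n b \<beta>"
    and c: "coev_one A E = (\<Oplus>\<^bsub>DE.T\<^esub>i\<in>{..<n}. DE.tn (\<beta> i) (b i))"
    by (rule coev_one_dual_basis[OF assms])
  interpret T: abelian_group DE.T by (rule DE.abelian_group_tensor)
  have b: "b i \<in> carrier E" "\<beta> i \<in> carrier D" if "i < n" for i
    using db that by (auto simp: dual_basis_def)
  have "coev A E a = (\<Oplus>\<^bsub>DE.T\<^esub>i\<in>{..<n}. DE.tn (lact D a (\<beta> i)) (b i))" if a: "a \<in> carrier A" for a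
  proof -
    have "coev A E a = (\<Oplus>\<^bsub>DE.T\<^esub>i\<in>{..<n}. lact DE.T a (DE.tn (\<beta> i) (b i)))"
      unfolding coev_def c
      by (rule add_hom_finsum[OF DE.abelian_group_tensor DE.abelian_group_tensor DE.tensor_lact(1)[OF a]])
        (use b in \<open>auto intro: DE.tens_closed\<close>)
    also have "\<dots> = (\<Oplus>\<^bsub>DE.T\<^esub>i\<in>{..<n}. DE.tn (lact D a (\<beta> i)) (b i))"
      by (rule T.finsum_cong') (use b a in \<open>auto simp: DE.tensor_lact(2) intro!: DE.tens_closed\<close>)
    finally show ?thesis .
  qed
  then show ?thesis using that db by blast
qed

end

subsection \<open>Weak left line modules\<close>

locale line_module = bimod_with_dual A L for A :: "(complex, 'a, 'm) module_scheme" (structure) and L :: "('a, 'l) bimod" +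
  assumes weak_line: "weak_left_line_module A L"
begin

lemma fgp: "left_fgp A L"
  using weak_line by (simp add: weak_left_line_module_def)

lemma coev_iso: "coev A L \<in> bimod_iso A (self_bimod A) DE.T"
  using weak_line by (simp add: weak_left_line_module_def)

lemma coev_bij: "bij_betw (coev A L) (carrier A) (carrier DE.T)"
  using coev_iso by (simp add: bimod_iso_def self_bimod_def)

lemma coev_hom:
  "\<lbrakk>a \<in> carrier A; b \<in> carrier A\<rbrakk> \<Longrightarrow> coev A L (a \<oplus> b) = coev A L a \<oplus>\<^bsub>DE.T\<^esub> coev A L b"
  "\<lbrakk>a \<in> carrier A; b \<in> carrier A\<rbrakk> \<Longrightarrow> coev A L (a \<otimes> b) = lact DE.T a (coev A L b)"
  "\<lbrakk>a \<in> carrier A; b \<in> carrier A\<rbrakk> \<Longrightarrow> coev A L (a \<otimes> b) = ract DE.T (coev A L a) b"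
  using coev_iso by (auto simp: bimod_iso_def bimod_hom_def left_hom_def self_bimod_def)

definition \<phi> :: "('l \<Rightarrow> 'a) \<Rightarrow> 'l \<Rightarrow> 'a" where
  "\<phi> = (\<lambda>\<alpha> x. coev_inv A L (tens A D L \<alpha> x))"

definition \<epsilon> :: "'l \<Rightarrow> ('l \<Rightarrow> 'a) \<Rightarrow> 'a" where
  "\<epsilon> = (\<lambda>x \<alpha>. ev A L (tens A L D x \<alpha>))"

lemma \<epsilon>_eq: "\<lbrakk>x \<in> carrier L; \<alpha> \<in> carrier D\<rbrakk> \<Longrightarrow> \<epsilon> x \<alpha> = \<alpha> x"
  by (simp add: \<epsilon>_def ev_tens)

text \<open>The working description of \<phi>: it solves an equation for \<open>coev\<close>, and
  \<open>coev_inj\<close> makes the solution unique.\<close>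

lemma coev_\<phi>:
  assumes "\<alpha> \<in> carrier D" "x \<in> carrier L"
  shows "\<phi> \<alpha> x \<in> carrier A" "coev A L (\<phi> \<alpha> x) = DE.tn \<alpha> x"
proof -
  have "DE.tn \<alpha> x \<in> coev A L ` carrier A"
    using coev_bij DE.tens_closed[OF assms] by (simp add: bij_betw_def)
  then show "\<phi> \<alpha> x \<in> carrier A" "coev A L (\<phi> \<alpha> x) = DE.tn \<alpha> x"
    unfolding \<phi>_def coev_inv_def by (rule inv_into_into, rule f_inv_into_f)
qed

lemma coev_inj: "\<lbrakk>a \<in> carrier A; b \<in> carrier A; coev A L a = coev A L b\<rbrakk> \<Longrightarrow> a = b"
  using coev_bij by (auto simp: bij_betw_def inj_on_def)

text \<open>The additive map that sends the tensor of \<gamma> and \<open>z\<close> to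
  \<open>lact L (\<gamma> x) z\<close> takes \<open>coev A L a\<close> to the dual basis expansion
  of \<open>ract L x a\<close>. At \<open>a = \<phi> \<alpha> y\<close> the element
  \<open>coev A L a\<close> is the simple tensor of \<alpha> and \<open>y\<close>, and the two
  values give the claim.\<close>

lemma lact_\<epsilon>_ract_\<phi>:
  assumes x: "x \<in> carrier L" and \<alpha>: "\<alpha> \<in> carrier D" and y: "y \<in> carrier L"
  shows "lact L (\<alpha> x) y = ract L x (\<phi> \<alpha> y)"
proof -
  let ?g = "\<lambda>(\<gamma>, z). lact L (\<gamma> x) z"
  have H: "induced L ?g \<in> add_hom DE.T L"
    and H_tn: "\<And>\<gamma> z. \<lbrakk>\<gamma> \<in> carrier D; z \<in> carrier L\<rbrakk> \<Longrightarrow> induced L ?g (DE.tn \<gamma> z) = lact L (\<gamma> x) z"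
    using DE.tensor_induced[OF E.abelian_group_axioms, of ?g]
    by (simp_all add: x dualD dual_apply act_plus act_add act_mult)
  obtain n b \<beta> where db: "dual_basis A L n b \<beta>"
    and c: "\<And>a. a \<in> carrier A \<Longrightarrow> coev A L a = (\<Oplus>\<^bsub>DE.T\<^esub>i\<in>{..<n}. DE.tn (lact D a (\<beta> i)) (b i))"
    by (rule coev_eq[OF fgp]) blast
  have b: "b i \<in> carrier L" "\<beta> i \<in> carrier D" if "i < n" for i
    using db that by (auto simp: dual_basis_def)
  have "induced L ?g (coev A L a) = ract L x a" if a: "a \<in> carrier A" for a
  proof -
    have "induced L ?g (coev A L a) = (\<Oplus>\<^bsub>L\<^esub>i\<in>{..<n}. induced L ?g (DE.tn (lact D a (\<beta> i)) (b i)))"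
      unfolding c[OF a]
      by (rule add_hom_finsum[OF DE.abelian_group_tensor E.abelian_group_axioms H])
        (use b a in \<open>auto intro!: DE.tens_closed\<close>)
    also have "\<dots> = (\<Oplus>\<^bsub>L\<^esub>i\<in>{..<n}. lact L (\<beta> i (ract L x a)) (b i))"
      by (rule E.finsum_cong') (use b a x in \<open>auto simp: H_tn dual_apply dualD\<close>)
    also have "\<dots> = ract L x a"
      using db a x by (simp add: dual_basis_def)
    finally show ?thesis .
  qed
  from this[of "\<phi> \<alpha> y"] show ?thesis
    using coev_\<phi>[OF \<alpha> y] H_tn[OF \<alpha> y] by simp
qed

text \<open>Evaluate at \<open>z\<close>: the left side is \<beta> at
  \<open>ract L z (\<phi> \<alpha> x)\<close>, which is \<open>lact L (\<alpha> z) x\<close> by the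
  previous identity, and \<beta> is left linear.\<close>

lemma lact_\<phi>_ract_\<epsilon>:
  assumes "\<alpha> \<in> carrier D" "x \<in> carrier L" "\<beta> \<in> carrier D"
  shows "lact D (\<phi> \<alpha> x) \<beta> = ract D \<alpha> (\<beta> x)"
  by (rule dual_eqI)
    (use assms coev_\<phi>(1)[OF assms(1,2)] in
      \<open>simp_all add: dual_simps lact_\<epsilon>_ract_\<phi>[symmetric]\<close>)

text \<open>\<open>coev A L a\<close> is a sum of tensors whose left factors are
  \<open>lact D a (\<beta> i)\<close>, so the action of \<open>a\<close> on the dual determines it,
  and \<open>coev\<close> is injective.\<close>

lemma lact_dual_faithful:
  assumes "a \<in> carrier A" "a' \<in> carrier A"
    and "\<And>\<beta>. \<beta> \<in> carrier D \<Longrightarrow> lact D a \<beta> = lact D a' \<beta>"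
  shows "a = a'"
proof (rule coev_inj[OF assms(1,2)])
  obtain n b \<beta> where db: "dual_basis A L n b \<beta>"
    and c: "\<And>a. a \<in> carrier A \<Longrightarrow> coev A L a = (\<Oplus>\<^bsub>DE.T\<^esub>i\<in>{..<n}. DE.tn (lact D a (\<beta> i)) (b i))"
    by (rule coev_eq[OF fgp]) blast
  interpret T: abelian_group DE.T by (rule DE.abelian_group_tensor)
  have b: "b i \<in> carrier L" "\<beta> i \<in> carrier D" if "i < n" for i
    using db that by (auto simp: dual_basis_def)
  show "coev A L a = coev A L a'"
    unfolding c[OF assms(1)] c[OF assms(2)]
    by (rule T.finsum_cong') (use b assms in \<open>auto intro!: DE.tens_closed\<close>)
qed

text \<open>Additivity and linearity of \<phi> are pulled back along the injective bimodule map
  \<open>coev\<close> from the corresponding rules for simple tensors; balancedness holds already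
  for the tensor to which \<open>coev_inv\<close> is applied.\<close>

sublocale pairing A L D \<epsilon> \<phi> Scal Pos Neg
proof unfold_locales
  show "inj Scal" "inj Pos" "inj Neg" by (simp_all add: inj_def)
next
  fix \<alpha> \<alpha>' x assume h: "\<alpha> \<in> carrier D" "\<alpha>' \<in> carrier D" "x \<in> carrier L"
  show "\<phi> (\<alpha> \<oplus>\<^bsub>D\<^esub> \<alpha>') x = \<phi> \<alpha> x \<oplus> \<phi> \<alpha>' x"
    by (rule coev_inj) (use h in \<open>simp_all add: coev_\<phi> coev_hom(1) DE.tens_add1\<close>)
next
  fix \<alpha> x x' assume h: "\<alpha> \<in> carrier D" "x \<in> carrier L" "x' \<in> carrier L"
  show "\<phi> \<alpha> (x \<oplus>\<^bsub>L\<^esub> x') = \<phi> \<alpha> x \<oplus> \<phi> \<alpha> x'"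
    by (rule coev_inj) (use h in \<open>simp_all add: coev_\<phi> coev_hom(1) DE.tens_add2\<close>)
next
  fix a \<alpha> x assume h: "a \<in> carrier A" "\<alpha> \<in> carrier D" "x \<in> carrier L"
  show "\<phi> (lact D a \<alpha>) x = a \<otimes> \<phi> \<alpha> x"
    by (rule coev_inj) (use h in \<open>simp_all add: coev_\<phi> coev_hom(2) DE.tensor_lact\<close>)
  show "\<phi> \<alpha> (ract L x a) = \<phi> \<alpha> x \<otimes> a"
    by (rule coev_inj) (use h in \<open>simp_all add: coev_\<phi> coev_hom(3) DE.tensor_ract\<close>)
  show "\<phi> (ract D \<alpha> a) x = \<phi> \<alpha> (lact L a x)"
    using h by (simp add: \<phi>_def DE.tens_bal)
qed (simp_all add: \<epsilon>_eq coev_\<phi>(1) dualD dual_apply lact_\<epsilon>_ract_\<phi> lact_\<phi>_ract_\<epsilon>)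

section \<open>Comparison with the prescribed powers and mixed products\<close>

lemma Lpow_eq: "Lpow A L n = M n"
  by (simp add: Lpow_def M_def)

lemma pos_word_eq: "pos_word A L xs = pw xs" and neg_word_eq: "neg_word A L ys = nw ys"
  by (simp_all add: pos_word_def neg_word_def pw_def swap.pw_def)

text \<open>The three branches of the prescribed product are the possible outcomes of cancelling
  letter by letter: nothing remains, a tail of \<open>ys\<close> remains, or a front part of
  \<open>xs\<close> remains.\<close>

lemma pos_neg_mult_eq:
  assumes "set xs \<subseteq> carrier L" "set ys \<subseteq> carrier D" "xs \<noteq> []" "ys \<noteq> []"
    and nm: "n = int (length xs)" "m = - int (length ys)"
  shows "pos_neg_mult A L xs ys = mul n m (pw xs) (nw ys)"
proof -
  have "nw ys \<in> carrier (M m)" using swap.pw_closed[of ys] assms by (simp add: M_swap)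
  then have mul: "mul n m (pw xs) (nw ys) = act (- int (length ys)) xs (nw ys)"
    using mul_pw[of xs "nw ys" m] assms by simp
  have e: "ev_pow A L = nested L \<epsilon>" by (simp add: ev_pow_def \<epsilon>_def)
  consider "length xs = length ys" | "length xs < length ys" | "length ys < length xs" by linarith
  then show ?thesis
  proof cases
    case 1
    obtain k where k: "length xs = Suc k" using assms(3) by (cases xs) simp_all
    have "nested L \<epsilon> (Suc k) xs ys \<in> carrier A"
      by (rule nested_closed[OF assms(1,2)]) (use 1 k in simp_all)
    then have "act (- int (length ys)) xs (nw ys) = Scal (nested L \<epsilon> (Suc k) xs ys)"
      using 1[symmetric] k act_nested[OF assms(1-3)] by (simp add: nw1_def)
    then show ?thesis unfolding mul using 1[symmetric] k by (simp add: pos_neg_mult_def e)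
  next
    case 2
    then show ?thesis unfolding mul using act_nested[OF assms(1-3)]
      by (simp add: pos_neg_mult_def e nw1_def Let_def Lpow_eq neg_word_eq)
  next
    case 3
    then show ?thesis unfolding mul using act_nested_long[OF assms(1,2,4) 3]
      by (simp add: pos_neg_mult_def e Let_def Lpow_eq pos_word_eq)
  qed
qed

lemma neg_pos_mult_eq:
  assumes "set xs \<subseteq> carrier L" "set ys \<subseteq> carrier D" "xs \<noteq> []" "ys \<noteq> []"
    and nm: "n = - int (length ys)" "m = int (length xs)"
  shows "neg_pos_mult A L ys xs = mul n m (nw ys) (pw xs)"
proof -
  have mul: "mul n m (nw ys) (pw xs) = swap.act (- int (length xs)) ys (pw xs)"
    using mul_nw[of ys "pw xs" m] pw_closed[of xs] assms by simp
  have e: "ev_tilde_pow A L = nested D \<phi>" by (simp add: ev_tilde_pow_def \<phi>_def)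
  consider "length ys = length xs" | "length ys < length xs" | "length xs < length ys" by linarith
  then show ?thesis
  proof cases
    case 1
    obtain k where k: "length ys = Suc k" using assms(4) by (cases ys) simp_all
    have "nested D \<phi> (Suc k) ys xs \<in> carrier A"
      by (rule swap.nested_closed[OF assms(2,1)]) (use 1 k in simp_all)
    then have "swap.act (- int (length xs)) ys (pw xs) = Scal (nested D \<phi> (Suc k) ys xs)"
      using 1[symmetric] k swap.act_nested[OF assms(2,1,4)] by (simp add: swap.nw1_def M_swap)
    then show ?thesis unfolding mul using 1[symmetric] k by (simp add: neg_pos_mult_def e)
  next
    case 2
    then show ?thesis unfolding mul using swap.act_nested[OF assms(2,1,4)]
      by (simp add: neg_pos_mult_def e swap.nw1_def Let_def Lpow_eq pos_word_eq M_swap)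
  next
    case 3
    then show ?thesis unfolding mul using swap.act_nested_long[OF assms(2,1,3) 3]
      by (simp add: neg_pos_mult_def e Let_def Lpow_eq neg_word_eq M_swap)
  qed
qed

end

subsection \<open>Direct sums of graded star algebras\<close>

text \<open>Separates the passage to the direct sum from the module theory: what has to be supplied
  are identities between homogeneous elements.\<close>

locale graded_star_algebra =
  fixes M :: "int \<Rightarrow> (complex, 'u, 'x) module_scheme" and \<mu> :: "int \<Rightarrow> int \<Rightarrow> 'u \<Rightarrow> 'u \<Rightarrow> 'u"
    and \<sigma> :: "int \<Rightarrow> 'u \<Rightarrow> 'u" and e :: 'u
  assumes module_M: "module complex_ring (M n)"
    and \<mu>_closed [simp]: "\<lbrakk>u \<in> carrier (M n); v \<in> carrier (M m)\<rbrakk> \<Longrightarrow> \<mu> n m u v \<in> carrier (M (n + m))"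
    and \<mu>_add1: "\<lbrakk>u \<in> carrier (M n); u' \<in> carrier (M n); v \<in> carrier (M m)\<rbrakk> \<Longrightarrow>
      \<mu> n m (u \<oplus>\<^bsub>M n\<^esub> u') v = \<mu> n m u v \<oplus>\<^bsub>M (n + m)\<^esub> \<mu> n m u' v"
    and \<mu>_add2: "\<lbrakk>u \<in> carrier (M n); v \<in> carrier (M m); v' \<in> carrier (M m)\<rbrakk> \<Longrightarrow>
      \<mu> n m u (v \<oplus>\<^bsub>M m\<^esub> v') = \<mu> n m u v \<oplus>\<^bsub>M (n + m)\<^esub> \<mu> n m u v'"
    and \<mu>_smult1: "\<lbrakk>u \<in> carrier (M n); v \<in> carrier (M m)\<rbrakk> \<Longrightarrow>
      \<mu> n m (c \<odot>\<^bsub>M n\<^esub> u) v = c \<odot>\<^bsub>M (n + m)\<^esub> \<mu> n m u v"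
    and \<mu>_smult2: "\<lbrakk>u \<in> carrier (M n); v \<in> carrier (M m)\<rbrakk> \<Longrightarrow>
      \<mu> n m u (c \<odot>\<^bsub>M m\<^esub> v) = c \<odot>\<^bsub>M (n + m)\<^esub> \<mu> n m u v"
    and \<mu>_assoc: "\<lbrakk>u \<in> carrier (M n); v \<in> carrier (M m); w \<in> carrier (M k)\<rbrakk> \<Longrightarrow>
      \<mu> (n + m) k (\<mu> n m u v) w = \<mu> n (m + k) u (\<mu> m k v w)"
    and e_closed [simp]: "e \<in> carrier (M 0)"
    and \<mu>_one1: "u \<in> carrier (M n) \<Longrightarrow> \<mu> 0 n e u = u"
    and \<mu>_one2: "u \<in> carrier (M n) \<Longrightarrow> \<mu> n 0 u e = u"
    and \<sigma>_closed [simp]: "u \<in> carrier (M n) \<Longrightarrow> \<sigma> n u \<in> carrier (M (- n))"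
    and \<sigma>_add: "\<lbrakk>u \<in> carrier (M n); v \<in> carrier (M n)\<rbrakk> \<Longrightarrow> \<sigma> n (u \<oplus>\<^bsub>M n\<^esub> v) = \<sigma> n u \<oplus>\<^bsub>M (- n)\<^esub> \<sigma> n v"
    and \<sigma>_smult: "u \<in> carrier (M n) \<Longrightarrow> \<sigma> n (c \<odot>\<^bsub>M n\<^esub> u) = cnj c \<odot>\<^bsub>M (- n)\<^esub> \<sigma> n u"
    and \<sigma>_\<sigma>: "u \<in> carrier (M n) \<Longrightarrow> \<sigma> (- n) (\<sigma> n u) = u"
    and \<sigma>_\<mu>: "\<lbrakk>u \<in> carrier (M n); v \<in> carrier (M m)\<rbrakk> \<Longrightarrow> \<sigma> (n + m) (\<mu> n m u v) = \<mu> (- m) (- n) (\<sigma> m v) (\<sigma> n u)"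
begin

sublocale M: module complex_ring "M n" for n by (rule module_M)

lemma smult_closed [simp]: "u \<in> carrier (M n) \<Longrightarrow> c \<odot>\<^bsub>M n\<^esub> u \<in> carrier (M n)"
  using M.smult_closed[of c] by simp

definition hom :: "int \<Rightarrow> 'u \<Rightarrow> int \<Rightarrow> 'u" where
  "hom n u = (\<lambda>k. if k = n then u else \<zero>\<^bsub>M k\<^esub>)"

definition total :: "(int \<Rightarrow> 'u) star_alg" where
  "total = \<lparr>carrier = carrier (sum_group UNIV (\<lambda>n. add_monoid (M n))),
      monoid.mult = (\<lambda>s t k. \<Oplus>\<^bsub>M k\<^esub>n\<in>{n. s n \<noteq> \<zero>\<^bsub>M n\<^esub> \<and> t (k - n) \<noteq> \<zero>\<^bsub>M (k - n)\<^esub>}.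
        \<mu> n (k - n) (s n) (t (k - n))),
      one = hom 0 e,
      zero = (\<lambda>n. \<zero>\<^bsub>M n\<^esub>),
      add = (\<lambda>s t n. s n \<oplus>\<^bsub>M n\<^esub> t n),
      module.smult = (\<lambda>c s n. c \<odot>\<^bsub>M n\<^esub> s n),
      star = (\<lambda>s n. \<sigma> (- n) (s (- n)))\<rparr>"

abbreviation "T \<equiv> carrier total"

abbreviation add_total (infixl \<open>\<boxplus>\<close> 65) where "s \<boxplus> t \<equiv> s \<oplus>\<^bsub>total\<^esub> t"

abbreviation mult_total (infixl \<open>\<boxtimes>\<close> 70) where "s \<boxtimes> t \<equiv> s \<otimes>\<^bsub>total\<^esub> t"

abbreviation smult_total (infixl \<open>\<boxdot>\<close> 70) where "c \<boxdot> s \<equiv> c \<odot>\<^bsub>total\<^esub> s"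

definition supp :: "(int \<Rightarrow> 'u) \<Rightarrow> int set" where
  "supp s = {n. s n \<noteq> \<zero>\<^bsub>M n\<^esub>}"

lemma carrier_total: "s \<in> T \<longleftrightarrow> (\<forall>n. s n \<in> carrier (M n)) \<and> finite (supp s)"
  by (simp add: total_def supp_def carrier_sum_group M.M.a_group PiE_iff)

lemma totalD: "s \<in> T \<Longrightarrow> s n \<in> carrier (M n)" "s \<in> T \<Longrightarrow> finite (supp s)"
  by (simp_all add: carrier_total)

lemma total_simps:
  "\<one>\<^bsub>total\<^esub> = hom 0 e" "\<zero>\<^bsub>total\<^esub> = (\<lambda>n. \<zero>\<^bsub>M n\<^esub>)" "s \<boxplus> t = (\<lambda>n. s n \<oplus>\<^bsub>M n\<^esub> t n)"
  "c \<boxdot> s = (\<lambda>n. c \<odot>\<^bsub>M n\<^esub> s n)" "star total s = (\<lambda>n. \<sigma> (- n) (s (- n)))"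
  by (simp_all add: total_def)

lemma hom_closed [simp]: "u \<in> carrier (M n) \<Longrightarrow> hom n u \<in> T"
  unfolding carrier_total
  by (auto simp: hom_def supp_def intro: finite_subset[of _ "{n}"])

lemma supp_add: "supp (\<lambda>n. s n \<oplus>\<^bsub>M n\<^esub> t n) \<subseteq> supp s \<union> supp t"
  by (auto simp: supp_def)

lemma add_total_closed [simp]: "\<lbrakk>s \<in> T; t \<in> T\<rbrakk> \<Longrightarrow> s \<boxplus> t \<in> T"
  unfolding carrier_total total_simps
  using finite_subset[OF supp_add[of s t]] by simp

lemma abelian_group_total: "abelian_group total"
proof (rule abelian_groupI)
  fix s assume s: "s \<in> T"
  have "supp (\<lambda>n. \<ominus>\<^bsub>M n\<^esub> s n) \<subseteq> supp s" by (auto simp: supp_def)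
  then have "(\<lambda>n. \<ominus>\<^bsub>M n\<^esub> s n) \<in> T"
    using s finite_subset by (auto simp: carrier_total)
  then show "\<exists>t\<in>T. t \<boxplus> s = \<zero>\<^bsub>total\<^esub>"
    using totalD(1)[OF s] by (intro bexI[of _ "\<lambda>n. \<ominus>\<^bsub>M n\<^esub> s n"]) (simp_all add: total_simps M.M.l_neg)
next
  show "\<zero>\<^bsub>total\<^esub> \<in> T" by (simp add: carrier_total total_simps supp_def)
next
  fix s t r assume "s \<in> T" "t \<in> T" "r \<in> T"
  then show "s \<boxplus> t \<boxplus> r = s \<boxplus> (t \<boxplus> r)"
    by (simp add: total_simps totalD(1) M.M.a_assoc)
next
  fix s t assume "s \<in> T" "t \<in> T"
  then show "s \<boxplus> t = t \<boxplus> s"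
    by (simp add: total_simps totalD(1) M.M.a_comm)
next
  fix s assume "s \<in> T"
  then show "\<zero>\<^bsub>total\<^esub> \<boxplus> s = s"
    by (simp add: total_simps totalD(1))
qed simp

text \<open>Finite support lets one degree be split off at a time, so laws that are additive in each
  argument need checking on homogeneous elements only.\<close>

lemma total_induct [consumes 1, case_names hom add]:
  assumes "s \<in> T"
    and hom: "\<And>n u. u \<in> carrier (M n) \<Longrightarrow> Q (hom n u)"
    and add: "\<And>s t. \<lbrakk>s \<in> T; t \<in> T; Q s; Q t\<rbrakk> \<Longrightarrow> Q (s \<boxplus> t)"
  shows "Q s"
proof -
  have "Q s" if "finite F" "supp s \<subseteq> F" "s \<in> T" for F s
    using that
  proof (induction F arbitrary: s rule: finite_induct)
    case empty
    \<comment> \<open>The rule has no case for zero, which is therefore taken as a homogeneous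
      element of degree 0.\<close>
    then have "s = hom 0 \<zero>\<^bsub>M 0\<^esub>" by (auto simp: hom_def supp_def fun_eq_iff)
    then show ?case using hom[of "\<zero>\<^bsub>M 0\<^esub>" 0] by simp
  next
    case (insert k F)
    define t where "t = (\<lambda>n. if n = k then \<zero>\<^bsub>M n\<^esub> else s n)"
    have t_supp: "supp t \<subseteq> F" using insert.prems(1) by (auto simp: t_def supp_def)
    have t: "t \<in> T"
      unfolding carrier_total
      using totalD(1)[OF insert.prems(2)] finite_subset[OF t_supp insert.hyps(1)] by (simp add: t_def)
    have "s = t \<boxplus> hom k (s k)"
      using totalD(1)[OF insert.prems(2)] by (auto simp: total_simps t_def hom_def fun_eq_iff)
    moreover have "Q (t \<boxplus> hom k (s k))"
      by (rule add[OF t _ insert.IH[OF t_supp t]]) (use hom totalD(1)[OF insert.prems(2)] in simp_all)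
    ultimately show ?case by simp
  qed
  then show ?thesis using assms(1) totalD(2)[OF assms(1)] by blast
qed

text \<open>The scalar laws at the complex number 0.\<close>

lemma \<mu>_zero [simp]:
  "v \<in> carrier (M m) \<Longrightarrow> \<mu> n m \<zero>\<^bsub>M n\<^esub> v = \<zero>\<^bsub>M (n + m)\<^esub>"
  "u \<in> carrier (M n) \<Longrightarrow> \<mu> n m u \<zero>\<^bsub>M m\<^esub> = \<zero>\<^bsub>M (n + m)\<^esub>"
  using \<mu>_smult1[of "\<zero>\<^bsub>M n\<^esub>" n v m 0] \<mu>_smult2[of u n "\<zero>\<^bsub>M m\<^esub>" m 0]
    M.smult_l_null[of "\<zero>\<^bsub>M n\<^esub>"] M.smult_l_null[of "\<zero>\<^bsub>M m\<^esub>"]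
    M.smult_l_null[of "\<mu> n m \<zero>\<^bsub>M n\<^esub> v" "n + m"] M.smult_l_null[of "\<mu> n m u \<zero>\<^bsub>M m\<^esub>" "n + m"]
  by simp_all

section \<open>The product on the direct sum\<close>

lemma \<mu>_term [simp]:
  "\<lbrakk>s \<in> T; t \<in> T\<rbrakk> \<Longrightarrow> \<mu> n (k - n) (s n) (t (k - n)) \<in> carrier (M k)"
  using \<mu>_closed[of "s n" n "t (k - n)" "k - n"] by (simp add: totalD(1))

text \<open>The index set in the definition of the product depends on both factors. Replacing it by
  a finite set that contains the support of the first factor lets sums for different factors be
  compared term by term.\<close>

lemma mult_total:
  assumes s: "s \<in> T" and t: "t \<in> T" and K: "finite K" "supp s \<subseteq> K"
  shows "(s \<boxtimes> t) k = (\<Oplus>\<^bsub>M k\<^esub>n\<in>K. \<mu> n (k - n) (s n) (t (k - n)))"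
proof -
  have z: "\<mu> n (k - n) (s n) (t (k - n)) = \<zero>\<^bsub>M k\<^esub>"
    if "s n = \<zero>\<^bsub>M n\<^esub> \<or> t (k - n) = \<zero>\<^bsub>M (k - n)\<^esub>" for n
    using that \<mu>_zero(1)[of "t (k - n)" "k - n" n] \<mu>_zero(2)[of "s n" n "k - n"] totalD(1)[OF s] totalD(1)[OF t]
    by auto
  have "(s \<boxtimes> t) k = (\<Oplus>\<^bsub>M k\<^esub>n\<in>{n. s n \<noteq> \<zero>\<^bsub>M n\<^esub> \<and> t (k - n) \<noteq> \<zero>\<^bsub>M (k - n)\<^esub>}. \<mu> n (k - n) (s n) (t (k - n)))"
    by (simp add: total_def)
  also have "\<dots> = (\<Oplus>\<^bsub>M k\<^esub>n\<in>K. \<mu> n (k - n) (s n) (t (k - n)))"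
    by (rule M.M.add.finprod_mono_neutral_cong_left) (use K z s t in \<open>auto simp: supp_def\<close>)
  finally show ?thesis .
qed

lemma mult_total_closed [simp]:
  assumes s: "s \<in> T" and t: "t \<in> T"
  shows "s \<boxtimes> t \<in> T"
  unfolding carrier_total
proof (intro conjI allI)
  note m = mult_total[OF s t totalD(2)[OF s] order_refl]
  show "(s \<boxtimes> t) k \<in> carrier (M k)" for k
    unfolding m using s t by (intro M.M.finsum_closed) auto
  have "supp (s \<boxtimes> t) \<subseteq> (\<lambda>(n, m). n + m) ` (supp s \<times> supp t)"
  proof
    fix k assume k: "k \<in> supp (s \<boxtimes> t)"
    let ?N = "{n. s n \<noteq> \<zero>\<^bsub>M n\<^esub> \<and> t (k - n) \<noteq> \<zero>\<^bsub>M (k - n)\<^esub>}"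
    have e: "(s \<boxtimes> t) k = (\<Oplus>\<^bsub>M k\<^esub>n\<in>?N. \<mu> n (k - n) (s n) (t (k - n)))"
      by (simp add: total_def)
    have "?N \<noteq> {}"
    proof
      assume N: "{n. s n \<noteq> \<zero>\<^bsub>M n\<^esub> \<and> t (k - n) \<noteq> \<zero>\<^bsub>M (k - n)\<^esub>} = {}"
      have "(s \<boxtimes> t) k = \<zero>\<^bsub>M k\<^esub>" unfolding e N by simp
      then show False using k by (simp add: supp_def)
    qed
    then obtain n where "n \<in> supp s" "k - n \<in> supp t" by (auto simp: supp_def)
    then show "k \<in> (\<lambda>(n, m). n + m) ` (supp s \<times> supp t)" by force
  qed
  then show "finite (supp (s \<boxtimes> t))"
    using finite_subset totalD(2)[OF s] totalD(2)[OF t] by blast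
qed

lemma total_l_distr:
  assumes s: "s \<in> T" and s': "s' \<in> T" and t: "t \<in> T"
  shows "(s \<boxplus> s') \<boxtimes> t = (s \<boxtimes> t) \<boxplus> (s' \<boxtimes> t)"
proof
  fix k
  have K: "finite (supp s \<union> supp s')" using s s' by (simp add: totalD(2))
  have "\<mu> n (k - n) (s n \<oplus>\<^bsub>M n\<^esub> s' n) (t (k - n)) =
      \<mu> n (k - n) (s n) (t (k - n)) \<oplus>\<^bsub>M k\<^esub> \<mu> n (k - n) (s' n) (t (k - n))" for n
    using \<mu>_add1[of "s n" n "s' n" "t (k - n)" "k - n"] s s' t by (simp add: totalD(1))
  then show "((s \<boxplus> s') \<boxtimes> t) k = ((s \<boxtimes> t) \<boxplus> (s' \<boxtimes> t)) k"
    using mult_total[OF add_total_closed[OF s s'] t K, of k] mult_total[OF s t K, of k]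
      mult_total[OF s' t K, of k] supp_add[of s s'] s s' t
    by (simp add: total_simps M.M.finsum_addf)
qed

lemma total_r_distr:
  assumes s: "s \<in> T" and t: "t \<in> T" and t': "t' \<in> T"
  shows "s \<boxtimes> (t \<boxplus> t') = (s \<boxtimes> t) \<boxplus> (s \<boxtimes> t')"
proof
  fix k
  note K = totalD(2)[OF s] order_refl
  have "\<mu> n (k - n) (s n) (t (k - n) \<oplus>\<^bsub>M (k - n)\<^esub> t' (k - n)) =
      \<mu> n (k - n) (s n) (t (k - n)) \<oplus>\<^bsub>M k\<^esub> \<mu> n (k - n) (s n) (t' (k - n))" for n
    using \<mu>_add2[of "s n" n "t (k - n)" "k - n" "t' (k - n)"] s t t' by (simp add: totalD(1))
  then show "(s \<boxtimes> (t \<boxplus> t')) k = ((s \<boxtimes> t) \<boxplus> (s \<boxtimes> t')) k"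
    using mult_total[OF s add_total_closed[OF t t'] K, of k] mult_total[OF s t K, of k]
      mult_total[OF s t' K, of k] s t t'
    by (simp add: total_simps M.M.finsum_addf)
qed

lemma hom_mult:
  assumes u: "u \<in> carrier (M n)" and v: "v \<in> carrier (M m)"
  shows "hom n u \<boxtimes> hom m v = hom (n + m) (\<mu> n m u v)"
proof
  fix k
  have sn: "supp (hom n u) \<subseteq> {n}" by (auto simp: supp_def hom_def)
  have c: "\<mu> n (k - n) u (hom m v (k - n)) \<in> carrier (M k)"
    using \<mu>_term[OF hom_closed[OF u] hom_closed[OF v], of n k] by (simp add: hom_def)
  have "(hom n u \<boxtimes> hom m v) k = (\<Oplus>\<^bsub>M k\<^esub>i\<in>{n}. \<mu> i (k - i) (hom n u i) (hom m v (k - i)))"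
    by (rule mult_total[OF _ _ _ sn]) (use u v in simp_all)
  also have "\<dots> = \<mu> n (k - n) u (hom m v (k - n))"
    using c by (simp add: hom_def M.M.finsum_insert)
  also have "\<dots> = hom (n + m) (\<mu> n m u v) k"
  proof (cases "k = n + m")
    case False
    then show ?thesis using \<mu>_zero(2)[OF u, of "k - n"] by (auto simp: hom_def)
  qed (simp add: hom_def)
  finally show "(hom n u \<boxtimes> hom m v) k = hom (n + m) (\<mu> n m u v) k" .
qed

text \<open>Distributivity reduces the claim to three homogeneous elements, where it is
  \<open>\<mu>_assoc\<close>; this avoids reindexing a double sum.\<close>

lemma total_assoc:
  assumes "s \<in> T" "t \<in> T" "r \<in> T"
  shows "(s \<boxtimes> t) \<boxtimes> r = s \<boxtimes> (t \<boxtimes> r)"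
  using assms(1)
proof (induction s rule: total_induct)
  case (hom n u)
  show ?case using assms(2)
  proof (induction t rule: total_induct)
    case (hom m v)
    show ?case using assms(3)
    proof (induction r rule: total_induct)
      case w: (hom k w)
      then show ?case
        using \<open>u \<in> carrier (M n)\<close> \<open>v \<in> carrier (M m)\<close> by (simp add: hom_mult \<mu>_assoc add.assoc)
    next
      case (add r r')
      then show ?case
        using \<open>u \<in> carrier (M n)\<close> \<open>v \<in> carrier (M m)\<close> by (simp add: total_r_distr)
    qed
  next
    case (add t t')
    then show ?case
      using \<open>u \<in> carrier (M n)\<close> assms(3) by (simp add: total_r_distr total_l_distr)
  qed
next
  case (add s s')
  then show ?case using assms by (simp add: total_l_distr)
qed

lemma total_one:
  assumes "s \<in> T"
  shows "\<one>\<^bsub>total\<^esub> \<boxtimes> s = s" "s \<boxtimes> \<one>\<^bsub>total\<^esub> = s"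
  using assms
  by (induction s rule: total_induct)
    (simp_all add: total_simps(1) total_l_distr total_r_distr hom_mult \<mu>_one1 \<mu>_one2)

lemma ring_total: "ring total"
proof (rule ringI)
  show "monoid total"
    by (rule monoidI) (simp_all add: total_assoc total_one, simp add: total_simps(1))
qed (simp_all add: abelian_group_total total_l_distr total_r_distr)

lemma supp_smult: "supp (\<lambda>n. c \<odot>\<^bsub>M n\<^esub> s n) \<subseteq> supp s"
  using M.smult_r_null[of c] by (auto simp: supp_def)

lemma smult_total_closed [simp]: "s \<in> T \<Longrightarrow> c \<boxdot> s \<in> T"
  unfolding carrier_total total_simps
  using finite_subset[OF supp_smult[of c s]] by simp

lemma module_total: "module complex_ring total"
proof (rule moduleI)
  fix c d s t assume s: "s \<in> T"
  show "(c \<oplus>\<^bsub>complex_ring\<^esub> d) \<boxdot> s = c \<boxdot> s \<boxplus> d \<boxdot> s"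
    using M.smult_l_distr[of c d] totalD(1)[OF s] by (simp add: total_simps)
  show "(c \<otimes>\<^bsub>complex_ring\<^esub> d) \<boxdot> s = c \<boxdot> (d \<boxdot> s)"
    using M.smult_assoc1[of c d] totalD(1)[OF s] by (simp add: total_simps)
  show "\<one>\<^bsub>complex_ring\<^esub> \<boxdot> s = s"
    using M.smult_one totalD(1)[OF s] by (simp add: total_simps)
  show "c \<boxdot> (s \<boxplus> t) = c \<boxdot> s \<boxplus> c \<boxdot> t" if t: "t \<in> T"
    using M.smult_r_distr[of c] totalD(1)[OF s] totalD(1)[OF t] by (simp add: total_simps)
qed (simp_all add: cring_complex_ring abelian_group_total)

lemma smult_hom: "u \<in> carrier (M n) \<Longrightarrow> c \<boxdot> hom n u = hom n (c \<odot>\<^bsub>M n\<^esub> u)"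
  using M.smult_r_null[of c] by (auto simp: total_simps hom_def fun_eq_iff)

lemma smult_total_add:
  "\<lbrakk>s \<in> T; t \<in> T\<rbrakk> \<Longrightarrow> c \<boxdot> (s \<boxplus> t) = c \<boxdot> s \<boxplus> c \<boxdot> t"
  using module.smult_r_distr[OF module_total, of c] by simp

lemma smult_total_mult:
  assumes "s \<in> T" "t \<in> T"
  shows "(c \<boxdot> s) \<boxtimes> t = c \<boxdot> (s \<boxtimes> t) \<and>
    s \<boxtimes> (c \<boxdot> t) = c \<boxdot> (s \<boxtimes> t)"
  using assms(1)
proof (induction s rule: total_induct)
  case (hom n u)
  show ?case using assms(2)
  proof (induction t rule: total_induct)
    case (hom m v)
    then show ?case
      using \<open>u \<in> carrier (M n)\<close> by (simp add: smult_hom hom_mult \<mu>_smult1 \<mu>_smult2)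
  next
    case (add t t')
    then show ?case using \<open>u \<in> carrier (M n)\<close> by (simp add: total_r_distr smult_total_add)
  qed
next
  case (add s s')
  then show ?case using assms(2) by (simp add: total_l_distr smult_total_add)
qed

section \<open>The star on the direct sum\<close>

lemma \<sigma>_zero [simp]: "\<sigma> n \<zero>\<^bsub>M n\<^esub> = \<zero>\<^bsub>M (- n)\<^esub>"
  using \<sigma>_smult[of "\<zero>\<^bsub>M n\<^esub>" n 0] M.smult_l_null[of "\<zero>\<^bsub>M n\<^esub>" n]
    M.smult_l_null[of "\<sigma> n \<zero>\<^bsub>M n\<^esub>" "- n"] by simp

lemma \<sigma>_zero' [simp]: "\<sigma> (- n) \<zero>\<^bsub>M (- n)\<^esub> = \<zero>\<^bsub>M n\<^esub>"
  using \<sigma>_zero[of "- n"] by simp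

lemma star_total_closed [simp]:
  assumes s: "s \<in> T" shows "star total s \<in> T"
proof -
  have "supp (\<lambda>n. \<sigma> (- n) (s (- n))) \<subseteq> uminus ` supp s"
  proof
    fix n assume "n \<in> supp (\<lambda>n. \<sigma> (- n) (s (- n)))"
    then have "- n \<in> supp s" by (auto simp: supp_def)
    then show "n \<in> uminus ` supp s" by force
  qed
  then have "finite (supp (\<lambda>n. \<sigma> (- n) (s (- n))))"
    using totalD(2)[OF s] finite_subset by blast
  moreover have "\<sigma> (- n) (s (- n)) \<in> carrier (M n)" for n
    using \<sigma>_closed[of "s (- n)" "- n"] totalD(1)[OF s] by simp
  ultimately show ?thesis by (simp add: carrier_total total_simps)
qed

lemma star_total_add:
  assumes "s \<in> T" "t \<in> T"
  shows "star total (s \<boxplus> t) = star total s \<boxplus> star total t"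
proof
  fix n
  show "star total (s \<boxplus> t) n = (star total s \<boxplus> star total t) n"
    using \<sigma>_add[of "s (- n)" "- n" "t (- n)"] assms by (simp add: total_simps totalD(1))
qed

lemma star_hom: "star total (hom n u) = hom (- n) (\<sigma> n u)"
  by (auto simp: total_simps hom_def fun_eq_iff)

lemma star_total_mult:
  assumes "s \<in> T" "t \<in> T"
  shows "star total (s \<boxtimes> t) = star total t \<boxtimes> star total s"
  using assms(1)
proof (induction s rule: total_induct)
  case (hom n u)
  show ?case using assms(2)
  proof (induction t rule: total_induct)
    case (hom m v)
    have "- (n + m) = - m + - n" by simp
    then show ?case
      using \<open>u \<in> carrier (M n)\<close> \<open>v \<in> carrier (M m)\<close>
      by (simp only: hom_mult star_hom \<sigma>_\<mu> \<sigma>_closed)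
  next
    case (add t t')
    then show ?case
      using \<open>u \<in> carrier (M n)\<close> by (simp add: total_l_distr total_r_distr star_total_add)
  qed
next
  case (add s s')
  then show ?case using assms(2) by (simp add: total_l_distr total_r_distr star_total_add)
qed

lemma star_algebra_total: "star_algebra total"
proof -
  have "star total (c \<boxdot> s) = cnj c \<boxdot> star total s" if "s \<in> T" for c s
  proof
    fix n
    show "star total (c \<boxdot> s) n = (cnj c \<boxdot> star total s) n"
      using \<sigma>_smult[of "s (- n)" "- n" c] that by (simp add: total_simps totalD(1))
  qed
  moreover have "star total (star total s) = s" if "s \<in> T" for s
    using \<sigma>_\<sigma> that by (simp add: total_simps totalD(1))
  ultimately show ?thesis
    unfolding star_algebra_def complex_algebra_def
    by (simp add: ring_total module_total smult_total_mult star_total_add star_total_mult)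
qed

end

subsection \<open>Products and stars of homogeneous elements\<close>

context pairing
begin

lemma induced_pw_eq:
  assumes T: "abelian_group T" and h: "h \<in> add_hom (M (1 + int k)) T"
    and f: "\<And>xs. \<lbrakk>xs \<noteq> []; set xs \<subseteq> carrier P; length xs = Suc k\<rbrakk> \<Longrightarrow> f xs = h (pw xs)"
    and V: "V \<in> carrier (tpow A P (Suc k))"
  shows "induced T f V = h (CP V)"
proof (rule P.tpow_induced_eq[OF T _ _ V])
  show "(\<lambda>V. h (CP V)) \<in> add_hom (tpow A P (Suc k)) T"
    using add_hom_compose[OF relabel_hom[OF inj_CP], of h "tpow A P (Suc k)"] h by (simp add: M_pos)
  show "f xs = h (CP (word_tens A P xs))" if "xs \<in> words P (Suc k)" for xs
    using f[of xs] that by (cases xs) (auto simp: words_def pw_def)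
qed

text \<open>Resolves the outer \<open>induced\<close> in a product of two tensor powers;
  \<open>induced_mul2\<close> resolves the inner one, with the outer word held fixed.\<close>

lemma induced_mul1:
  assumes n: "n = 1 + int k" and U: "U \<in> carrier (tpow A P (Suc k))" and v: "v \<in> carrier (M m)"
    and f: "\<And>xs. \<lbrakk>xs \<noteq> []; set xs \<subseteq> carrier P; length xs = Suc k\<rbrakk> \<Longrightarrow> f xs = mul n m (pw xs) v"
  shows "induced (M (n + m)) f U = mul n m (CP U) v"
  by (rule induced_pw_eq[OF M.abelian_group_E _ _ U]) (use mul_hom1[OF v, of n] n f in simp_all)

lemma induced_mul2:
  assumes m: "m = 1 + int k" and V: "V \<in> carrier (tpow A P (Suc k))" and u: "u \<in> carrier (M n)"
    and f: "\<And>xs. \<lbrakk>xs \<noteq> []; set xs \<subseteq> carrier P; length xs = Suc k\<rbrakk> \<Longrightarrow> f xs = mul n m u (pw xs)"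
  shows "induced (M (n + m)) f V = mul n m u (CP V)"
  by (rule induced_pw_eq[OF M.abelian_group_E _ _ V]) (use mul_hom2[OF u, of m] m f in simp_all)

lemma M_pos_elem:
  assumes "u \<in> carrier (M n)" "n = 1 + int k"
  obtains U where "u = CP U" "U \<in> carrier (tpow A P (Suc k))"
  using assms by (auto simp: M_pos relabel_simps[OF inj_CP])

lemma pw_degree: "\<lbrakk>xs \<noteq> []; set xs \<subseteq> carrier P; n = int (length xs)\<rbrakk> \<Longrightarrow> pw xs \<in> carrier (M n)"
  by simp

end

context line_module
begin

lemma induced_mul1':
  assumes "n = - (1 + int k)" "U \<in> carrier (tpow A D (Suc k))" "v \<in> carrier (M m)"
    and "\<And>ys. \<lbrakk>ys \<noteq> []; set ys \<subseteq> carrier D; length ys = Suc k\<rbrakk> \<Longrightarrow> f ys = mul n m (nw ys) v"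
  shows "induced (M (n + m)) f U = mul n m (Neg U) v"
proof -
  have "- n = 1 + int k" using assms(1) by simp
  from swap.induced_mul1[OF this, of U v "- m" f] show ?thesis
    using assms(2-4) by (simp add: M_swap mul_swap add.commute)
qed

lemma induced_mul2':
  assumes "m = - (1 + int k)" "V \<in> carrier (tpow A D (Suc k))" "u \<in> carrier (M n)"
    and "\<And>ys. \<lbrakk>ys \<noteq> []; set ys \<subseteq> carrier D; length ys = Suc k\<rbrakk> \<Longrightarrow> f ys = mul n m u (nw ys)"
  shows "induced (M (n + m)) f V = mul n m u (Neg V)"
proof -
  have "- m = 1 + int k" using assms(1) by simp
  from swap.induced_mul2[OF this, of V u "- n" f] show ?thesis
    using assms(2-4) by (simp add: M_swap mul_swap add.commute)
qed

lemma M_neg_elem: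
  assumes "u \<in> carrier (M n)" "n = - (1 + int k)"
  obtains U where "u = Neg U" "U \<in> carrier (tpow A D (Suc k))"
proof -
  have n: "- n = 1 + int k" using assms(2) by simp
  have "u \<in> carrier (swap.M (- n))" using assms(1) by (simp add: M_swap)
  then show ?thesis using swap.M_pos_elem[OF _ n] that by blast
qed

lemma nw_degree: "\<lbrakk>ys \<noteq> []; set ys \<subseteq> carrier D; n = - int (length ys)\<rbrakk> \<Longrightarrow> nw ys \<in> carrier (M n)"
  using swap.pw_degree[of ys "- n"] by (simp add: M_swap)

lemma mul_nw_nw:
  assumes "xs \<noteq> []" "set xs \<subseteq> carrier D" "ys \<noteq> []" "set ys \<subseteq> carrier D"
    and "n = - int (length xs)" "m = - int (length ys)"
  shows "mul n m (nw xs) (nw ys) = nw (xs @ ys)"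
  using swap.mul_pw_pw[of xs ys "- n" "- m"] assms by (simp add: mul_swap)

text \<open>As \<open>mul\<close> is already known to be additive in each argument, the nested
  \<open>induced\<close> maps coincide with it as soon as the values on pairs of words do;
  balancedness of the prescribed functions is inherited from \<open>mul\<close>.\<close>

lemma comp_mult_eq:
  assumes u: "u \<in> carrier (M n)" and v: "v \<in> carrier (M m)"
  shows "comp_mult A L n m u v = mul n m u v"
proof (cases n rule: M_cases)
  case 1
  then obtain a where "u = Scal a" "a \<in> carrier A" using u by (auto simp: carrier_M_zero)
  then show ?thesis by (simp add: 1 Lpow_eq)
next
  case n: (2 k)
  obtain U where U: "u = Pos U" "U \<in> carrier (tpow A L (Suc k))"
    by (rule M_pos_elem[OF u n])
  show ?thesis
  proof (cases m rule: M_cases)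
    case 1
    then obtain b where "v = Scal b" "b \<in> carrier A" using v by (auto simp: carrier_M_zero)
    then show ?thesis using U mul_S_right[OF u] by (simp add: 1 Lpow_eq)
  next
    case m: (2 j)
    obtain V where V: "v = Pos V" "V \<in> carrier (tpow A L (Suc j))"
      by (rule M_pos_elem[OF v m])
    have "induced (M (n + m)) (\<lambda>xs. induced (M (n + m)) (\<lambda>ys. pos_word A L (xs @ ys)) V) U = mul n m (Pos U) (Pos V)"
      by (intro induced_mul1[OF n U(2) v[unfolded V(1)]] induced_mul2[OF m V(2)] pw_degree)
        (use n m in \<open>simp_all add: pos_word_eq mul_pw_pw\<close>)
    then show ?thesis by (simp add: U V Lpow_eq)
  next
    case m: (3 j)
    obtain V where V: "v = Neg V" "V \<in> carrier (tpow A D (Suc j))"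
      by (rule M_neg_elem[OF v m])
    have "induced (M (n + m)) (\<lambda>xs. induced (M (n + m)) (\<lambda>ys. pos_neg_mult A L xs ys) V) U = mul n m (Pos U) (Neg V)"
      by (intro induced_mul1[OF n U(2) v[unfolded V(1)]] induced_mul2'[OF m V(2)] pw_degree pos_neg_mult_eq)
        (use n m in simp_all)
    then show ?thesis by (simp add: U V Lpow_eq)
  qed
next
  case n: (3 k)
  obtain U where U: "u = Neg U" "U \<in> carrier (tpow A D (Suc k))"
    by (rule M_neg_elem[OF u n])
  show ?thesis
  proof (cases m rule: M_cases)
    case 1
    then obtain b where "v = Scal b" "b \<in> carrier A" using v by (auto simp: carrier_M_zero)
    then show ?thesis using U mul_S_right[OF u] by (simp add: 1 Lpow_eq)
  next
    case m: (2 j)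
    obtain V where V: "v = Pos V" "V \<in> carrier (tpow A L (Suc j))"
      by (rule M_pos_elem[OF v m])
    have "induced (M (n + m)) (\<lambda>xs. induced (M (n + m)) (\<lambda>ys. neg_pos_mult A L xs ys) V) U = mul n m (Neg U) (Pos V)"
      by (intro induced_mul1'[OF n U(2) v[unfolded V(1)]] induced_mul2[OF m V(2)] nw_degree neg_pos_mult_eq)
        (use n m in simp_all)
    then show ?thesis by (simp add: U V Lpow_eq)
  next
    case m: (3 j)
    obtain V where V: "v = Neg V" "V \<in> carrier (tpow A D (Suc j))"
      by (rule M_neg_elem[OF v m])
    have "induced (M (n + m)) (\<lambda>xs. induced (M (n + m)) (\<lambda>ys. neg_word A L (xs @ ys)) V) U = mul n m (Neg U) (Neg V)"
      by (intro induced_mul1'[OF n U(2) v[unfolded V(1)]] induced_mul2'[OF m V(2)] nw_degree)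
        (use n m in \<open>simp_all add: neg_word_eq mul_nw_nw\<close>)
    then show ?thesis by (simp add: U V Lpow_eq)
  qed
qed

end

section \<open>Hermitian structures on a weak left line module\<close>

locale hermitian_line_module = line_module A L
  for A :: "('a, 'm) star_alg_scheme" (structure) and L :: "('a, 'l) bimod" +
  fixes G :: "'l \<Rightarrow> 'l \<Rightarrow> 'a"
  assumes star_alg: "star_algebra A" and hermitian: "nondegenerate_hermitian A L G"
begin

definition Ginv :: "('l \<Rightarrow> 'a) \<Rightarrow> 'l" where
  "Ginv = inv_into (carrier L) G"

lemma star_A:
  "a \<in> carrier A \<Longrightarrow> star A a \<in> carrier A"
  "\<lbrakk>a \<in> carrier A; b \<in> carrier A\<rbrakk> \<Longrightarrow> star A (a \<oplus> b) = star A a \<oplus> star A b"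
  "\<lbrakk>a \<in> carrier A; b \<in> carrier A\<rbrakk> \<Longrightarrow> star A (a \<otimes> b) = star A b \<otimes> star A a"
  "a \<in> carrier A \<Longrightarrow> star A (star A a) = a"
  "a \<in> carrier A \<Longrightarrow> star A (c \<odot> a) = cnj c \<odot> star A a"
  using star_alg by (simp_all add: star_algebra_def)

lemma G_iso: "G \<in> bimod_iso A (conj_bimod A L) D"
  using hermitian by (simp add: nondegenerate_hermitian_def)

lemma G_bij: "bij_betw G (carrier L) (carrier D)"
  using G_iso by (simp add: bimod_iso_def conj_bimod_def)

lemma G_closed: "x \<in> carrier L \<Longrightarrow> G x \<in> carrier D"
  by (rule bij_betw_apply[OF G_bij])

lemma G_add: "\<lbrakk>x \<in> carrier L; y \<in> carrier L\<rbrakk> \<Longrightarrow> G (x \<oplus>\<^bsub>L\<^esub> y) = G x \<oplus>\<^bsub>D\<^esub> G y"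
  using G_iso by (simp add: bimod_iso_def bimod_hom_def left_hom_def conj_bimod_def)

lemma G_ract:
  assumes "a \<in> carrier A" "x \<in> carrier L" shows "G (ract L x a) = lact D (star A a) (G x)"
proof -
  \<comment> \<open>The left action of \<open>b\<close> on the conjugate bimodule is the right
    action of \<open>star A b\<close>. Taking \<open>b\<close> to be a star then yields the form
    wanted.\<close>
  have "G (ract L x (star A b)) = lact D b (G x)" if "b \<in> carrier A" for b
    using G_iso that assms(2) by (simp add: bimod_iso_def bimod_hom_def left_hom_def conj_bimod_def)
  from this[of "star A a"] show ?thesis using assms by (simp add: star_A)
qed

lemma G_lact:
  assumes "a \<in> carrier A" "x \<in> carrier L" shows "G (lact L a x) = ract D (G x) (star A a)"
proof -
  have "G (lact L (star A b) x) = ract D (G x) b" if "b \<in> carrier A" for b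
    using G_iso that assms(2) by (simp add: bimod_iso_def bimod_hom_def conj_bimod_def)
  from this[of "star A a"] show ?thesis using assms by (simp add: star_A)
qed

lemma Ginv_G: "x \<in> carrier L \<Longrightarrow> Ginv (G x) = x"
  unfolding Ginv_def by (rule bij_betw_inv_into_left[OF G_bij])

lemma Ginv_closed: "\<alpha> \<in> carrier D \<Longrightarrow> Ginv \<alpha> \<in> carrier L"
  unfolding Ginv_def by (rule bij_betw_apply[OF bij_betw_inv_into[OF G_bij]])

lemma G_Ginv: "\<alpha> \<in> carrier D \<Longrightarrow> G (Ginv \<alpha>) = \<alpha>"
  unfolding Ginv_def by (rule bij_betw_inv_into_right[OF G_bij])

lemma Ginv_eqI: "\<lbrakk>x \<in> carrier L; G x = \<alpha>\<rbrakk> \<Longrightarrow> Ginv \<alpha> = x"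
  using Ginv_G by auto

text \<open>The inner product of \<open>x\<close> and \<open>y\<close> evaluates to
  \<open>G y x\<close>, so the Hermitian condition becomes a pointwise identity for
  \<open>G\<close>.\<close>

lemma G_hermitian:
  assumes "x \<in> carrier L" "y \<in> carrier L" shows "star A (G x y) = G y x"
proof -
  have "inner_product A L G x y = star A (inner_product A L G y x)"
    using hermitian assms unfolding nondegenerate_hermitian_def by blast
  then show ?thesis using assms by (simp only: inner_product_def ev_tens G_closed)
qed

lemma \<phi>_star_eq:
  assumes \<alpha>: "\<alpha> \<in> carrier D" and x: "x \<in> carrier L"
  shows "star A (\<phi> \<alpha> x) = \<phi> (G x) (Ginv \<alpha>)"
proof (rule lact_dual_faithful)
  note c = G_closed Ginv_closed star_A(1) coev_\<phi>(1) dualD(1)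
  show "star A (\<phi> \<alpha> x) \<in> carrier A" "\<phi> (G x) (Ginv \<alpha>) \<in> carrier A"
    using assms by (simp_all add: c)
  fix \<beta> assume \<beta>: "\<beta> \<in> carrier D"
  \<comment> \<open>Both functionals are written as values of \<open>G\<close>, so that actions on
    \<beta> can be moved into the argument of \<open>G\<close>, and Hermitian symmetry turns the
    star of \<open>\<alpha> z\<close> into \<open>\<beta> y\<close>.\<close>
  define z where "z = Ginv \<beta>"
  define y where "y = Ginv \<alpha>"
  have z: "z \<in> carrier L" "G z = \<beta>" and y: "y \<in> carrier L" "G y = \<alpha>"
    using \<beta> \<alpha> by (simp_all add: z_def y_def Ginv_closed G_Ginv)
  have "lact D (star A (\<phi> \<alpha> x)) \<beta> = G (ract L z (\<phi> \<alpha> x))"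
    using z \<alpha> x by (simp add: G_ract c)
  also have "\<dots> = G (lact L (\<alpha> z) x)"
    using lact_\<epsilon>_ract_\<phi>[OF z(1) \<alpha> x] by simp
  also have "\<dots> = ract D (G x) (star A (\<alpha> z))"
    using z \<alpha> x by (simp add: G_lact c)
  also have "star A (\<alpha> z) = \<beta> y"
    using G_hermitian[OF y(1) z(1)] y z by simp
  also have "ract D (G x) (\<beta> y) = lact D (\<phi> (G x) y) \<beta>"
    using lact_\<phi>_ract_\<epsilon>[of "G x" y \<beta>] x y \<beta> by (simp add: c)
  finally show "lact D (star A (\<phi> \<alpha> x)) \<beta> = lact D (\<phi> (G x) (Ginv \<alpha>)) \<beta>"
    by (simp add: y_def)
qed

sublocale star_pairing A L D \<epsilon> \<phi> Scal Pos Neg "star A" G Ginv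
proof unfold_locales
  fix x \<alpha> assume "x \<in> carrier L" "\<alpha> \<in> carrier D"
  then show "star A (\<epsilon> x \<alpha>) = \<epsilon> (Ginv \<alpha>) (G x)"
    using G_hermitian[of "Ginv \<alpha>" x] by (simp add: \<epsilon>_eq G_closed Ginv_closed G_Ginv)
next
  fix \<alpha> \<beta> assume "\<alpha> \<in> carrier D" "\<beta> \<in> carrier D"
  then show "Ginv (\<alpha> \<oplus>\<^bsub>D\<^esub> \<beta>) = Ginv \<alpha> \<oplus>\<^bsub>L\<^esub> Ginv \<beta>"
    by (intro Ginv_eqI) (simp_all add: Ginv_closed G_add G_Ginv)
next
  fix a \<alpha> assume "a \<in> carrier A" "\<alpha> \<in> carrier D"
  then show "Ginv (lact D a \<alpha>) = ract L (Ginv \<alpha>) (star A a)"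
    "Ginv (ract D \<alpha> a) = lact L (star A a) (Ginv \<alpha>)"
    by (intro Ginv_eqI; simp add: Ginv_closed G_ract G_lact G_Ginv star_A)+
qed (simp_all add: star_A G_closed G_add G_lact G_ract Ginv_closed Ginv_G G_Ginv \<phi>_star_eq)

lemma comp_star_eq:
  assumes "u \<in> carrier (M n)" shows "comp_star A L G n u = starM n u"
proof (cases n rule: M_cases)
  case 1
  then show ?thesis using assms by (auto simp: carrier_M_zero)
next
  case (2 k)
  obtain U where "u = Pos U" using M_pos_elem[OF assms 2] by blast
  then show ?thesis
    using 2 by (simp add: starM_def extP_def Lpow_eq neg_word_eq inv_f_f[OF inj_CP])
next
  case (3 k)
  obtain U where "u = Neg U" using M_neg_elem[OF assms 3] by blast
  then show ?thesis
    using 3 by (simp add: starM_def swap.extP_def Lpow_eq pos_word_eq inv_f_f[OF inj_CN] flip: Ginv_def)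
qed

end

section \<open>Assembly of the star algebra\<close>

context hermitian_line_module
begin

lemma graded: "graded_star_algebra (Lpow A L) (comp_mult A L) (comp_star A L G) (Scal \<one>)"
proof (rule graded_star_algebra.intro)
  fix n m k u u' v v' w c
  note c = comp_mult_eq comp_star_eq
  show "module complex_ring (Lpow A L n)" by (simp add: Lpow_eq M.module_E)
  show "Scal \<one> \<in> carrier (Lpow A L 0)" by (simp add: Lpow_eq)
  show "comp_mult A L n m u v \<in> carrier (Lpow A L (n + m))"
    if "u \<in> carrier (Lpow A L n)" "v \<in> carrier (Lpow A L m)"
    using that by (simp add: Lpow_eq c)
  show "comp_mult A L n m (u \<oplus>\<^bsub>Lpow A L n\<^esub> u') v = comp_mult A L n m u v \<oplus>\<^bsub>Lpow A L (n + m)\<^esub> comp_mult A L n m u' v"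
    if "u \<in> carrier (Lpow A L n)" "u' \<in> carrier (Lpow A L n)" "v \<in> carrier (Lpow A L m)"
    using that add_hom_add[OF mul_hom1, of v m u n u'] by (simp add: Lpow_eq c)
  show "comp_mult A L n m u (v \<oplus>\<^bsub>Lpow A L m\<^esub> v') = comp_mult A L n m u v \<oplus>\<^bsub>Lpow A L (n + m)\<^esub> comp_mult A L n m u v'"
    if "u \<in> carrier (Lpow A L n)" "v \<in> carrier (Lpow A L m)" "v' \<in> carrier (Lpow A L m)"
    using that by (simp add: Lpow_eq c mul_add2)
  show "comp_mult A L n m (c \<odot>\<^bsub>Lpow A L n\<^esub> u) v = c \<odot>\<^bsub>Lpow A L (n + m)\<^esub> comp_mult A L n m u v"
      "comp_mult A L n m u (c \<odot>\<^bsub>Lpow A L m\<^esub> v) = c \<odot>\<^bsub>Lpow A L (n + m)\<^esub> comp_mult A L n m u v"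
    if "u \<in> carrier (Lpow A L n)" "v \<in> carrier (Lpow A L m)"
    using that module.smult_closed[OF M.module_E, of c] by (simp_all add: Lpow_eq comp_mult_eq mul_smult)
  show "comp_mult A L (n + m) k (comp_mult A L n m u v) w = comp_mult A L n (m + k) u (comp_mult A L m k v w)"
    if "u \<in> carrier (Lpow A L n)" "v \<in> carrier (Lpow A L m)" "w \<in> carrier (Lpow A L k)"
    using that by (simp add: Lpow_eq c mul_assoc)
  show "comp_mult A L 0 n (Scal \<one>) u = u" "comp_mult A L n 0 u (Scal \<one>) = u"
    if "u \<in> carrier (Lpow A L n)"
    using that by (simp_all only: Lpow_eq comp_mult_eq S_closed A.one_closed mul_one_left mul_one_right)
  show "comp_star A L G n u \<in> carrier (Lpow A L (- n))" if "u \<in> carrier (Lpow A L n)"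
    using that by (simp add: Lpow_eq c)
  show "comp_star A L G n (u \<oplus>\<^bsub>Lpow A L n\<^esub> v) = comp_star A L G n u \<oplus>\<^bsub>Lpow A L (- n)\<^esub> comp_star A L G n v"
    if "u \<in> carrier (Lpow A L n)" "v \<in> carrier (Lpow A L n)"
    using that by (simp add: Lpow_eq c add_hom_add[OF starM_hom])
  show "comp_star A L G n (c \<odot>\<^bsub>Lpow A L n\<^esub> u) = cnj c \<odot>\<^bsub>Lpow A L (- n)\<^esub> comp_star A L G n u"
    if "u \<in> carrier (Lpow A L n)"
    using that module.smult_closed[OF M.module_E, of c] by (simp add: Lpow_eq comp_star_eq starM_smult)
  show "comp_star A L G (- n) (comp_star A L G n u) = u" if "u \<in> carrier (Lpow A L n)"
    using that by (simp add: Lpow_eq c starM_starM)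
  show "comp_star A L G (n + m) (comp_mult A L n m u v) = comp_mult A L (- m) (- n) (comp_star A L G m v) (comp_star A L G n u)"
    if "u \<in> carrier (Lpow A L n)" "v \<in> carrier (Lpow A L m)"
    using that by (simp add: Lpow_eq c starM_mul)
qed

lemma homogeneous_eq: "homogeneous A L n u = graded_star_algebra.hom (Lpow A L) n u"
  by (simp add: homogeneous_def graded_star_algebra.hom_def[OF graded])

lemma TZ_eq:
  "TZ A L G = graded_star_algebra.total (Lpow A L) (comp_mult A L) (comp_star A L G) (Scal \<one>)"
  by (simp add: TZ_def graded_star_algebra.total_def[OF graded] homogeneous_eq)

lemma star_algebra_TZ: "star_algebra (TZ A L G)"
  unfolding TZ_eq by (rule graded_star_algebra.star_algebra_total[OF graded])

lemma star_homogeneous: "star (TZ A L G) (homogeneous A L n u) = homogeneous A L (- n) (comp_star A L G n u)"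
  unfolding TZ_eq homogeneous_eq by (rule graded_star_algebra.star_hom[OF graded])

lemma star_pos_word:
  assumes "xs \<noteq> []" "set xs \<subseteq> carrier L"
  shows "comp_star A L G (int (length xs)) (pos_word A L xs) = neg_word A L (rev (map G xs))"
  using assms by (simp add: pos_word_eq neg_word_eq comp_star_eq starM_pw)

lemma star_neg_word:
  assumes "ys \<noteq> []" "set ys \<subseteq> carrier D"
  shows "comp_star A L G (- int (length ys)) (neg_word A L ys) = pos_word A L (rev (map (inv_into (carrier L) G) ys))"
proof -
  have "nw ys \<in> carrier (M (- int (length ys)))"
    using swap.pw_closed[OF assms] by (simp add: M_swap)
  then show ?thesis
    using assms by (simp add: pos_word_eq neg_word_eq comp_star_eq starM_nw flip: Ginv_def)
qed

end

lemma hermitian_line_moduleI: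
  assumes "star_algebra A" "weak_left_line_module A L" "nondegenerate_hermitian A L G"
  shows "hermitian_line_module A L G"
proof -
  have A: "calgebra A" by (rule calgebra.intro) (use assms(1) in \<open>simp add: star_algebra_def\<close>)
  have L: "bimod A L"
    by (intro bimod.intro A bimod_axioms.intro) (use assms(2) in \<open>simp add: weak_left_line_module_def\<close>)
  have "bimod A (dual A L)"
    by (intro bimod.intro A bimod_axioms.intro bimod.bimodule_dual L)
  then have "bimod_with_dual A L" by (intro bimod_with_dual.intro L)
  then have "line_module A L" by (intro line_module.intro line_module_axioms.intro assms(2))
  then show ?thesis
    by (intro hermitian_line_module.intro hermitian_line_module_axioms.intro assms(1,3))
qed

theorem proposition10p2:
  fixes A :: "'a star_alg" and L :: "('a, 'l) bimod" and G :: "'l \<Rightarrow> 'l \<Rightarrow> 'a"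
  assumes "star_algebra A"
    and "weak_left_line_module A L"
    and "nondegenerate_hermitian A L G"
  shows "star_algebra (TZ A L G) \<and>
    (\<forall>a\<in>carrier A.
       star (TZ A L G) (homogeneous A L 0 (Scal a)) = homogeneous A L 0 (Scal (star A a))) \<and>
    (\<forall>xs. xs \<noteq> [] \<and> set xs \<subseteq> carrier L \<longrightarrow>
       star (TZ A L G) (homogeneous A L (int (length xs)) (pos_word A L xs)) =
       homogeneous A L (- int (length xs)) (neg_word A L (rev (map G xs)))) \<and>
    (\<forall>ys. ys \<noteq> [] \<and> set ys \<subseteq> carrier (dual A L) \<longrightarrow>
       star (TZ A L G) (homogeneous A L (- int (length ys)) (neg_word A L ys)) =
       homogeneous A L (int (length ys)) (pos_word A L (rev (map (inv_into (carrier L) G) ys))))"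
proof -
  interpret hermitian_line_module A L G
    using assms by (rule hermitian_line_moduleI)
  show ?thesis
    using star_algebra_TZ star_pos_word star_neg_word by (simp add: star_homogeneous)
qed

end
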